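(* For all sufficiently large $d$, almost surely $T_4(\mathbb{Z}^d)$ has an infinite connected component.
   Context: Layers model: given a graph $G=(V,E)$, let $(X_v)_{v\in V}$ be i.i.d. Uniform$[0,1]$ random variables ("ages"). For an integer $k\ge1$, $T_k(G)$ is the (random) set of vertices $v$ having at most $k-1$ neighbors $u$ with $X_u<X_v$; $T_k(G)$ also denotes the subgraph of $G$ induced on this set. $\mathbb{Z}^d$ is the usual nearest-neighbor lattice graph. *)

theory Defs
  imports "HOL-Probability.Probability" "Graph_Theory.Graph_Theory"
begin

text \<open>
  Undirected simple graphs are represented by symmetric loop-free pair digraphs (locale
  \<^locale>\<open>pair_bidirected_digraph\<close>): each edge is present in both orientations.  Vertex and arc sets
  may be infinite.
\<close>

text \<open>A point of the \<open>d\<close>-dimensional lattice is a function on the \<open>d\<close> coordinates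
  \<open>0, \<dots>, d - 1\<close>; two points are adjacent iff their \<open>\<ell>\<^sub>1\<close>-distance is 1.\<close>

definition lattice_points :: "nat \<Rightarrow> (nat \<Rightarrow> int) set" where
  "lattice_points d = ({..<d} \<rightarrow>\<^sub>E UNIV)"

definition lattice_graph :: "nat \<Rightarrow> (nat \<Rightarrow> int) pair_pre_digraph" where
  "lattice_graph d =
    \<lparr> pverts = lattice_points d,
      parcs = {(x, y). x \<in> lattice_points d \<and> y \<in> lattice_points d \<and> (\<Sum>i<d. \<bar>x i - y i\<bar>) = 1} \<rparr>"

lemma pair_bidirected_digraph_lattice_graph: "pair_bidirected_digraph (lattice_graph d)"
proof
  show "symmetric (with_proj (lattice_graph d))"
    unfolding symmetric_def by (rule symI) (auto simp: lattice_graph_def abs_minus_commute)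
qed (auto simp: lattice_graph_def)

text \<open>The joint law of i.i.d. uniform ages, on the canonical product space: an outcome is the family
  of ages itself, and the age of the vertex \<open>v\<close> is the coordinate \<open>X v\<close>.\<close>

definition ages :: "'v pair_pre_digraph \<Rightarrow> ('v \<Rightarrow> real) measure" where
  "ages G = (\<Pi>\<^sub>M v\<in>pverts G. uniform_measure lborel {0..1})"

lemma prob_space_ages: "prob_space (ages G)"
  unfolding ages_def by (intro prob_space_PiM prob_space_uniform_measure) auto

definition neighbors :: "'v pair_pre_digraph \<Rightarrow> 'v \<Rightarrow> 'v set" where
  "neighbors G v = {u. (v, u) \<in> parcs G}"

text \<open>The layer \<open>T\<^sub>k(G)\<close>, for \<open>k \<ge> 1\<close>.  Finiteness is required explicitly because \<^const>\<open>card\<close> is 0 on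
  infinite sets.\<close>

definition layer_verts :: "nat \<Rightarrow> 'v pair_pre_digraph \<Rightarrow> ('v \<Rightarrow> real) \<Rightarrow> 'v set" where
  "layer_verts k G X =
    {v \<in> pverts G. finite {u \<in> neighbors G v. X u < X v} \<and>
                   card {u \<in> neighbors G v. X u < X v} \<le> k - 1}"

definition layer :: "nat \<Rightarrow> 'v pair_pre_digraph \<Rightarrow> ('v \<Rightarrow> real) \<Rightarrow> ('v, 'v \<times> 'v) pre_digraph" where
  "layer k G X = with_proj G \<restriction> layer_verts k G X"

text \<open>The name is qualified to distinguish graph connectedness from the topological notion.\<close>

definition connected_component_of_graph ::
    "('v, 'e) pre_digraph \<Rightarrow> ('v, 'e) pre_digraph \<Rightarrow> bool" where
  "connected_component_of_graph G C \<longleftrightarrow>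
    pre_digraph.max_subgraph G Digraph_Component.connected C"

end

theory Submission
  imports Defs
begin

text \<open>
  Only oriented paths are needed.  Order of magnitude \<open>1/d\<close> is the right scale for the ages of layer
  vertices, and there the number of neighbours of smaller age is asymptotically Poisson; conditionally on the
  ages along an oriented path, the event that all its vertices lie in \<open>T\<^sub>4\<close> becomes a product of Poisson
  probabilities.  Discretising the ages into 12 classes, the expected number of such paths is governed
  by a transfer matrix, whose Perron root exceeds \<open>2\<close>; since there are \<open>d\<close> oriented steps among the
  \<open>2 d\<close> neighbours, the expected number of good oriented paths grows exponentially.

  Second moment: weight the paths by the \<open>h\<close>-transform of the transfer matrix.  Two paths interact only
  when they are within bounded distance of each other.  A merged stretch costs a factor \<open>2 d\<close> per step
  divided by the matrix entry, but persists with probability \<open>1/d\<close>, so it contributes a geometric series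
  with ratio less than one; other meetings are rare because the difference of two walks is strongly
  transient in high dimension.  Both effects are encoded in one supermartingale.  Hence good paths of every
  length exist with probability bounded below, and Kolmogorov's zero-one law, applied to the
  sigma-algebras of the levels (the sum of the coordinates), finishes the proof.
\<close>

section \<open>A potential for the difference of two walks\<close>

text \<open>The growth inequality serves twice. Merged paths choose the same direction with
  probability \<open>1 / d\<close>, and the probability ratio gains \<open>2 d / w\<close>. Under
  the \<open>h\<close>-transform, where the next class \<open>l\<close> has probability
  \<open>p(l) = w(l) h(l) / T\<close> with \<open>T\<close> the row sum of \<open>w h\<close>, the
  sum of \<open>p(l)^2 * 2 / (w(l) h(l))\<close> over \<open>l\<close> collapses to
  \<open>2 / T\<close>. So \<open>T \<ge> 2 \<mu> h\<close> makes the expected number of paths grow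
  and also makes merged stretches contract by \<open>1 / \<mu>\<close>.

  The bit in the type is forced by the age order: the number of private neighbours that may be
  younger depends on both path neighbours, but on the predecessor only through one comparison of
  classes. This keeps the chain of types finite.

  The constants are not circular: the limit matrix alone fixes the cost \<open>C\<close> of a near
  meeting, \<open>C\<close> fixes the exponent \<open>s\<close> of the potential, and only then is
  \<open>d\<close> taken large.\<close>

definition sqnorm :: "nat \<Rightarrow> (nat \<Rightarrow> int) \<Rightarrow> int" where
  "sqnorm d D = (\<Sum>i<d. (D i)\<^sup>2)"

definition shift_diff :: "(nat \<Rightarrow> int) \<Rightarrow> nat \<Rightarrow> nat \<Rightarrow> nat \<Rightarrow> int" where
  "shift_diff D a b = (\<lambda>i. D i - of_bool (i = a) + of_bool (i = b))"

lemma sqnorm_nonneg: "0 \<le> sqnorm d D"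
  by (simp add: sqnorm_def sum_nonneg)

lemma sqnorm_eq_0_iff: "sqnorm d D = 0 \<longleftrightarrow> (\<forall>i<d. D i = 0)"
  by (auto simp: sqnorm_def sum_nonneg_eq_0_iff)

lemma sqnorm_shift_diff:
  assumes "a < d" "b < d" "a \<noteq> b"
  shows "sqnorm d (shift_diff D a b) = sqnorm d D + 2 + 2 * (D b - D a)"
proof -
  have "(shift_diff D a b i)\<^sup>2 = (D i)\<^sup>2 + (if i = a then 1 - 2 * D a else 0) + (if i = b then 1 + 2 * D b else 0)"
    for i using assms by (auto simp: shift_diff_def power2_eq_square algebra_simps)
  then show ?thesis
    using assms by (simp add: sqnorm_def sum.distrib algebra_simps)
qed

lemma sqnorm_shift_diff_same: "sqnorm d (shift_diff D a a) = sqnorm d D"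
  by (simp add: sqnorm_def shift_diff_def)

lemma diff_sq_le_sqnorm:
  assumes "a < d" "b < d"
  shows "(D b - D a)\<^sup>2 \<le> 2 * sqnorm d D"
proof (cases "a = b")
  case True then show ?thesis using sqnorm_nonneg[of d D] by simp
next
  case False
  have "(D b)\<^sup>2 + (D a)\<^sup>2 = (\<Sum>i\<in>{a,b}. (D i)\<^sup>2)" using False by simp
  also have "\<dots> \<le> sqnorm d D"
    unfolding sqnorm_def using assms by (intro sum_mono2) auto
  finally have "(D b)\<^sup>2 + (D a)\<^sup>2 \<le> sqnorm d D" .
  moreover have "(D b - D a)\<^sup>2 \<le> 2 * ((D b)\<^sup>2 + (D a)\<^sup>2)"
    using zero_le_power2[of "D b + D a"] by (simp add: power2_eq_square algebra_simps)
  ultimately show ?thesis by (meson mult_left_mono order_trans zero_le_numeral)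
qed

section \<open>One-step mean of an inverse power of the distance\<close>

lemma inverse_power_second_order:
  "\<exists>C\<ge>0. \<forall>u::real. \<bar>u\<bar> \<le> 1/2 \<longrightarrow> inverse ((1 + u) ^ s) \<le> 1 - real s * u + C * u\<^sup>2"
proof (induction s)
  case 0 then show ?case by (auto intro: exI[of _ 0])
next
  case (Suc s)
  then obtain C where C: "C \<ge> 0"
    and *: "\<And>u::real. \<bar>u\<bar> \<le> 1/2 \<Longrightarrow> inverse ((1 + u) ^ s) \<le> 1 - real s * u + C * u\<^sup>2" by blast
  show ?case
  proof (intro exI[of _ "3 * C + 2 * real s + 2"] conjI allI impI)
    fix u :: real assume u: "\<bar>u\<bar> \<le> 1/2"
    have "1 \<le> (1 - u + 2 * u\<^sup>2) * (1 + u)"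
    proof -
      have "(1 - u + 2 * u\<^sup>2) * (1 + u) = 1 + u\<^sup>2 * (1 + 2 * u)"
        by (simp add: algebra_simps power2_eq_square)
      then show ?thesis using u by simp
    qed
    then have i: "inverse (1 + u) \<le> 1 - u + 2 * u\<^sup>2"
      using u by (simp add: inverse_eq_divide pos_divide_le_eq)
    have "inverse ((1 + u) ^ Suc s) = inverse ((1 + u) ^ s) * inverse (1 + u)" by simp
    also have "\<dots> \<le> (1 - real s * u + C * u\<^sup>2) * (1 - u + 2 * u\<^sup>2)"
      using *[OF u] i u by (intro mult_mono) (auto intro: order_trans[OF _ *[OF u]])
    also have "\<dots> = 1 - real (Suc s) * u + u\<^sup>2 * (C + real s + 2 - (C + 2 * real s) * u + 2 * C * u\<^sup>2)"
      by (simp add: algebra_simps power2_eq_square)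
    also have "\<dots> \<le> 1 - real (Suc s) * u + u\<^sup>2 * (3 * C + 2 * real s + 2)"
    proof -
      have "- (C + 2 * real s) * u \<le> (C + 2 * real s) * (1/2)"
        using u C by (metis abs_le_D2 minus_mult_commute mult_left_mono add_nonneg_nonneg mult_nonneg_nonneg of_nat_0_le_iff zero_le_numeral)
      moreover have "u\<^sup>2 \<le> 1/4" using u power_mono[of "\<bar>u\<bar>" "1/2" 2] by (simp add: power2_eq_square)
      then have "2 * C * u\<^sup>2 \<le> 2 * C * (1/4)" using C by (intro mult_left_mono) auto
      ultimately have "C + real s + 2 - (C + 2 * real s) * u + 2 * C * u\<^sup>2 \<le> 3 * C + 2 * real s + 2"
        using C by (simp add: algebra_simps)
      then show ?thesis by (intro add_left_mono mult_left_mono) auto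
    qed
    finally show "inverse ((1 + u) ^ Suc s) \<le> 1 - real (Suc s) * u + (3 * C + 2 * real s + 2) * u\<^sup>2"
      by (simp add: mult.commute)
  qed (use C in auto)
qed

text \<open>A power of the distance, as for a Green's function. The offset 8 keeps the linear part
  \<open>2 * (D b - D a)\<close> of a step below half of the shifted norm \<open>R + 10\<close>, so
  one Taylor bound covers all \<open>D\<close>, including those near 0.\<close>

definition potential :: "nat \<Rightarrow> int \<Rightarrow> real" where
  "potential s R = inverse ((real_of_int R + 8) ^ s)"

text \<open>A pair \<open>a = b\<close> keeps the norm. Otherwise the norm grows by 2 plus the
  antisymmetric term \<open>2 * (D b - D a)\<close>, whose first-order contribution cancels in the
  double sum. The squared differences sum to at most \<open>4 * d * R\<close>, which leaves a
  relative error of order \<open>1 / (d * (R + 10))\<close>.\<close>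

lemma potential_mean_le:
  "\<exists>C\<ge>0. \<forall>d>0. \<forall>D. (\<Sum>a<d. \<Sum>b<d. potential s (sqnorm d (shift_diff D a b)) / (real d)\<^sup>2)
    \<le> potential s (sqnorm d D) / real d
      + (1 - 1 / real d + C / (real d * (real_of_int (sqnorm d D) + 10))) * potential s (sqnorm d D + 2)"
proof -
  obtain C0 where C0: "C0 \<ge> 0"
    and *: "\<And>u::real. \<bar>u\<bar> \<le> 1/2 \<Longrightarrow> inverse ((1 + u) ^ s) \<le> 1 - real s * u + C0 * u\<^sup>2"
    using inverse_power_second_order by blast
  show ?thesis
  proof (intro exI[of _ "16 * C0"] conjI allI impI)
    fix d :: nat and D :: "nat \<Rightarrow> int"
    assume d: "d > 0"
    define R where "R = real_of_int (sqnorm d D)"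
    define T where "T = R + 10"
    define p where "p = potential s (sqnorm d D + 2)"
    define p0 where "p0 = potential s (sqnorm d D)"
    have R: "R \<ge> 0" by (simp add: R_def sqnorm_nonneg)
    then have T: "T > 0" by (simp add: T_def)
    have p: "p = inverse (T ^ s)" by (simp add: p_def potential_def T_def R_def algebra_simps)
    then have p_pos: "p > 0" using T by simp
    define Y where "Y a b = real_of_int (D b - D a)" for a b
    define F where "F a b = p * (1 - real s * (2 * Y a b / T) + C0 * (2 * Y a b / T)\<^sup>2)" for a b
    have Y_sq: "(Y a b)\<^sup>2 \<le> 2 * R" if "a < d" "b < d" for a b
    proof -
      have "real_of_int ((D b - D a)\<^sup>2) \<le> real_of_int (2 * sqnorm d D)"
        using diff_sq_le_sqnorm[OF that, of D] by (simp only: of_int_le_iff)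
      then show ?thesis by (simp add: Y_def R_def)
    qed
    have off: "potential s (sqnorm d (shift_diff D a b)) \<le> F a b" if ab: "a < d" "b < d" "a \<noteq> b" for a b
    proof -
      define u where "u = 2 * Y a b / T"
      have "(4 * Y a b)\<^sup>2 \<le> 32 * R" using Y_sq[OF ab(1,2)] by (simp add: power_mult_distrib)
      also have "\<dots> \<le> T\<^sup>2"
      proof -
        have "0 \<le> (R - 6)\<^sup>2 + 64" by simp
        then show ?thesis by (simp add: T_def power2_eq_square algebra_simps)
      qed
      finally have "\<bar>4 * Y a b\<bar> \<le> T" using T abs_le_square_iff[of "4 * Y a b" T] by simp
      then have u: "\<bar>u\<bar> \<le> 1/2" using T by (simp add: u_def abs_divide field_simps abs_mult)
      have "real_of_int (sqnorm d (shift_diff D a b)) + 8 = T * (1 + u)"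
        using T by (simp add: sqnorm_shift_diff[OF ab] u_def T_def R_def Y_def field_simps)
      then have "potential s (sqnorm d (shift_diff D a b)) = p * inverse ((1 + u) ^ s)"
        by (simp add: potential_def p power_mult_distrib)
      also have "\<dots> \<le> p * (1 - real s * u + C0 * u\<^sup>2)"
        using *[OF u] p_pos by (intro mult_left_mono) auto
      finally show ?thesis by (simp add: F_def u_def)
    qed
    \<comment> \<open>\<open>F\<close> equals \<open>p\<close> on the diagonal, while the true value
      there is \<open>p0\<close>; the difference is added back.\<close>
    have "(\<Sum>a<d. \<Sum>b<d. potential s (sqnorm d (shift_diff D a b)))
        \<le> (\<Sum>a<d. \<Sum>b<d. F a b + (if a = b then p0 - p else 0))"
      using off by (intro sum_mono) (auto simp: sqnorm_shift_diff_same p0_def F_def Y_def)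
    also have "\<dots> = (\<Sum>a<d. \<Sum>b<d. F a b) + real d * (p0 - p)"
      by (simp add: sum.distrib)
    also have "(\<Sum>a<d. \<Sum>b<d. F a b) = (real d)\<^sup>2 * p + (2 * real s / T * p) * (\<Sum>a<d. \<Sum>b<d. - Y a b)
        + (4 * C0 / T\<^sup>2 * p) * (\<Sum>a<d. \<Sum>b<d. (Y a b)\<^sup>2)"
    proof -
      have "F a b = p + (2 * real s / T * p) * (- Y a b) + (4 * C0 / T\<^sup>2 * p) * (Y a b)\<^sup>2" for a b
        by (simp add: F_def algebra_simps power_divide power_mult_distrib)
      then show ?thesis by (simp only: sum.distrib sum_distrib_left) (simp add: power2_eq_square)
    qed
    also have "(\<Sum>a<d. \<Sum>b<d. - Y a b) = 0"
      by (simp add: Y_def sum_negf sum_subtractf sum_distrib_left)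
    finally have A: "(\<Sum>a<d. \<Sum>b<d. potential s (sqnorm d (shift_diff D a b)))
      \<le> (real d)\<^sup>2 * p + (2 * real s / T * p) * 0 + (4 * C0 / T\<^sup>2 * p) * (\<Sum>a<d. \<Sum>b<d. (Y a b)\<^sup>2) + real d * (p0 - p)" .
    have B: "(\<Sum>a<d. \<Sum>b<d. (Y a b)\<^sup>2) \<le> 4 * real d * R"
    proof -
      have "(Y a b)\<^sup>2 \<le> 2 * ((real_of_int (D a))\<^sup>2 + (real_of_int (D b))\<^sup>2)" for a b
        using zero_le_power2[of "real_of_int (D a + D b)"] by (simp add: Y_def power2_eq_square algebra_simps)
      then have "(\<Sum>a<d. \<Sum>b<d. (Y a b)\<^sup>2) \<le> (\<Sum>a<d. \<Sum>b<d. 2 * ((real_of_int (D a))\<^sup>2 + (real_of_int (D b))\<^sup>2))"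
        by (intro sum_mono)
      also have "\<dots> = 4 * real d * R"
        by (simp add: sum.distrib sum_distrib_left[symmetric] R_def sqnorm_def)
      finally show ?thesis .
    qed
    have "(4 * C0 / T\<^sup>2 * p) * (\<Sum>a<d. \<Sum>b<d. (Y a b)\<^sup>2) \<le> (4 * C0 / T\<^sup>2 * p) * (4 * real d * R)"
      using C0 p_pos by (intro mult_left_mono B) auto
    with A have "(\<Sum>a<d. \<Sum>b<d. potential s (sqnorm d (shift_diff D a b)))
        \<le> (real d)\<^sup>2 * p + (4 * C0 / T\<^sup>2 * p) * (4 * real d * R) + real d * (p0 - p)"
      by linarith
    also have "(4 * C0 / T\<^sup>2 * p) * (4 * real d * R) \<le> 16 * C0 / T * p * real d"
    proof -
      have "(4 * C0 / T\<^sup>2 * p) * (4 * real d * R) = (16 * C0 / T * p * real d) * (R / T)"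
        by (simp add: power2_eq_square)
      also have "\<dots> \<le> (16 * C0 / T * p * real d) * 1"
        using C0 T p_pos R by (intro mult_left_mono) (auto simp: T_def)
      finally show ?thesis by simp
    qed
    finally have "(\<Sum>a<d. \<Sum>b<d. potential s (sqnorm d (shift_diff D a b)))
        \<le> (real d)\<^sup>2 * p + 16 * C0 / T * p * real d + real d * (p0 - p)" by simp
    then have "(\<Sum>a<d. \<Sum>b<d. potential s (sqnorm d (shift_diff D a b))) / (real d)\<^sup>2
        \<le> ((real d)\<^sup>2 * p + 16 * C0 / T * p * real d + real d * (p0 - p)) / (real d)\<^sup>2"
      by (intro divide_right_mono) auto
    also have "\<dots> = p0 / real d + (1 - 1 / real d + 16 * C0 / (real d * T)) * p"
      using d T by (simp add: field_simps power2_eq_square)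
    finally show "(\<Sum>a<d. \<Sum>b<d. potential s (sqnorm d (shift_diff D a b)) / (real d)\<^sup>2)
    \<le> potential s (sqnorm d D) / real d
      + (1 - 1 / real d + 16 * C0 / (real d * (real_of_int (sqnorm d D) + 10))) * potential s (sqnorm d D + 2)"
      by (simp add: sum_divide_distrib p_def p0_def T_def R_def)
  qed (use C0 in auto)
qed

lemma potential_pos: "R \<ge> 0 \<Longrightarrow> potential s R > 0"
  by (simp add: potential_def)

lemma potential_antimono: "0 \<le> R \<Longrightarrow> R \<le> R' \<Longrightarrow> potential s R' \<le> potential s R"
  unfolding potential_def by (intro le_imp_inverse_le power_mono) auto

definition mean_potential :: "nat \<Rightarrow> nat \<Rightarrow> (nat \<Rightarrow> int) \<Rightarrow> real" where
  "mean_potential s d D = (\<Sum>a<d. \<Sum>b<d. potential s (sqnorm d (shift_diff D a b)) / (real d)\<^sup>2)"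

text \<open>The deterministic growth of the norm by 2 multiplies the potential by
  \<open>((R + 8) / (R + 10)) ^ s\<close>, at most \<open>1 - 2 / (R + 10)\<close>; for large
  \<open>d\<close> this beats the error \<open>K / (d * (R + 10))\<close>. For
  \<open>R \<le> 16\<close> the base is at most \<open>12/13\<close>, so a large \<open>s\<close>
  gains any prescribed factor. As \<open>K\<close> depends on \<open>s\<close>, the bound on
  \<open>d\<close> is chosen after \<open>s\<close>.\<close>

lemma potential_superharmonic:
  fixes C :: real
  assumes C: "C > 0"
  shows "\<exists>s d\<^sub>0. \<forall>d\<ge>d\<^sub>0. \<forall>D. mean_potential s d D \<le> potential s (sqnorm d D) \<and>
    (sqnorm d D \<le> 16 \<longrightarrow> 2 * C * mean_potential s d D \<le> potential s (sqnorm d D))"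
proof -
  obtain s0 where s0: "(12/13::real) ^ s0 < 1 / (4 * C)"
    using real_arch_pow_inv[of "1 / (4 * C)" "12/13"] C by auto
  define s where "s = Suc s0"
  have s: "(12/13::real) ^ s \<le> 1 / (4 * C)"
  proof -
    have "(12/13::real) ^ s \<le> (12/13) ^ s0" by (intro power_decreasing) (auto simp: s_def)
    with s0 show ?thesis by linarith
  qed
  obtain K where K: "K \<ge> 0" and *: "\<And>d D. d > 0 \<Longrightarrow> mean_potential s d D
    \<le> potential s (sqnorm d D) / real d
      + (1 - 1 / real d + K / (real d * (real_of_int (sqnorm d D) + 10))) * potential s (sqnorm d D + 2)"
    using potential_mean_le[of s] unfolding mean_potential_def by blast
  show ?thesis
  proof (rule exI[of _ s], rule exI[of _ "nat \<lceil>4 * C + K + 2\<rceil>"], intro allI impI)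
    fix d D assume "nat \<lceil>4 * C + K + 2\<rceil> \<le> d"
    then have d': "real d \<ge> 4 * C + K + 2" by linarith
    then have d: "real d \<ge> 2" "d > 0" using C K by (linarith, auto intro: gr0I)
    define R where "R = real_of_int (sqnorm d D)"
    have R: "R \<ge> 0" by (simp add: R_def sqnorm_nonneg)
    define p where "p = potential s (sqnorm d D)"
    define p2 where "p2 = potential s (sqnorm d D + 2)"
    define x where "x = (R + 8) / (R + 10)"
    have x: "0 < x" "x \<le> 1 - 2 / (R + 10)" using R by (auto simp: x_def field_simps)
    have p: "p > 0" using potential_pos[OF sqnorm_nonneg] by (simp add: p_def)
    have p2: "p2 = x ^ s * p" using R by (simp add: p2_def p_def potential_def x_def R_def power_divide field_simps)
    have x_s: "x ^ s \<le> x"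
    proof -
      have "x \<le> 1" using x(2) R by (smt (verit) divide_nonneg_nonneg)
      then show ?thesis unfolding s_def using x(1) by (simp add: power_le_one mult_left_le)
    qed
    have le: "mean_potential s d D \<le> p / real d + (1 - 1 / real d + K / (real d * (R + 10))) * p2"
      using *[OF d(2), of D] by (simp add: p_def p2_def R_def)
    have nonneg: "0 \<le> 1 - 1 / real d + K / (real d * (R + 10))"
      using d K R by (intro add_nonneg_nonneg) auto
    have "(1 - 1 / real d + K / (real d * (R + 10))) * x ^ s \<le> 1 - 1 / real d"
    proof -
      have "(1 - 1 / real d + K / (real d * (R + 10))) * x ^ s
          \<le> (1 - 1 / real d + K / (real d * (R + 10))) * (1 - 2 / (R + 10))"
        using nonneg x x_s by (intro mult_left_mono) auto
      also have "\<dots> \<le> 1 - 1 / real d"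
      proof -
        have "K + 1 \<le> real d" using d' C by linarith
        then have "K / real d \<le> 2 * (1 - 1 / real d)" using d by (simp add: field_simps)
        then have "K / real d * (1 - 2 / (R + 10)) \<le> 2 * (1 - 1 / real d) * 1"
          using K d R by (intro mult_mono) (auto simp: field_simps)
        then have "(K / real d * (1 - 2 / (R + 10)) - 2 * (1 - 1 / real d)) / (R + 10) \<le> 0"
          using R by (simp add: divide_nonpos_pos)
        moreover have "(1 - 1 / real d + K / (real d * (R + 10))) * (1 - 2 / (R + 10)) =
          1 - 1 / real d + (K / real d * (1 - 2 / (R + 10)) - 2 * (1 - 1 / real d)) / (R + 10)"
          using R d by (simp add: divide_simps) (simp add: algebra_simps)
        ultimately show ?thesis by linarith
      qed
      finally show ?thesis .
    qed
    then have "(1 - 1 / real d + K / (real d * (R + 10))) * p2 \<le> (1 - 1 / real d) * p"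
      unfolding p2 using p by (simp add: mult.assoc[symmetric])
    with le have 1: "mean_potential s d D \<le> p" by (simp add: algebra_simps)
    have 2: "2 * C * mean_potential s d D \<le> p" if near: "sqnorm d D \<le> 16"
    proof -
      have "R \<le> 16" using near by (simp add: R_def)
      then have "x \<le> 12/13" using R by (simp add: x_def field_simps)
      then have "x ^ s \<le> 1 / (4 * C)" using x(1) s by (intro order_trans[OF power_mono s]) auto
      then have p2': "p2 \<le> 1 / (4 * C) * p" unfolding p2 using p by (intro mult_right_mono) auto
      have "K / (real d * (R + 10)) \<le> K / real d"
        using K d R by (intro divide_left_mono mult_pos_pos) (auto simp: mult_le_cancel_left1)
      then have "1 - 1 / real d + K / (real d * (R + 10)) \<le> 1 + K / real d"
        using d by (smt (verit) divide_nonneg_nonneg)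
      then have "(1 - 1 / real d + K / (real d * (R + 10))) * p2 \<le> (1 + K / real d) * (1 / (4 * C) * p)"
        using p2' C p nonneg K d x p2 by (intro mult_mono) auto
      with le have "mean_potential s d D \<le> p / real d + (1 + K / real d) * (1 / (4 * C) * p)" by linarith
      also have "\<dots> = p * ((4 * C + K) / real d + 1) / (4 * C)" using C d by (simp add: field_simps)
      also have "\<dots> \<le> p * 2 / (4 * C)"
        using p C d d' by (intro divide_right_mono mult_left_mono) (auto simp: field_simps)
      finally show ?thesis using C by (simp add: field_simps)
    qed
    show "mean_potential s d D \<le> potential s (sqnorm d D) \<and>
    (sqnorm d D \<le> 16 \<longrightarrow> 2 * C * mean_potential s d D \<le> potential s (sqnorm d D))"
      using 1 2 by (simp add: p_def)
  qed
qed

text \<open>With \<open>R\<close> the squared norm, a move to 0 requires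
  \<open>2 * (D a - D b) = R + 2\<close>, and \<open>(D b - D a)^2 \<le> 2 * R\<close> then turns
  into \<open>(R - 2)^2 \<le> 0\<close>. In particular, paths beyond the threshold 16 cannot meet in
  one step.\<close>

lemma shift_diff_zero_sqnorm:
  assumes "a < d" "b < d" "sqnorm d (shift_diff D a b) = 0" "sqnorm d D > 0"
  shows "sqnorm d D = 2"
proof -
  define R where "R = sqnorm d D"
  have "a \<noteq> b" using assms sqnorm_shift_diff_same[of d D a] by auto
  then have "R + 2 + 2 * (D b - D a) = 0" using sqnorm_shift_diff[of a d b D] assms by (simp add: R_def)
  then have "(R + 2)\<^sup>2 = 4 * (D b - D a)\<^sup>2" by (simp add: power2_eq_square algebra_simps) algebra
  also have "\<dots> \<le> 8 * R" using diff_sq_le_sqnorm[of a d b D] assms by (simp add: R_def)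
  finally have "(R - 2)\<^sup>2 \<le> 0" by (simp add: power2_eq_square algebra_simps)
  then show ?thesis by (simp add: R_def)
qed

text \<open>A meeting determines both directions, so its probability is at most
  \<open>1 / d^2\<close>. A cost of order \<open>d\<close> at each meeting therefore contributes
  only \<open>O(1 / d)\<close>.\<close>

lemma sum_shift_diff_zero_le:
  assumes "sqnorm d D > 0"
  shows "(\<Sum>a<d. \<Sum>b<d. of_bool (sqnorm d (shift_diff D a b) = 0)) \<le> (1::real)"
proof -
  have eq: "a = a' \<and> b = b'"
    if "a < d" "b < d" "a' < d" "b' < d" "sqnorm d (shift_diff D a b) = 0" "sqnorm d (shift_diff D a' b') = 0"
    for a b a' b'
  proof -
    have ne: "a \<noteq> b" "a' \<noteq> b'"
      using that assms sqnorm_shift_diff_same[of d D] by auto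
    have 1: "D i = of_bool (i = a) - of_bool (i = b)" if "i < d" for i
      using \<open>sqnorm d (shift_diff D a b) = 0\<close> that by (auto simp: sqnorm_eq_0_iff shift_diff_def)
    have 2: "D i = of_bool (i = a') - of_bool (i = b')" if "i < d" for i
      using \<open>sqnorm d (shift_diff D a' b') = 0\<close> that by (auto simp: sqnorm_eq_0_iff shift_diff_def)
    show ?thesis using 1[of a] 2[of a] 1[of b] 2[of b] ne that by (auto split: if_splits simp: of_bool_def)
  qed
  define Z where "Z = {p \<in> {..<d} \<times> {..<d}. sqnorm d (shift_diff D (fst p) (snd p)) = 0}"
  have "card Z \<le> 1"
    using eq unfolding Z_def by (intro card_le_Suc0_iff_eq[THEN iffD2, THEN order_trans]) auto
  moreover have "(\<Sum>a<d. \<Sum>b<d. of_bool (sqnorm d (shift_diff D a b) = 0)) = real (card Z)"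
    unfolding sum.cartesian_product Z_def by (simp add: of_bool_def sum.If_cases Int_def split_beta)
  ultimately show ?thesis by simp
qed

section \<open>Pairs of random typed paths\<close>

text \<open>A vertex of a typed path has a class \<open>k\<close> and a bit \<open>b\<close>, which says whether the class of its predecessor
  is at most \<open>k\<close>.  The weight \<open>w b k l\<close> is \<open>2 d\<close> times the probability of a vertex of this type whose
  successor has class \<open>l\<close>, and \<open>h\<close> is an approximate right eigenvector of the transfer matrix.  The \<open>2\<close> in
  \<open>growth\<close> accounts for the \<open>d\<close> oriented directions among the \<open>2 d\<close> neighbours.\<close>

locale class_chain =
  fixes N :: nat and w :: "bool \<Rightarrow> nat \<Rightarrow> nat \<Rightarrow> real" and h :: "bool \<Rightarrow> nat \<Rightarrow> real" and \<mu> :: real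
  assumes w_pos: "k < N \<Longrightarrow> l < N \<Longrightarrow> w b k l > 0"
    and h_pos: "k < N \<Longrightarrow> h b k > 0"
    and \<mu>: "\<mu> > 1"
    and growth: "k < N \<Longrightarrow> 2 * \<mu> * h b k \<le> (\<Sum>l<N. w b k l * h (k \<le> l) l)"
begin

text \<open>The Doob transform of \<open>w\<close> by \<open>h\<close>. It is normalised by the
  exact row sum because \<open>h\<close> satisfies only an inequality.\<close>

definition trans_prob :: "bool \<Rightarrow> nat \<Rightarrow> nat \<Rightarrow> real" where
  "trans_prob b k l = w b k l * h (k \<le> l) l / (\<Sum>j<N. w b k j * h (k \<le> j) j)"

text \<open>The factor by which one time step can change the ratio \<open>P(E \<inter> E') / (P(E) P(E'))\<close> for two typed paths
  whose current positions differ by \<open>D\<close>.  Neighbourhoods can only meet when the positions are at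
  \<open>\<ell>\<^sub>1\<close>-distance at most 4, whence the threshold 16 for the squared Euclidean norm.\<close>

definition overlap_factor :: "real \<Rightarrow> nat \<Rightarrow> (nat \<Rightarrow> int) \<Rightarrow> nat \<Rightarrow> bool \<Rightarrow> nat \<Rightarrow> nat \<Rightarrow> real" where
  "overlap_factor C d D k b' k' l' =
    (if sqnorm d D > 16 then 1 else if sqnorm d D > 0 then C
     else if k = k' then 2 * real d / w b' k' l' else 0)"

lemma total_pos: "k < N \<Longrightarrow> 0 < (\<Sum>l<N. w b k l * h (k \<le> l) l)"
  using growth[of k b] h_pos[of k b] \<mu> by (smt (verit) mult_pos_pos)

lemma trans_prob_nonneg: "k < N \<Longrightarrow> l < N \<Longrightarrow> trans_prob b k l \<ge> 0"
  using total_pos[of k b] w_pos[of k l b] h_pos[of l "k \<le> l"] by (simp add: trans_prob_def)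

lemma sum_trans_prob: "k < N \<Longrightarrow> (\<Sum>l<N. trans_prob b k l) = 1"
  using total_pos[of k b] by (simp add: trans_prob_def sum_divide_distrib[symmetric])

lemma pair_mean_le:
  assumes "k < N" "k' < N" "\<And>l l'. l < N \<Longrightarrow> l' < N \<Longrightarrow> G l l' \<le> B"
  shows "(\<Sum>l<N. \<Sum>l'<N. trans_prob b k l * trans_prob b' k' l' * G l l') \<le> B"
proof -
  have "(\<Sum>l<N. \<Sum>l'<N. trans_prob b k l * trans_prob b' k' l' * G l l')
      \<le> (\<Sum>l<N. \<Sum>l'<N. trans_prob b k l * trans_prob b' k' l' * B)"
    using assms by (intro sum_mono mult_left_mono mult_nonneg_nonneg trans_prob_nonneg) auto
  also have "\<dots> = (\<Sum>l<N. trans_prob b k l * B)"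
    using sum_trans_prob[OF assms(2)]
    by (simp add: sum_distrib_left[symmetric] sum_distrib_right[symmetric] mult.assoc)
  also have "\<dots> = B" using sum_trans_prob[OF assms(1)] by (simp add: sum_distrib_right[symmetric])
  finally show ?thesis .
qed

text \<open>On coinciding positions with equal types the function is \<open>K d / h\<close>, which the eigenvector inequality
  contracts by \<open>1 / \<mu>\<close>.  If only the bits differ (the paths have just met) it is \<open>K' d\<close> with a larger \<open>K'\<close>;
  this lasts for one step, since afterwards the bits agree or the classes differ.\<close>

lemma lyapunov_exists:
  assumes C: "C > 0"
  shows "\<exists>d\<^sub>0. \<forall>d\<ge>d\<^sub>0. \<exists>g. (\<forall>D b k b' k'. g D b k b' k' \<ge> 1) \<and>
    (\<forall>D b b'. \<forall>k<N. \<forall>k'<N.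
      (\<Sum>a<d. \<Sum>a'<d. \<Sum>l<N. \<Sum>l'<N. trans_prob b k l * trans_prob b' k' l' / (real d)\<^sup>2 *
         (overlap_factor C d D k b' k' l' * g (shift_diff D a a') (k \<le> l) l (k' \<le> l') l')) \<le> (g D b k b' k' :: real))"
proof -
  have fin: "finite (UNIV \<times> {..<N} \<times> {..<N} :: (bool \<times> nat \<times> nat) set)" by simp
  obtain \<rho> where \<rho>: "\<rho> > 0" "\<And>b k l. k < N \<Longrightarrow> l < N \<Longrightarrow> \<rho> \<le> w b k l"
  proof -
    define S where "S = insert 1 ((\<lambda>(b, k, l). w b k l) ` (UNIV \<times> {..<N} \<times> {..<N}))"
    have "finite S" "S \<noteq> {}" by (simp_all add: S_def)
    then show ?thesis using w_pos
      by (intro that[of "Min S"]) (auto simp: S_def intro!: Min_le, force)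
  qed
  obtain \<eta> where \<eta>: "\<eta> > 0" "\<And>b k. k < N \<Longrightarrow> \<eta> \<le> h b k"
  proof -
    define S where "S = insert 1 ((\<lambda>(b, k). h b k) ` (UNIV \<times> {..<N}))"
    have "finite S" "S \<noteq> {}" by (simp_all add: S_def)
    then show ?thesis using h_pos
      by (intro that[of "Min S"]) (auto simp: S_def intro!: Min_le)
  qed
  obtain H where H: "H > 0" "\<And>b k. k < N \<Longrightarrow> h b k \<le> H"
  proof -
    define S where "S = insert 1 ((\<lambda>(b, k). h b k) ` (UNIV \<times> {..<N}))"
    have "finite S" "S \<noteq> {}" "1 \<in> S" by (simp_all add: S_def)
    then have "1 \<le> Max S" by simp
    moreover have "h b k \<le> Max S" if "k < N" for b k
      using that \<open>finite S\<close> by (intro Max_ge) (auto simp: S_def)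
    ultimately show ?thesis by (intro that[of "Max S"]) auto
  qed
  obtain s d1 where s: "\<And>d D. d \<ge> d1 \<Longrightarrow> mean_potential s d D \<le> potential s (sqnorm d D)"
    "\<And>d D. d \<ge> d1 \<Longrightarrow> sqnorm d D \<le> 16 \<Longrightarrow> 2 * C * mean_potential s d D \<le> potential s (sqnorm d D)"
    using potential_superharmonic[OF C] by blast
  \<comment> \<open>In the near case \<open>C * (1 + A * M + K' / d) \<le> 1 + A * P\<close> is
    needed, with \<open>P\<close> the potential and \<open>M\<close> its mean. Half of
    \<open>A * P\<close> pays for \<open>C * A * M\<close>, since \<open>2 * C * M \<le> P\<close>.
    The other half is at least \<open>2 * C\<close> by this choice of \<open>A\<close> and pays for
    the rest.\<close>
  define A where "A = 4 * C / potential s 16"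
  have A: "A > 0" using C by (simp add: A_def potential_pos)
  define g2 where "g2 = 1 + A * potential s 2"
  have g2: "g2 > 1" using A by (simp add: g2_def potential_pos)
  \<comment> \<open>Solves \<open>H * (2 / \<rho>) * (1 + g2) = K * (1 - 1 / \<mu>)\<close>: what
    the contraction leaves free must cover, per unit of \<open>d\<close>, a change of class
    (\<open>2 / \<rho>\<close>) and a split of the paths (\<open>2 / \<rho> * g2\<close>).\<close>
  define K where "K = H * (2 / \<rho>) * (1 + g2) * \<mu> / (\<mu> - 1)"
  have K: "K > 0" using H(1) \<rho>(1) g2 \<mu> by (simp add: K_def)
  \<comment> \<open>The first summand pays for the step after a meeting with unequal bits; the rest
    makes \<open>K' * d\<close> dominate every value of \<open>g\<close> on merged
    positions.\<close>
  define K' where "K' = (2 / \<rho>) * (K / \<eta> + 1 + g2) + K / \<eta> + 1"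
  have K': "K' > 1" "K / \<eta> \<le> K'" using K \<eta>(1) \<rho>(1) g2 by (auto simp: K'_def add_pos_pos add_nonneg_pos)
  show ?thesis
  proof (intro exI[of _ "max d1 (nat \<lceil>K' + 1 + H / K\<rceil>)"] allI impI)
    fix d assume "max d1 (nat \<lceil>K' + 1 + H / K\<rceil>) \<le> d"
    then have d1: "d1 \<le> d" and "K' + 1 + H / K \<le> real d" by (simp, linarith)
    moreover have "H / K > 0" using H K by simp
    ultimately have dK: "K' + 1 \<le> real d" and dH: "H / K \<le> real d" using K' by linarith+
    then have d: "real d > 1" "d > 0" using K' by (linarith, auto intro: gr0I)
    \<comment> \<open>The value 1 for \<open>k \<ge> N\<close> keeps \<open>g \<ge> 1\<close> for
      numbers that are not classes, where nothing is known about \<open>h\<close>.\<close>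
    define g :: "(nat \<Rightarrow> int) \<Rightarrow> bool \<Rightarrow> nat \<Rightarrow> bool \<Rightarrow> nat \<Rightarrow> real" where
      "g D b k b' k' = (if sqnorm d D > 0 then 1 + A * potential s (sqnorm d D)
         else if k \<noteq> k' \<or> k \<ge> N then 1 else if b = b' then K * real d / h b k else K' * real d)" for D b k b' k'
    have g_ge: "1 \<le> g D b k b' k'" for D b k b' k'
    proof -
      have "1 \<le> K * real d / h b k" if "k < N"
      proof -
        have "h b k \<le> K * real d" using dH K H(2)[OF that, of b] by (simp add: field_simps)
        then show ?thesis using h_pos[OF that, of b] by simp
      qed
      moreover have "1 \<le> K' * real d" using K' d mult_mono[of 1 K' 1 "real d"] by simp
      ultimately show ?thesis
        using A potential_pos[of "sqnorm d D" s] by (auto simp: g_def)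
    qed
    have pot_nonneg: "0 \<le> A * potential s (sqnorm d D)" for D
      using A potential_pos[OF sqnorm_nonneg, of s d D] by simp
    have Kd: "K * real d / h b k \<le> K * real d / \<eta>" if "k < N" for b k
      using that K d \<eta>(2)[OF that, of b] \<eta>(1) by (intro divide_left_mono mult_pos_pos) (auto intro: h_pos)
    have g_le: "g D b k b' k' \<le> 1 + A * potential s (sqnorm d D) + of_bool (sqnorm d D = 0) * (K' * real d)"
      for D b k b' k'
    proof -
      have "K * real d / h b k \<le> K' * real d" if "k < N"
      proof -
        have "K * real d / \<eta> \<le> K' * real d" using K'(2) d mult_right_mono[of "K / \<eta>" K' "real d"] by simp
        then show ?thesis using Kd[OF that, of b] by linarith
      qed
      moreover have "0 \<le> K' * real d" using K' by simp
      ultimately show ?thesis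
        using pot_nonneg[of D] sqnorm_nonneg[of d D] by (force simp: g_def)
    qed
    have w_inv: "2 * real d / w b k l \<le> 2 * real d / \<rho>" "0 \<le> 2 * real d / w b k l" if "k < N" "l < N" for b k l
      using \<rho>(1) \<rho>(2)[OF that, of b] by (auto intro!: divide_left_mono mult_pos_pos)
    \<comment> \<open>The diagonal carries total weight \<open>1 / d\<close>. Its values will be
      quadratic in \<open>d\<close>, a factor \<open>2 d / w\<close> times \<open>K d / h\<close>,
      so their contribution is linear in \<open>d\<close>, like \<open>g\<close> itself.\<close>
    have diag_sum: "(\<Sum>a<d. \<Sum>a'<d. F a a' / (real d)\<^sup>2) \<le> x / real d + y"
      if "y \<ge> 0" "\<And>a. a < d \<Longrightarrow> F a a \<le> x" "\<And>a a'. a < d \<Longrightarrow> a' < d \<Longrightarrow> a \<noteq> a' \<Longrightarrow> F a a' \<le> y" for F x y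
    proof -
      have "(\<Sum>a<d. \<Sum>a'<d. F a a') \<le> (\<Sum>a<d. \<Sum>a'<d. y + (if a = a' then x else 0))"
        using that by (intro sum_mono) (auto intro: order_trans[OF that(2)])
      also have "\<dots> = (real d)\<^sup>2 * y + real d * x" by (simp add: sum.distrib power2_eq_square algebra_simps)
      finally have "(\<Sum>a<d. \<Sum>a'<d. F a a') / (real d)\<^sup>2 \<le> ((real d)\<^sup>2 * y + real d * x) / (real d)\<^sup>2"
        by (intro divide_right_mono) auto
      also have "\<dots> = x / real d + y" using d by (simp add: field_simps power2_eq_square)
      finally show ?thesis by (simp only: sum_divide_distrib)
    qed
    have step: "(\<Sum>a<d. \<Sum>a'<d. \<Sum>l<N. \<Sum>l'<N. trans_prob b k l * trans_prob b' k' l' / (real d)\<^sup>2 *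
         (overlap_factor C d D k b' k' l' * g (shift_diff D a a') (k \<le> l) l (k' \<le> l') l')) \<le> g D b k b' k'"
      if k: "k < N" and k': "k' < N" for D b b' k k'
    proof -
      define F where "F a a' = (\<Sum>l<N. \<Sum>l'<N. trans_prob b k l * trans_prob b' k' l' *
         (overlap_factor C d D k b' k' l' * g (shift_diff D a a') (k \<le> l) l (k' \<le> l') l'))" for a a'
      have LHS: "(\<Sum>a<d. \<Sum>a'<d. \<Sum>l<N. \<Sum>l'<N. trans_prob b k l * trans_prob b' k' l' / (real d)\<^sup>2 *
         (overlap_factor C d D k b' k' l' * g (shift_diff D a a') (k \<le> l) l (k' \<le> l') l')) =
         (\<Sum>a<d. \<Sum>a'<d. F a a' / (real d)\<^sup>2)"
        by (simp add: F_def sum_divide_distrib)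
      have far: "(\<Sum>a<d. \<Sum>a'<d. F a a' / (real d)\<^sup>2)
          \<le> c * (1 + A * mean_potential s d D + K' * z / real d)"
        if c: "c > 0" "\<And>l'. overlap_factor C d D k b' k' l' = c"
          and z: "(\<Sum>a<d. \<Sum>a'<d. of_bool (sqnorm d (shift_diff D a a') = 0)) \<le> z" for c z
      proof -
        have "F a a' \<le> c * (1 + A * potential s (sqnorm d (shift_diff D a a'))
            + of_bool (sqnorm d (shift_diff D a a') = 0) * (K' * real d))" for a a'
          unfolding F_def c(2) using c(1) g_le by (intro pair_mean_le k k' mult_left_mono) auto
        then have "(\<Sum>a<d. \<Sum>a'<d. F a a' / (real d)\<^sup>2) \<le> (\<Sum>a<d. \<Sum>a'<d. c * (1 + A * potential s (sqnorm d (shift_diff D a a'))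
            + of_bool (sqnorm d (shift_diff D a a') = 0) * (K' * real d)) / (real d)\<^sup>2)"
          by (intro sum_mono divide_right_mono) auto
        also have "\<dots> = (\<Sum>a<d. \<Sum>a'<d. c / (real d)\<^sup>2 + (c * A) * (potential s (sqnorm d (shift_diff D a a')) / (real d)\<^sup>2)
            + (c * K' / real d) * of_bool (sqnorm d (shift_diff D a a') = 0))"
          using d by (intro sum.cong refl) (simp add: field_simps power2_eq_square)
        also have "\<dots> = c + c * A * mean_potential s d D
          + (c * K' / real d) * (\<Sum>a<d. \<Sum>a'<d. of_bool (sqnorm d (shift_diff D a a') = 0))"
          using d unfolding sum.distrib mean_potential_def sum_distrib_left[symmetric]
          by (simp add: power2_eq_square)
        also have "\<dots> \<le> c + c * A * mean_potential s d D + (c * K' / real d) * z"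
          using z c K' by (intro add_left_mono mult_left_mono) auto
        also have "\<dots> = c * (1 + A * mean_potential s d D + K' * z / real d)" by (simp add: algebra_simps)
        finally show ?thesis .
      qed
      consider "sqnorm d D > 16" | "0 < sqnorm d D" "sqnorm d D \<le> 16" | "sqnorm d D = 0" "k \<noteq> k'"
        | "sqnorm d D = 0" "k = k'" using sqnorm_nonneg[of d D] by fastforce
      then have "(\<Sum>a<d. \<Sum>a'<d. F a a' / (real d)\<^sup>2) \<le> g D b k b' k'"
      proof cases
        case 1
        then have "(\<Sum>a<d. \<Sum>a'<d. of_bool (sqnorm d (shift_diff D a a') = 0)) \<le> (0::real)"
          using shift_diff_zero_sqnorm[of _ d _ D] by (force intro!: sum_nonpos simp: of_bool_def)
        then have "(\<Sum>a<d. \<Sum>a'<d. F a a' / (real d)\<^sup>2) \<le> 1 + A * mean_potential s d D"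
          using far[of 1 0] 1 by (simp add: overlap_factor_def)
        also have "\<dots> \<le> g D b k b' k'" using 1 A s(1)[OF d1, of D] by (simp add: g_def)
        finally show ?thesis .
      next
        case 2
        have "(\<Sum>a<d. \<Sum>a'<d. F a a' / (real d)\<^sup>2) \<le> C * (1 + A * mean_potential s d D + K' / real d)"
          using far[of C 1] 2 C sum_shift_diff_zero_le[of d D] by (simp add: overlap_factor_def)
        also have "\<dots> \<le> 1 + A * potential s (sqnorm d D)"
        proof -
          have "K' / real d \<le> 1" using dK d by simp
          then have "C * (K' / real d) \<le> C * 1" using C by (intro mult_left_mono) auto
          moreover have "A * (2 * C * mean_potential s d D) \<le> A * potential s (sqnorm d D)"
            using A s(2)[OF d1 2(2)] by simp
          moreover have "4 * C \<le> A * potential s (sqnorm d D)"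
          proof -
            have "4 * C = A * potential s 16" using potential_pos[of 16 s] by (simp add: A_def)
            also have "\<dots> \<le> A * potential s (sqnorm d D)" using A 2 by (intro mult_left_mono potential_antimono) auto
            finally show ?thesis .
          qed
          ultimately show ?thesis using C by (simp add: algebra_simps)
        qed
        also have "\<dots> = g D b k b' k'" using 2 by (simp add: g_def)
        finally show ?thesis .
      next
        case 3
        then have "F a a' = 0" for a a' by (simp add: F_def overlap_factor_def)
        then show ?thesis using g_ge[of D b k b' k'] by simp
      next
        case 4
        have overlap_factor: "overlap_factor C d D k b' k' l' = 2 * real d / w b' k l'" for l'
          using 4 by (simp add: overlap_factor_def)
        have same: "sqnorm d (shift_diff D a a) = 0" for a using 4 by (simp add: sqnorm_shift_diff_same)
        have differ: "F a a' \<le> 2 * real d / \<rho> * g2" if "a < d" "a' < d" "a \<noteq> a'" for a a'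
        proof -
          have "sqnorm d (shift_diff D a a') = 2"
            using sqnorm_shift_diff[OF that, of D] 4 that by (simp add: sqnorm_eq_0_iff)
          then have "g (shift_diff D a a') (k \<le> l) l (k' \<le> l') l' = g2" for l l'
            by (simp add: g_def g2_def)
          then show ?thesis unfolding F_def overlap_factor using k 4 g2 \<rho>(1)
            by (intro pair_mean_le mult_mono w_inv) auto
        qed
        have y: "0 \<le> 2 * real d / \<rho> * g2" using \<rho> g2 by simp
        show ?thesis
        proof (cases "b = b'")
          case True
          define T where "T = (\<Sum>j<N. w b k j * h (k \<le> j) j)"
          have T: "T \<ge> 2 * \<mu> * h b k" "T > 0" using growth[OF k] total_pos[OF k] by (auto simp: T_def)
          have "F a a \<le> 2 * real d / \<rho> + K * (real d)\<^sup>2 / (\<mu> * h b k)" if "a < d" for a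
          proof -
            \<comment> \<open>From equal types, \<open>l = l'\<close> leads to equal types again,
              whereas \<open>l \<noteq> l'\<close> leads to contradictory classes, where
              \<open>g\<close> is 1.\<close>
            have "F a a = (\<Sum>l<N. \<Sum>l'<N. trans_prob b k l * trans_prob b' k' l' *
              (2 * real d / w b' k l' * of_bool (l \<noteq> l')) +
              (if l = l' then trans_prob b k l * trans_prob b k l * (2 * real d / w b k l) * (K * real d / h (k \<le> l) l) else 0))"
              unfolding F_def overlap_factor using 4 True same
              by (intro sum.cong refl) (auto simp: g_def mult_ac)
            also have "\<dots> = (\<Sum>l<N. \<Sum>l'<N. trans_prob b k l * trans_prob b' k' l' *
              (2 * real d / w b' k l' * of_bool (l \<noteq> l'))) +
              (\<Sum>l<N. trans_prob b k l * trans_prob b k l * (2 * real d / w b k l) * (K * real d / h (k \<le> l) l))"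
              by (simp add: sum.distrib)
            also have "(\<Sum>l<N. \<Sum>l'<N. trans_prob b k l * trans_prob b' k' l' *
              (2 * real d / w b' k l' * of_bool (l \<noteq> l'))) \<le> 2 * real d / \<rho>"
              using k 4 w_inv \<rho> by (intro pair_mean_le) (auto simp: of_bool_def)
            \<comment> \<open>One factor \<open>trans_prob\<close> cancels both \<open>w\<close> and
              \<open>h\<close> at \<open>l\<close>; what remains no longer depends on
              \<open>l\<close>.\<close>
            also have "(\<Sum>l<N. trans_prob b k l * trans_prob b k l * (2 * real d / w b k l) * (K * real d / h (k \<le> l) l))
              = (\<Sum>l<N. trans_prob b k l * (2 * K * (real d)\<^sup>2 / T))"
            proof (intro sum.cong refl)
              fix l assume l: "l \<in> {..<N}"
              have "w b k l \<noteq> 0" "h (k \<le> l) l \<noteq> 0" "T \<noteq> 0" using w_pos[OF k, of l b] h_pos[of l "k \<le> l"] T l by auto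
              moreover have "trans_prob b k l = w b k l * h (k \<le> l) l / T" by (simp add: trans_prob_def T_def)
              ultimately have "trans_prob b k l * (2 * real d / w b k l) * (K * real d / h (k \<le> l) l) = 2 * K * (real d)\<^sup>2 / T"
                by (simp add: field_simps power2_eq_square)
              then show "trans_prob b k l * trans_prob b k l * (2 * real d / w b k l) * (K * real d / h (k \<le> l) l)
                = trans_prob b k l * (2 * K * (real d)\<^sup>2 / T)" by (simp only: mult.assoc)
            qed
            also have "\<dots> = 2 * K * (real d)\<^sup>2 / T"
              by (simp only: sum_distrib_right[symmetric] sum_trans_prob[OF k] mult_1_left)
            also have "\<dots> \<le> 2 * K * (real d)\<^sup>2 / (2 * \<mu> * h b k)"
              using T K \<mu> h_pos[OF k, of b] by (intro divide_left_mono) auto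
            finally show ?thesis by simp
          qed
          from diag_sum[of _ F, OF y this differ]
          have "(\<Sum>a<d. \<Sum>a'<d. F a a' / (real d)\<^sup>2)
            \<le> (2 * real d / \<rho> + K * (real d)\<^sup>2 / (\<mu> * h b k)) / real d + 2 * real d / \<rho> * g2" by blast
          also have "\<dots> = 2 / \<rho> + K * real d / (\<mu> * h b k) + 2 * real d / \<rho> * g2"
            using d by (simp add: add_divide_distrib power2_eq_square)
          also have "\<dots> \<le> K * real d / (\<mu> * h b k) + real d * ((2 / \<rho>) * (1 + g2))"
          proof -
            have "1 * (2 / \<rho>) \<le> real d * (2 / \<rho>)" using d \<rho> by (intro mult_right_mono) auto
            moreover have "real d * ((2 / \<rho>) * (1 + g2)) = real d * (2 / \<rho>) + 2 * real d / \<rho> * g2"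
              by (simp add: algebra_simps add_divide_distrib)
            ultimately show ?thesis by linarith
          qed
          also have "(2 / \<rho>) * (1 + g2) = K * (1 - 1 / \<mu>) / H"
          proof -
            have *: "K = H * G * \<mu> / (\<mu> - 1) \<Longrightarrow> G = K * (1 - 1 / \<mu>) / H" for G
              using \<mu> H(1) by (simp add: field_simps)
            show ?thesis by (rule *) (simp only: K_def mult.assoc)
          qed
          also have "\<dots> \<le> K * (1 - 1 / \<mu>) / h b k"
            using K \<mu> H h_pos[OF k, of b] by (intro divide_left_mono mult_nonneg_nonneg) (auto simp: k)
          also have "K * real d / (\<mu> * h b k) + real d * (K * (1 - 1 / \<mu>) / h b k) = K * real d / h b k"
            using \<mu> h_pos[OF k, of b] by (simp add: field_simps)
          also have "\<dots> = g D b k b' k'" using 4 k True by (simp add: g_def)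
          finally show ?thesis using d by (simp add: mult_left_mono)
        next
          case False
          have "F a a \<le> 2 * real d / \<rho> * (K * real d / \<eta> + 1)" if "a < d" for a
          proof -
            have *: "g (shift_diff D a a) (k \<le> l) l (k' \<le> l') l' \<le> K * real d / \<eta> + 1" if "l < N" for l l'
            proof -
              have "0 \<le> K * real d / \<eta>" using K \<eta> by simp
              then show ?thesis using same[of a] 4 Kd[OF that, of "k \<le> l"] that by (auto simp: g_def)
            qed
            show ?thesis unfolding F_def overlap_factor using k 4
              by (intro pair_mean_le mult_mono w_inv *) (auto simp: \<rho> less_imp_le intro: order_trans[OF _ g_ge])
          qed
          from diag_sum[of _ F, OF y this differ]
          have "(\<Sum>a<d. \<Sum>a'<d. F a a' / (real d)\<^sup>2)
            \<le> (2 * real d / \<rho> * (K * real d / \<eta> + 1)) / real d + 2 * real d / \<rho> * g2" by blast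
          also have "\<dots> = (2 / \<rho>) * (K * real d / \<eta> + 1 + real d * g2)"
          proof -
            have 1: "2 * real d / \<rho> * y / real d = (2 / \<rho>) * y" for y using d by simp
            have 2: "2 * real d / \<rho> * g2 = (2 / \<rho>) * (real d * g2)" by simp
            show ?thesis unfolding 1 2 by (simp only: distrib_left)
          qed
          also have "\<dots> \<le> (2 / \<rho>) * (K * real d / \<eta> + real d + real d * g2)"
            using d \<rho> by (intro mult_left_mono) auto
          also have "\<dots> = real d * ((2 / \<rho>) * (K / \<eta> + 1 + g2))"
            by (simp add: algebra_simps add_divide_distrib)
          also have "\<dots> \<le> real d * K'" using K \<eta> by (intro mult_left_mono) (auto simp: K'_def)
          also have "\<dots> = g D b k b' k'" using 4 k False by (simp add: g_def)
          finally show ?thesis .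
        qed
      qed
      then show ?thesis unfolding LHS .
    qed
    show "\<exists>g. (\<forall>D b k b' k'. g D b k b' k' \<ge> 1) \<and>
    (\<forall>D b b'. \<forall>k<N. \<forall>k'<N.
      (\<Sum>a<d. \<Sum>a'<d. \<Sum>l<N. \<Sum>l'<N. trans_prob b k l * trans_prob b' k' l' / (real d)\<^sup>2 *
         (overlap_factor C d D k b' k' l' * g (shift_diff D a a') (k \<le> l) l (k' \<le> l') l')) \<le> (g D b k b' k' :: real))"
      using g_ge step by blast
  qed
qed

section \<open>Sums over pairs of typed paths of fixed length\<close>

definition step_lists :: "nat \<Rightarrow> nat \<Rightarrow> (nat \<times> nat) list set" where
  "step_lists d n = {ls. set ls \<subseteq> {..<d} \<times> {..<N} \<and> length ls = n}"

fun path_weight :: "nat \<Rightarrow> bool \<Rightarrow> nat \<Rightarrow> (nat \<times> nat) list \<Rightarrow> real" where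
  "path_weight d b k [] = 1"
| "path_weight d b k ((a, l) # ls) = trans_prob b k l / real d * path_weight d (k \<le> l) l ls"

fun path_overlap_factor :: "real \<Rightarrow> nat \<Rightarrow> (nat \<Rightarrow> int) \<Rightarrow> nat \<Rightarrow> bool \<Rightarrow> nat \<Rightarrow> (nat \<times> nat) list \<Rightarrow> (nat \<times> nat) list \<Rightarrow> real" where
  "path_overlap_factor C d D k b' k' ((a, l) # ls) ((a', l') # ls') =
     overlap_factor C d D k b' k' l' * path_overlap_factor C d (shift_diff D a a') l (k' \<le> l') l' ls ls'"
| "path_overlap_factor C d D k b' k' _ _ = 1"

lemma sum_step_lists_Suc:
  "(\<Sum>ls\<in>step_lists d (Suc n). f ls) = (\<Sum>a<d. \<Sum>l<N. \<Sum>ls\<in>step_lists d n. f ((a, l) # ls))"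
proof -
  have "step_lists d (Suc n) = (\<lambda>p. fst p # snd p) ` (({..<d} \<times> {..<N}) \<times> step_lists d n)"
    by (force simp: step_lists_def length_Suc_conv image_iff)
  then have "(\<Sum>ls\<in>step_lists d (Suc n). f ls) = (\<Sum>p\<in>({..<d} \<times> {..<N}) \<times> step_lists d n. f (fst p # snd p))"
    by (simp only:) (subst sum.reindex, auto simp: inj_on_def)
  also have "\<dots> = (\<Sum>x\<in>{..<d} \<times> {..<N}. \<Sum>ls\<in>step_lists d n. f (x # ls))"
    by (simp add: sum.cartesian_product split_beta)
  also have "\<dots> = (\<Sum>a<d. \<Sum>l<N. \<Sum>ls\<in>step_lists d n. f ((a, l) # ls))"
    by (subst sum.cartesian_product) (auto intro!: sum.cong)
  finally show ?thesis .
qed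

lemma step_lists_0: "step_lists d 0 = {[]}"
  by (auto simp: step_lists_def)

lemma finite_step_lists: "finite (step_lists d n)"
  unfolding step_lists_def by (rule finite_lists_length_eq) auto

lemma path_weight_nonneg:
  "ls \<in> step_lists d n \<Longrightarrow> k < N \<Longrightarrow> path_weight d b k ls \<ge> 0"
proof (induction ls arbitrary: n b k)
  case (Cons x ls)
  obtain a l where x: "x = (a, l)" by (cases x)
  with Cons have "ls \<in> step_lists d (length ls)" "l < N" by (auto simp: step_lists_def)
  with Cons x show ?case by (auto intro!: mult_nonneg_nonneg divide_nonneg_nonneg trans_prob_nonneg)
qed simp

lemma sum_path_weight:
  assumes "d > 0"
  shows "k < N \<Longrightarrow> (\<Sum>ls\<in>step_lists d n. path_weight d b k ls) = 1"
proof (induction n arbitrary: b k)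
  case (Suc n)
  have "(\<Sum>ls\<in>step_lists d (Suc n). path_weight d b k ls) =
    (\<Sum>a<d. \<Sum>l<N. trans_prob b k l / real d * (\<Sum>ls\<in>step_lists d n. path_weight d (k \<le> l) l ls))"
    by (simp add: sum_step_lists_Suc sum_distrib_left)
  also have "\<dots> = (\<Sum>a<d. \<Sum>l<N. trans_prob b k l / real d)"
    by (intro sum.cong refl) (simp add: Suc.IH)
  also have "\<dots> = 1" using assms Suc.prems by (simp add: sum_divide_distrib[symmetric] sum_trans_prob)
  finally show ?case .
qed (simp add: step_lists_0)

text \<open>The supermartingale argument: the first steps of both paths are split off and averaged
  last, so \<open>step\<close> closes the induction; \<open>g \<ge> 1\<close> starts it at length 0.
  The bound does not involve \<open>n\<close>.\<close>

lemma path_pair_sum_le: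
  assumes d: "d > 0" and g1: "\<And>D b k b' k'. g D b k b' k' \<ge> (1::real)"
    and step: "\<And>D b b' k k'. k < N \<Longrightarrow> k' < N \<Longrightarrow>
      (\<Sum>a<d. \<Sum>a'<d. \<Sum>l<N. \<Sum>l'<N. trans_prob b k l * trans_prob b' k' l' / (real d)\<^sup>2 *
         (overlap_factor C d D k b' k' l' * g (shift_diff D a a') (k \<le> l) l (k' \<le> l') l')) \<le> g D b k b' k'"
    and C: "C > 0"
  shows "k < N \<Longrightarrow> k' < N \<Longrightarrow> (\<Sum>ls\<in>step_lists d n. \<Sum>ls'\<in>step_lists d n.
    path_weight d b k ls * path_weight d b' k' ls' * path_overlap_factor C d D k b' k' ls ls') \<le> g D b k b' k'"
proof (induction n arbitrary: D b k b' k')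
  case 0 then show ?case using g1 by (simp add: step_lists_0)
next
  case (Suc n)
  have swap3: "(\<Sum>x\<in>A. \<Sum>y\<in>B. \<Sum>w\<in>E. \<Sum>v\<in>F. f x y w v) = (\<Sum>y\<in>B. \<Sum>w\<in>E. \<Sum>x\<in>A. \<Sum>v\<in>F. f x y w v)"
    for A :: "'x set" and B :: "'y set" and E :: "'z set" and F :: "'v set" and f :: "_ \<Rightarrow> _ \<Rightarrow> _ \<Rightarrow> _ \<Rightarrow> real"
    by (subst sum.swap, rule sum.cong[OF refl], rule sum.swap)
  have "(\<Sum>ls\<in>step_lists d (Suc n). \<Sum>ls'\<in>step_lists d (Suc n).
      path_weight d b k ls * path_weight d b' k' ls' * path_overlap_factor C d D k b' k' ls ls')
    = (\<Sum>a<d. \<Sum>l<N. \<Sum>ls\<in>step_lists d n. \<Sum>a'<d. \<Sum>l'<N. \<Sum>ls'\<in>step_lists d n.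
        trans_prob b k l * trans_prob b' k' l' / (real d)\<^sup>2 * (overlap_factor C d D k b' k' l' *
        (path_weight d (k \<le> l) l ls * path_weight d (k' \<le> l') l' ls' *
          path_overlap_factor C d (shift_diff D a a') l (k' \<le> l') l' ls ls')))"
    unfolding sum_step_lists_Suc by (intro sum.cong refl) (simp add: power2_eq_square)
  also have "\<dots> = (\<Sum>a<d. \<Sum>l<N. \<Sum>a'<d. \<Sum>l'<N. \<Sum>ls\<in>step_lists d n. \<Sum>ls'\<in>step_lists d n.
        trans_prob b k l * trans_prob b' k' l' / (real d)\<^sup>2 * (overlap_factor C d D k b' k' l' *
        (path_weight d (k \<le> l) l ls * path_weight d (k' \<le> l') l' ls' *
          path_overlap_factor C d (shift_diff D a a') l (k' \<le> l') l' ls ls')))"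
    by (rule sum.cong[OF refl], rule sum.cong[OF refl], rule swap3)
  also have "\<dots> = (\<Sum>a<d. \<Sum>l<N. \<Sum>a'<d. \<Sum>l'<N.
        trans_prob b k l * trans_prob b' k' l' / (real d)\<^sup>2 * (overlap_factor C d D k b' k' l' *
        (\<Sum>ls\<in>step_lists d n. \<Sum>ls'\<in>step_lists d n. path_weight d (k \<le> l) l ls * path_weight d (k' \<le> l') l' ls' *
          path_overlap_factor C d (shift_diff D a a') l (k' \<le> l') l' ls ls')))"
    by (simp only: sum_distrib_left)
  also have "\<dots> \<le> (\<Sum>a<d. \<Sum>l<N. \<Sum>a'<d. \<Sum>l'<N.
        trans_prob b k l * trans_prob b' k' l' / (real d)\<^sup>2 * (overlap_factor C d D k b' k' l' *
          g (shift_diff D a a') (k \<le> l) l (k' \<le> l') l'))"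
  proof (intro sum_mono mult_left_mono)
    fix a l a' l' assume "l \<in> {..<N}" "l' \<in> {..<N}"
    then show "(\<Sum>ls\<in>step_lists d n. \<Sum>ls'\<in>step_lists d n. path_weight d (k \<le> l) l ls * path_weight d (k' \<le> l') l' ls' *
          path_overlap_factor C d (shift_diff D a a') l (k' \<le> l') l' ls ls') \<le> g (shift_diff D a a') (k \<le> l) l (k' \<le> l') l'"
      by (intro Suc.IH) auto
    show "0 \<le> overlap_factor C d D k b' k' l'"
      using C w_pos[OF \<open>k' < N\<close>, of l' b'] \<open>l' \<in> _\<close> by (simp add: overlap_factor_def)
    show "0 \<le> trans_prob b k l * trans_prob b' k' l' / (real d)\<^sup>2"
      using \<open>l \<in> _\<close> \<open>l' \<in> _\<close> Suc.prems by (simp add: trans_prob_nonneg)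
  qed
  also have "\<dots> = (\<Sum>a<d. \<Sum>a'<d. \<Sum>l<N. \<Sum>l'<N.
        trans_prob b k l * trans_prob b' k' l' / (real d)\<^sup>2 * (overlap_factor C d D k b' k' l' *
          g (shift_diff D a a') (k \<le> l) l (k' \<le> l') l'))"
    by (rule sum.cong[OF refl], rule sum.swap)
  also have "\<dots> \<le> g D b k b' k'" by (rule step) fact+
  finally show ?case .
qed

lemma path_pair_sum_bounded:
  assumes "C > 0"
  shows "\<exists>d\<^sub>0. \<forall>d\<ge>d\<^sub>0. \<exists>B. \<forall>n. \<forall>k<N. (\<Sum>ls\<in>step_lists d n. \<Sum>ls'\<in>step_lists d n.
    path_weight d b k ls * path_weight d b k ls' * path_overlap_factor C d (\<lambda>_. 0) k b k ls ls') \<le> B k"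
proof -
  obtain d0 where "\<And>d. d \<ge> d0 \<Longrightarrow> \<exists>g. (\<forall>D b k b' k'. g D b k b' k' \<ge> 1) \<and>
    (\<forall>D b b'. \<forall>k<N. \<forall>k'<N.
      (\<Sum>a<d. \<Sum>a'<d. \<Sum>l<N. \<Sum>l'<N. trans_prob b k l * trans_prob b' k' l' / (real d)\<^sup>2 *
         (overlap_factor C d D k b' k' l' * g (shift_diff D a a') (k \<le> l) l (k' \<le> l') l')) \<le> (g D b k b' k' :: real))"
    using lyapunov_exists[OF assms] by blast
  note * = this
  show ?thesis
  proof (intro exI[of _ "max d0 1"] allI impI)
    fix d assume "max d0 1 \<le> d"
    then have d: "d0 \<le> d" "d > 0" by auto
    obtain g where g: "\<forall>D b k b' k'. g D b k b' k' \<ge> (1::real)"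
      "\<forall>D b b'. \<forall>k<N. \<forall>k'<N.
      (\<Sum>a<d. \<Sum>a'<d. \<Sum>l<N. \<Sum>l'<N. trans_prob b k l * trans_prob b' k' l' / (real d)\<^sup>2 *
         (overlap_factor C d D k b' k' l' * g (shift_diff D a a') (k \<le> l) l (k' \<le> l') l')) \<le> g D b k b' k'"
      using *[OF d(1)] by blast
    show "\<exists>B. \<forall>n. \<forall>k<N. (\<Sum>ls\<in>step_lists d n. \<Sum>ls'\<in>step_lists d n.
        path_weight d b k ls * path_weight d b k ls' * path_overlap_factor C d (\<lambda>_. 0) k b k ls ls') \<le> B k"
      using path_pair_sum_le[OF d(2) g(1)[rule_format] g(2)[rule_format] assms]
      by (intro exI[of _ "\<lambda>k. g (\<lambda>_. 0) b k b k"]) blast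
  qed
qed

text \<open>The recursion fits the induction on the length, but the path probabilities come as a
  product over times. The displacement at time \<open>i\<close> is recovered by counting how often
  each direction has been used.\<close>

lemma path_overlap_factor_eq_prod:
  assumes "length ls = n" "length ls' = n"
  shows "path_overlap_factor C d D k b' k' ls ls' =
    (\<Prod>i<n. overlap_factor C d (\<lambda>c. D c - int (card {t. t < i \<and> fst (ls ! t) = c}) + int (card {t. t < i \<and> fst (ls' ! t) = c}))
      ((k # map snd ls) ! i) (if i = 0 then b' else (k' # map snd ls') ! (i - 1) \<le> (k' # map snd ls') ! i)
      ((k' # map snd ls') ! i) (snd (ls' ! i)))"
  using assms
proof (induction n arbitrary: D k b' k' ls ls')
  case (Suc n)
  obtain a l ms a' l' ms' where ls: "ls = (a, l) # ms" "ls' = (a', l') # ms'" "length ms = n" "length ms' = n"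
    using Suc.prems by (auto simp: length_Suc_conv)
  have card: "card {t. t < Suc i \<and> fst (((x, y) # us) ! t) = c} = of_bool (c = x) + card {t. t < i \<and> fst (us ! t) = c}"
    for x y i c and us :: "(nat \<times> nat) list"
  proof -
    have "{t. t < Suc i \<and> fst (((x, y) # us) ! t) = c} = {t. t = 0 \<and> x = c} \<union> Suc ` {t. t < i \<and> fst (us ! t) = c}"
      (is "?A = ?B")
    proof (rule set_eqI)
      fix t show "t \<in> ?A \<longleftrightarrow> t \<in> ?B" by (cases t) auto
    qed
    also have "card \<dots> = card {t::nat. t = 0 \<and> x = c} + card (Suc ` {t. t < i \<and> fst (us ! t) = c})"
      by (intro card_Un_disjoint) auto
    finally show ?thesis by (auto simp: card_image)
  qed
  have prev: "(if i = 0 then k' \<le> l' else (l' # map snd ms') ! (i - 1) \<le> (l' # map snd ms') ! i) =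
     ((k' # l' # map snd ms') ! i \<le> (l' # map snd ms') ! i)" for i
    by (cases i) auto
  have D: "(\<lambda>c. shift_diff D a a' c - int (card {t. t < i \<and> fst (ms ! t) = c}) + int (card {t. t < i \<and> fst (ms' ! t) = c}))
    = (\<lambda>c. D c - int (card {t. t < Suc i \<and> fst (ls ! t) = c}) + int (card {t. t < Suc i \<and> fst (ls' ! t) = c}))" for i
    unfolding ls card by (auto simp: shift_diff_def)
  show ?case
    unfolding ls path_overlap_factor.simps prod.lessThan_Suc_shift Suc.IH[OF ls(3,4)] D[unfolded ls] prev
    by simp
qed simp

end

section \<open>Oriented lattice paths and their neighbourhoods\<close>

definition bump :: "(nat \<Rightarrow> int) \<Rightarrow> nat \<Rightarrow> int \<Rightarrow> nat \<Rightarrow> int" where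
  "bump v b t = v(b := v b + t)"

primrec path_pos :: "(nat \<Rightarrow> int) \<Rightarrow> (nat \<Rightarrow> nat) \<Rightarrow> nat \<Rightarrow> nat \<Rightarrow> int" where
  "path_pos z a 0 = z"
| "path_pos z a (Suc j) = bump (path_pos z a j) (a j) 1"

definition level :: "nat \<Rightarrow> (nat \<Rightarrow> int) \<Rightarrow> int" where
  "level d v = (\<Sum>b<d. v b)"

definition l1dist :: "nat \<Rightarrow> (nat \<Rightarrow> int) \<Rightarrow> (nat \<Rightarrow> int) \<Rightarrow> int" where
  "l1dist d u v = (\<Sum>b<d. \<bar>u b - v b\<bar>)"

text \<open>The omitted directions lead to the next path vertex and to the corner charged to vertex
  \<open>j + 2\<close>, because \<open>corner z a (j + 2)\<close> is
  \<open>bump (path_pos z a j) (a (Suc j)) 1\<close>.\<close>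

definition up_nbrs :: "nat \<Rightarrow> (nat \<Rightarrow> int) \<Rightarrow> (nat \<Rightarrow> nat) \<Rightarrow> nat \<Rightarrow> (nat \<Rightarrow> int) set" where
  "up_nbrs d z a j = (\<lambda>b. bump (path_pos z a j) b 1) ` {b. b < d \<and> b \<noteq> a j \<and> b \<noteq> a (Suc j)}"

text \<open>The common neighbour of the path vertices \<open>j - 2\<close> and \<open>j\<close> other than vertex \<open>j - 1\<close>; it exists only if the
  two steps in between have different directions.  All uses have \<open>j \<ge> 2\<close>, so the subtraction does not
  truncate.\<close>

definition corner :: "(nat \<Rightarrow> int) \<Rightarrow> (nat \<Rightarrow> nat) \<Rightarrow> nat \<Rightarrow> nat \<Rightarrow> int" where
  "corner z a j = bump (path_pos z a j) (a (j - 2)) (- 1)"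

definition private_nbrs :: "nat \<Rightarrow> (nat \<Rightarrow> int) \<Rightarrow> (nat \<Rightarrow> nat) \<Rightarrow> nat \<Rightarrow> (nat \<Rightarrow> int) set" where
  "private_nbrs d z a j = up_nbrs d z a j \<union>
     (\<lambda>b. bump (path_pos z a j) b (- 1)) ` {b. b < d \<and> b \<noteq> a (j - 1) \<and> b \<noteq> a (j - 2)}"

text \<open>Each corner is assigned to the later of its two path neighbours, which makes the blocks of one path
  disjoint.\<close>

definition block :: "nat \<Rightarrow> (nat \<Rightarrow> int) \<Rightarrow> (nat \<Rightarrow> nat) \<Rightarrow> nat \<Rightarrow> (nat \<Rightarrow> int) set" where
  "block d z a j = insert (path_pos z a j) (up_nbrs d z a j \<union>
     (\<lambda>b. bump (path_pos z a j) b (- 1)) ` {b. b < d \<and> b \<noteq> a (j - 1)})"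

lemma level_bump: "b < d \<Longrightarrow> level d (bump v b t) = level d v + t"
proof -
  assume b: "b < d"
  have "bump v b t c = v c + (if c = b then t else 0)" for c by (simp add: bump_def)
  then show ?thesis using b by (simp add: level_def sum.distrib)
qed

lemma bump_in_lattice: "v \<in> lattice_points d \<Longrightarrow> b < d \<Longrightarrow> bump v b t \<in> lattice_points d"
  by (auto simp: lattice_points_def bump_def PiE_def extensional_def)

lemma path_pos_in_lattice:
  "z \<in> lattice_points d \<Longrightarrow> (\<And>i. a i < d) \<Longrightarrow> path_pos z a j \<in> lattice_points d"
  by (induction j) (auto intro: bump_in_lattice)

lemma level_pos: "(\<And>i. a i < d) \<Longrightarrow> level d (path_pos z a j) = level d z + int j"
  by (induction j) (auto simp: level_bump)

lemma path_pos_shift: "path_pos (path_pos z a k) (\<lambda>i. a (i + k)) j = path_pos z a (j + k)"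
  by (induction j) auto

lemma block_in_lattice:
  "z \<in> lattice_points d \<Longrightarrow> (\<And>i. a i < d) \<Longrightarrow> block d z a j \<subseteq> lattice_points d"
  by (auto simp: block_def up_nbrs_def intro!: bump_in_lattice path_pos_in_lattice)

lemma private_nbrs_subset: "private_nbrs d z a j \<subseteq> block d z a j"
  by (auto simp: block_def private_nbrs_def)

lemma path_pos_in_block: "path_pos z a j \<in> block d z a j"
  by (simp add: block_def)

lemma corner_in_block: "a (j - 2) < d \<Longrightarrow> a (j - 2) \<noteq> a (j - 1) \<Longrightarrow> corner z a j \<in> block d z a j"
  by (auto simp: block_def corner_def)

lemma bump_neq: "t \<noteq> 0 \<Longrightarrow> bump v b t \<noteq> v"
  by (auto simp: bump_def fun_eq_iff)

lemma bump_eq_iff: "t \<noteq> 0 \<Longrightarrow> bump v b t = bump v c t \<longleftrightarrow> b = c"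
  by (auto simp: bump_def fun_eq_iff split: if_splits)

lemma bump_opposite_neq: "bump v b 1 \<noteq> bump v c (- 1)"
  by (auto simp: bump_def fun_eq_iff)

lemma path_pos_notin_private: "path_pos z a j \<notin> private_nbrs d z a j"
  using bump_neq[of 1 "path_pos z a j"] bump_neq[of "-1" "path_pos z a j"]
  by (auto simp: private_nbrs_def up_nbrs_def) (metis one_neq_zero neg_equal_0_iff_equal)+

lemma corner_notin_private: "corner z a j \<notin> private_nbrs d z a j"
  using bump_opposite_neq[of "path_pos z a j"]
  by (auto simp: private_nbrs_def up_nbrs_def corner_def bump_eq_iff) metis

lemma corner_neq_pos: "corner z a j \<noteq> path_pos z a j"
  by (simp add: corner_def bump_neq)

lemma finite_private: "finite (private_nbrs d z a j)"
  by (auto simp: private_nbrs_def up_nbrs_def)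

lemma card_up: "card (up_nbrs d z a j) = card {b. b < d \<and> b \<noteq> a j \<and> b \<noteq> a (Suc j)}"
  unfolding up_nbrs_def by (intro card_image) (auto simp: inj_on_def bump_eq_iff)

lemma card_without_two: "card {b. b < d \<and> b \<noteq> x \<and> b \<noteq> y} \<ge> d - 2" "card {b. b < d \<and> b \<noteq> x \<and> b \<noteq> y} \<le> d"
  for x y :: nat
proof -
  have eq: "{b. b < d \<and> b \<noteq> x \<and> b \<noteq> y} = {..<d} - {x, y}" by auto
  have "card {..<d} - card {x, y} \<le> card ({..<d} - {x, y})" by (intro diff_card_le_card_Diff) auto
  moreover have "card {x, y} \<le> 2" by (simp add: card_insert_if)
  ultimately show "card {b. b < d \<and> b \<noteq> x \<and> b \<noteq> y} \<ge> d - 2" unfolding eq by simp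
  show "card {b. b < d \<and> b \<noteq> x \<and> b \<noteq> y} \<le> d" unfolding eq
    using card_mono[of "{..<d}" "{..<d} - {x, y}"] by auto
qed

lemma card_private: "2 * d - 4 \<le> card (private_nbrs d z a j)" "card (private_nbrs d z a j) \<le> 2 * d"
proof -
  let ?L = "(\<lambda>b. bump (path_pos z a j) b (- 1)) ` {b. b < d \<and> b \<noteq> a (j - 1) \<and> b \<noteq> a (j - 2)}"
  have "card ?L = card {b. b < d \<and> b \<noteq> a (j - 1) \<and> b \<noteq> a (j - 2)}"
    by (intro card_image) (auto simp: inj_on_def bump_eq_iff)
  moreover have "card (private_nbrs d z a j) = card (up_nbrs d z a j) + card ?L"
    unfolding private_nbrs_def using bump_opposite_neq
    by (intro card_Un_disjoint) (auto simp: up_nbrs_def)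
  ultimately have "card (private_nbrs d z a j) = card {b. b < d \<and> b \<noteq> a j \<and> b \<noteq> a (Suc j)} +
    card {b. b < d \<and> b \<noteq> a (j - 1) \<and> b \<noteq> a (j - 2)}" by (simp add: card_up)
  then show "2 * d - 4 \<le> card (private_nbrs d z a j)" "card (private_nbrs d z a j) \<le> 2 * d"
    using card_without_two[of d "a j" "a (Suc j)"] card_without_two[of d "a (j - 1)" "a (j - 2)"] by linarith+
qed

lemma block_cases:
  assumes "u \<in> block d z a j"
  obtains "u = path_pos z a j"
  | b where "b < d" "b \<noteq> a j" "b \<noteq> a (Suc j)" "u = bump (path_pos z a j) b 1"
  | b where "b < d" "b \<noteq> a (j - 1)" "u = bump (path_pos z a j) b (- 1)"
  using assms by (auto simp: block_def up_nbrs_def)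

text \<open>A block occupies the levels \<open>j - 1\<close>, \<open>j\<close> and
  \<open>j + 1\<close> relative to the start, so only \<open>j = i + 1\<close> and
  \<open>j = i + 2\<close> could collide. A common point would then use a direction removed from one
  of the two blocks.\<close>

lemma block_disjoint_less:
  assumes a: "\<And>i. a i < d" and "i < j"
  shows "block d z a i \<inter> block d z a j = {}"
proof (rule equals0I)
  fix u assume "u \<in> block d z a i \<inter> block d z a j"
  then have ui: "u \<in> block d z a i" and uj: "u \<in> block d z a j" by auto
  note lev = level_bump level_pos[OF a]
  from ui show False
  proof (cases rule: block_cases)
    case 1
    from uj show False
    proof (cases rule: block_cases)
      case (3 b)
      then have "level d u = level d z + int j - 1" by (simp add: lev)
      then have "j = Suc i" using 1 by (simp add: lev)
      have "path_pos z a i b = bump (bump (path_pos z a i) (a i) 1) b (- 1) b" "b \<noteq> a i"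
        using 1 3 \<open>j = Suc i\<close> by auto
      then have False by (simp add: bump_def)
      then show False by simp
    qed (use 1 \<open>i < j\<close> in \<open>auto dest!: arg_cong[of _ _ "level d"] simp: lev\<close>)
  next
    case (2 b)
    then have lu: "level d u = level d z + int i + 1" by (simp add: lev)
    from uj show False
    proof (cases rule: block_cases)
      case 1
      then have "j = Suc i" using lu by (simp add: lev)
      then have "bump (path_pos z a i) b 1 = bump (path_pos z a i) (a i) 1" using 1 2 by simp
      then show False using 2 by (simp add: bump_eq_iff)
    next
      case (2 c)
      then show False using lu \<open>i < j\<close> by (simp add: lev)
    next
      case (3 c)
      then have "j = Suc (Suc i)" using lu by (simp add: lev)
      then have "bump (path_pos z a i) b 1 = bump (bump (bump (path_pos z a i) (a i) 1) (a (Suc i)) 1) c (- 1)"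
        using 2 3 by simp
      then have "bump (path_pos z a i) b 1 b = bump (bump (bump (path_pos z a i) (a i) 1) (a (Suc i)) 1) c (- 1) b" by simp
      then show False using 2 by (auto simp: bump_def split: if_splits)
    qed
  next
    case (3 b)
    then have lu: "level d u = level d z + int i - 1" by (simp add: lev)
    from uj show False
      by (cases rule: block_cases) (use lu \<open>i < j\<close> in \<open>auto simp: lev\<close>)
  qed
qed

lemma block_disjoint:
  assumes "\<And>i. a i < d" "i \<noteq> j"
  shows "block d z a i \<inter> block d z a j = {}"
  using block_disjoint_less[where a=a and d=d and i=i and j=j and z=z] block_disjoint_less[where a=a and d=d and i=j and j=i and z=z] assms
  by (metis Int_commute linorder_neqE_nat)

section \<open>Distances between paths and their blocks\<close>

lemma l1dist_triangle: "l1dist d u w \<le> l1dist d u v + l1dist d v w"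
  unfolding l1dist_def sum.distrib[symmetric] by (intro sum_mono) linarith

lemma l1dist_commute: "l1dist d u v = l1dist d v u"
  by (simp add: l1dist_def abs_minus_commute)

lemma l1dist_self: "l1dist d u u = 0"
  by (simp add: l1dist_def)

lemma l1dist_bump: "b < d \<Longrightarrow> l1dist d v (bump v b t) = \<bar>t\<bar>"
proof -
  assume b: "b < d"
  have "\<bar>v c - bump v b t c\<bar> = (if c = b then \<bar>t\<bar> else 0)" for c by (simp add: bump_def)
  then show ?thesis using b by (simp add: l1dist_def)
qed

lemma level_diff_le_l1dist: "\<bar>level d u - level d v\<bar> \<le> l1dist d u v"
  unfolding level_def l1dist_def sum_subtractf[symmetric] by (rule sum_abs)

lemma l1dist_path_pos:
  assumes "\<And>i. a i < d"
  shows "l1dist d (path_pos z a i) (path_pos z a (i + k)) \<le> int k"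
proof (induction k)
  case (Suc k)
  have "l1dist d (path_pos z a i) (path_pos z a (i + Suc k)) \<le> l1dist d (path_pos z a i) (path_pos z a (i + k)) + 1"
    using l1dist_triangle[of d "path_pos z a i" "path_pos z a (i + Suc k)" "path_pos z a (i + k)"]
      l1dist_bump[OF assms[of "i + k"], of "path_pos z a (i + k)" 1] by simp
  then show ?case using Suc by simp
qed (simp add: l1dist_self)

lemma l1dist_block:
  assumes "u \<in> block d z a j"
  shows "l1dist d (path_pos z a j) u \<le> 1"
  using assms by (cases rule: block_cases) (auto simp: l1dist_self l1dist_bump)

lemma sqnorm_le_l1_sq: "sqnorm d (\<lambda>c. u c - v c) \<le> (l1dist d u v)\<^sup>2"
proof -
  have "(u c - v c)\<^sup>2 \<le> \<bar>u c - v c\<bar> * l1dist d u v" if "c < d" for c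
  proof -
    have "\<bar>u c - v c\<bar> \<le> l1dist d u v"
      unfolding l1dist_def using that by (intro member_le_sum) auto
    then have "\<bar>u c - v c\<bar> * \<bar>u c - v c\<bar> \<le> \<bar>u c - v c\<bar> * l1dist d u v" by (intro mult_left_mono) auto
    then show ?thesis by (simp add: power2_eq_square)
  qed
  then have "sqnorm d (\<lambda>c. u c - v c) \<le> (\<Sum>c<d. \<bar>u c - v c\<bar> * l1dist d u v)"
    unfolding sqnorm_def by (intro sum_mono) auto
  then show ?thesis by (simp add: sum_distrib_right[symmetric] l1dist_def power2_eq_square)
qed

text \<open>Centres of meeting blocks are at distance at most 2. The level records the time, so the
  two times differ by at most 2, and moving along the first path to time \<open>j\<close> costs at
  most 2 more. Distance 4 gives squared norm at most 16.\<close>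

lemma blocks_meet_imp_near:
  assumes a: "\<And>i. a i < d" and a': "\<And>i. a' i < d"
    and "block d z a i \<inter> block d z a' j \<noteq> {}"
  shows "sqnorm d (\<lambda>c. path_pos z a' j c - path_pos z a j c) \<le> 16"
proof -
  obtain u where u: "u \<in> block d z a i" "u \<in> block d z a' j" using assms by auto
  have 1: "l1dist d (path_pos z a' j) (path_pos z a i) \<le> 2"
    using l1dist_triangle[of d "path_pos z a' j" "path_pos z a i" u] l1dist_block[OF u(1)] l1dist_block[OF u(2)]
    by (simp add: l1dist_commute)
  then have ij: "\<bar>int i - int j\<bar> \<le> 2"
    using level_diff_le_l1dist[of d "path_pos z a' j" "path_pos z a i"] by (simp add: level_pos[OF a] level_pos[OF a'])
  have "l1dist d (path_pos z a i) (path_pos z a j) \<le> \<bar>int i - int j\<bar>"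
  proof (cases "i \<le> j")
    case True then show ?thesis using l1dist_path_pos[OF a, where z=z and i=i and k="j - i"] by simp
  next
    case False then show ?thesis using l1dist_path_pos[OF a, where z=z and i=j and k="i - j"] by (simp add: l1dist_commute)
  qed
  with ij 1 have "l1dist d (path_pos z a' j) (path_pos z a j) \<le> 4"
    using l1dist_triangle[of d "path_pos z a' j" "path_pos z a j" "path_pos z a i"] by linarith
  moreover have "0 \<le> l1dist d (path_pos z a' j) (path_pos z a j)" by (simp add: l1dist_def sum_nonneg)
  ultimately have "(l1dist d (path_pos z a' j) (path_pos z a j))\<^sup>2 \<le> 4\<^sup>2" by (intro power_mono)
  then show ?thesis using sqnorm_le_l1_sq[of d "path_pos z a' j" "path_pos z a j"] by simp
qed

lemma path_pos_eq_card: "path_pos z a j c = z c + int (card {t. t < j \<and> a t = c})"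
proof (induction j)
  case (Suc j)
  have "{t. t < Suc j \<and> a t = c} = {t. t < j \<and> a t = c} \<union> (if a j = c then {j} else {})"
    by (auto simp: less_Suc_eq)
  then show ?case using Suc by (auto simp: bump_def card_insert_if)
qed simp

section \<open>Events of independent uniform ages\<close>

abbreviation unif :: "real measure" where
  "unif \<equiv> uniform_measure lborel {0..1}"

lemma prob_space_unif: "prob_space unif"
  by (intro prob_space_uniform_measure) auto

lemma prob_space_PiM_unif: "prob_space (PiM I (\<lambda>_. unif))"
  by (intro prob_space_PiM prob_space_unif)

lemma indep_vars_PiM_unif:
  "prob_space.indep_vars (PiM I (\<lambda>_. unif)) (\<lambda>_. unif) (\<lambda>i \<omega>. \<omega> i) I"
proof -
  interpret prob_space "PiM I (\<lambda>_. unif)" by (rule prob_space_PiM_unif)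
  show ?thesis
  proof (cases "I = {}")
    case True
    show ?thesis unfolding indep_vars_def indep_sets_def using True by auto
  next
    case False
    have "distr (PiM I (\<lambda>_. unif)) (PiM I (\<lambda>_. unif)) (\<lambda>x. \<lambda>i\<in>I. x i) = distr (PiM I (\<lambda>_. unif)) (PiM I (\<lambda>_. unif)) (\<lambda>x. x)"
      by (intro distr_cong refl) (auto simp: space_PiM PiE_def extensional_def restrict_def fun_eq_iff)
    also have "\<dots> = PiM I (\<lambda>_. unif)" by (rule distr_id2) simp
    also have "\<dots> = (\<Pi>\<^sub>M i\<in>I. distr (PiM I (\<lambda>_. unif)) unif (\<lambda>x. x i))"
      by (intro PiM_cong refl distr_PiM_component[symmetric] prob_space_unif)
    finally show ?thesis
      using False by (subst indep_vars_iff_distr_eq_PiM') auto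
  qed
qed

text \<open>Predicates are taken on all functions, so that the same event can be read in the product
  over any index set containing \<open>V\<close>.\<close>

definition local_event :: "'v set \<Rightarrow> (('v \<Rightarrow> real) \<Rightarrow> bool) \<Rightarrow> bool" where
  "local_event V Q \<longleftrightarrow> (\<forall>x. Q (restrict x V) = Q x) \<and> Measurable.pred (PiM V (\<lambda>_. unif)) Q"

lemma local_eventI:
  assumes "\<And>x y. (\<And>v. v \<in> V \<Longrightarrow> x v = y v) \<Longrightarrow> Q x = Q y"
    and "\<And>M. (\<And>v. v \<in> V \<Longrightarrow> (\<lambda>x. x v) \<in> borel_measurable M) \<Longrightarrow> Measurable.pred M Q"
  shows "local_event V Q"
  unfolding local_event_def
proof (intro conjI allI)
  show "Q (restrict x V) = Q x" for x by (rule assms(1)) auto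
  show "Measurable.pred (PiM V (\<lambda>_. unif)) Q"
  proof (rule assms(2))
    fix v assume "v \<in> V"
    then have "(\<lambda>x. x v) \<in> measurable (PiM V (\<lambda>_. unif)) unif" by simp
    then show "(\<lambda>x. x v) \<in> borel_measurable (PiM V (\<lambda>_. unif))"
      by (simp cong: measurable_cong_sets)
  qed
qed

definition iid_prob :: "'v set \<Rightarrow> (('v \<Rightarrow> real) \<Rightarrow> bool) \<Rightarrow> real" where
  "iid_prob I Q = measure (PiM I (\<lambda>_. unif)) {x \<in> space (PiM I (\<lambda>_. unif)). Q x}"

lemma iid_prob_nonneg: "0 \<le> iid_prob I Q"
  by (simp add: iid_prob_def)

lemma local_event_sets:
  assumes "local_event V Q" "V \<subseteq> I"
  shows "{x \<in> space (PiM I (\<lambda>_. unif)). Q x} \<in> sets (PiM I (\<lambda>_. unif))"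
proof -
  have "{x \<in> space (PiM I (\<lambda>_. unif)). Q x} =
      (\<lambda>x. restrict x V) -` {x \<in> space (PiM V (\<lambda>_. unif)). Q x} \<inter> space (PiM I (\<lambda>_. unif))"
    using assms measurable_space[OF measurable_restrict_subset[OF assms(2), of "\<lambda>_. unif"]]
    by (auto simp: local_event_def)
  also have "\<dots> \<in> sets (PiM I (\<lambda>_. unif))"
    using assms by (intro measurable_sets[OF measurable_restrict_subset]) (auto simp: local_event_def pred_def)
  finally show ?thesis .
qed

lemma iid_prob_mono:
  assumes "\<And>x. Q x \<Longrightarrow> Q' x" "local_event V' Q'" "V' \<subseteq> I"
  shows "iid_prob I Q \<le> iid_prob I Q'"
proof -
  interpret prob_space "PiM I (\<lambda>_. unif)" by (rule prob_space_PiM_unif)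
  show ?thesis unfolding iid_prob_def
    using assms(1) by (intro finite_measure_mono local_event_sets[OF assms(2,3)]) auto
qed

lemma iid_prob_blocks:
  assumes fin: "finite J" and disj: "disjoint_family_on V J" and sub: "\<And>j. j \<in> J \<Longrightarrow> V j \<subseteq> I"
    and loc: "\<And>j. j \<in> J \<Longrightarrow> local_event (V j) (Q j)"
  shows "iid_prob I (\<lambda>x. \<forall>j\<in>J. Q j x) = (\<Prod>j\<in>J. iid_prob I (Q j))"
proof (cases "J = {}")
  case True
  then show ?thesis using prob_space.prob_space[OF prob_space_PiM_unif[of I]] by (simp add: iid_prob_def)
next
  case False
  interpret prob_space "PiM I (\<lambda>_. unif)" by (rule prob_space_PiM_unif)
  let ?M = "PiM I (\<lambda>_. unif)"
  define A where "A j = {x \<in> space (PiM (V j) (\<lambda>_. unif)). Q j x}" for j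
  have ind: "indep_vars (\<lambda>j. PiM (V j) (\<lambda>_. unif)) (\<lambda>j \<omega>. restrict (\<lambda>i. \<omega> i) (V j)) J"
    by (rule indep_vars_restrict[OF indep_vars_PiM_unif sub disj])
  have pre: "(\<lambda>\<omega>. restrict (\<lambda>i. \<omega> i) (V j)) -` A j \<inter> space ?M = {x \<in> space ?M. Q j x}" if "j \<in> J" for j
    using loc[OF that] measurable_space[OF measurable_restrict_subset[OF sub[OF that], of "\<lambda>_. unif"]]
    by (auto simp: local_event_def A_def)
  have "prob (\<Inter>j\<in>J. (\<lambda>\<omega>. restrict (\<lambda>i. \<omega> i) (V j)) -` A j \<inter> space ?M)
      = (\<Prod>j\<in>J. prob ((\<lambda>\<omega>. restrict (\<lambda>i. \<omega> i) (V j)) -` A j \<inter> space ?M))"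
    using loc by (intro indep_varsD[OF ind False fin]) (auto simp: A_def local_event_def pred_def)
  also have "(\<Inter>j\<in>J. (\<lambda>\<omega>. restrict (\<lambda>i. \<omega> i) (V j)) -` A j \<inter> space ?M) = {x \<in> space ?M. \<forall>j\<in>J. Q j x}"
    using False pre by auto
  also have "(\<Prod>j\<in>J. prob ((\<lambda>\<omega>. restrict (\<lambda>i. \<omega> i) (V j)) -` A j \<inter> space ?M)) = (\<Prod>j\<in>J. iid_prob I (Q j))"
    by (intro prod.cong refl) (simp add: pre iid_prob_def)
  finally show ?thesis by (simp add: iid_prob_def)
qed

lemma iid_prob_coord:
  assumes "v \<in> I" "B \<in> sets borel"
  shows "iid_prob I (\<lambda>x. x v \<in> B) = measure unif B"
proof -
  have "measure (distr (PiM I (\<lambda>_. unif)) unif (\<lambda>x. x v)) B = iid_prob I (\<lambda>x. x v \<in> B)"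
    using assms by (subst measure_distr) (auto simp: iid_prob_def vimage_def Int_def intro!: arg_cong[of _ _ "measure _"])
  then show ?thesis using distr_PiM_component[of I "\<lambda>_. unif", OF prob_space_unif assms(1)] by simp
qed

lemma measure_unif_Ico:
  assumes "0 \<le> a" "a \<le> b" "b \<le> 1"
  shows "measure unif {a..<b} = b - a"
proof -
  have "{0..1} \<inter> {a..<b} = {a..<b}" using assms by auto
  then show ?thesis using assms by simp
qed

lemma iid_prob_interval:
  assumes "v \<in> I" "0 \<le> a" "a \<le> b" "b \<le> 1"
  shows "iid_prob I (\<lambda>x. a \<le> x v \<and> x v < b) = b - a"
  using iid_prob_coord[OF assms(1), of "{a..<b}"] measure_unif_Ico[OF assms(2-4)] by simp

lemma iid_prob_less:
  assumes "v \<in> I" "0 \<le> c" "c \<le> 1"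
  shows "iid_prob I (\<lambda>x. x v < c) = c"
proof -
  have "{0..1} \<inter> {..<c} = {0..<c}" using assms by auto
  then show ?thesis using iid_prob_coord[OF assms(1), of "{..<c}"] assms by simp
qed

lemma iid_prob_ge:
  assumes "v \<in> I" "0 \<le> c" "c \<le> 1"
  shows "iid_prob I (\<lambda>x. c \<le> x v) = 1 - c"
proof -
  have "{0..1} \<inter> {c..} = {c..1}" using assms by auto
  then show ?thesis using iid_prob_coord[OF assms(1), of "{c..}"] assms by simp
qed

lemma local_coord:
  assumes "v \<in> V" "Measurable.pred borel R"
  shows "local_event V (\<lambda>x. R (x v))"
  by (rule local_eventI) (use assms in \<open>auto intro: measurable_compose\<close>)

lemma local_interval: "v \<in> V \<Longrightarrow> local_event V (\<lambda>x. a \<le> x v \<and> x v < b)"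
  by (rule local_coord) auto

lemma local_less: "v \<in> V \<Longrightarrow> local_event V (\<lambda>x. x v < b)"
  by (rule local_coord) auto

lemma local_ge: "v \<in> V \<Longrightarrow> local_event V (\<lambda>x. a \<le> x v)"
  by (rule local_coord) auto

lemma local_imp_ge: "(q \<Longrightarrow> v \<in> V) \<Longrightarrow> local_event V (\<lambda>x. q \<longrightarrow> a \<le> x v)"
  using local_ge[of v V a] by (cases q) (auto simp: local_event_def)

text \<open>Splits the count according to the exact set \<open>T\<close> of small coordinates. The
  cases are finitely many, mutually exclusive and products over coordinates, which gives both
  measurability and the probability.\<close>

lemma card_less_le_iff:
  assumes "finite P"
  shows "card {u \<in> P. x u < c} \<le> k \<longleftrightarrow> (\<exists>T\<in>{T \<in> Pow P. card T \<le> k}. \<forall>u\<in>P. (x u < c \<longleftrightarrow> u \<in> T))"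
proof
  assume "card {u \<in> P. x u < c} \<le> k"
  then show "\<exists>T\<in>{T \<in> Pow P. card T \<le> k}. \<forall>u\<in>P. (x u < c \<longleftrightarrow> u \<in> T)"
    by (intro bexI[of _ "{u \<in> P. x u < c}"]) auto
next
  assume "\<exists>T\<in>{T \<in> Pow P. card T \<le> k}. \<forall>u\<in>P. (x u < c \<longleftrightarrow> u \<in> T)"
  then obtain T where "T \<subseteq> P" "card T \<le> k" "\<forall>u\<in>P. (x u < c \<longleftrightarrow> u \<in> T)" by auto
  moreover from this have "{u \<in> P. x u < c} = T" by auto
  ultimately show "card {u \<in> P. x u < c} \<le> k" by simp
qed

lemma measurable_card_less:
  assumes "finite P" "\<And>u. u \<in> P \<Longrightarrow> (\<lambda>x. x u) \<in> borel_measurable M"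
  shows "Measurable.pred M (\<lambda>x. card {u \<in> P. x u < (c::real)} \<le> k)"
  unfolding card_less_le_iff[OF assms(1)]
proof (intro pred_intros_finite)
  fix T u assume "u \<in> P"
  have [measurable]: "(\<lambda>x. x u) \<in> borel_measurable M" by (rule assms) fact
  show "Measurable.pred M (\<lambda>x. (x u < c) = (u \<in> T))" by measurable
qed (use assms in auto)

lemma local_card_less: "finite P \<Longrightarrow> P \<subseteq> V \<Longrightarrow> local_event V (\<lambda>x. card {u \<in> P. x u < c} \<le> k)"
proof (rule local_eventI)
  fix x y :: "'a \<Rightarrow> real" assume "P \<subseteq> V" "\<And>v. v \<in> V \<Longrightarrow> x v = y v"
  then have "{u \<in> P. x u < c} = {u \<in> P. y u < c}" by auto
  then show "(card {u \<in> P. x u < c} \<le> k) = (card {u \<in> P. y u < c} \<le> k)" by simp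
qed (auto intro: measurable_card_less)

lemma sum_subsets_by_card:
  fixes f :: "nat \<Rightarrow> real"
  assumes "finite P"
  shows "(\<Sum>T | T \<subseteq> P \<and> card T \<le> k. f (card T)) = (\<Sum>i\<le>k. real (card P choose i) * f i)"
proof -
  have "{T. T \<subseteq> P \<and> card T \<le> k} = (\<Union>i\<in>{..k}. {T. T \<subseteq> P \<and> card T = i})" by auto
  then have "(\<Sum>T | T \<subseteq> P \<and> card T \<le> k. f (card T)) = (\<Sum>i\<le>k. \<Sum>T | T \<subseteq> P \<and> card T = i. f (card T))"
    using assms by (simp only:) (subst sum.UNION_disjoint, auto)
  also have "\<dots> = (\<Sum>i\<le>k. real (card P choose i) * f i)"
    using n_subsets[OF assms] by (intro sum.cong refl) simp
  finally show ?thesis .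
qed

text \<open>A binomial distribution function, with the size of \<open>P\<close> bounded from above
  in the exponent and from below in the binomial coefficient. The bound then depends on
  \<open>d\<close> alone, not on the number of directions that the path repeats.\<close>

lemma iid_prob_card_less_ge:
  fixes P I :: "'v set"
  assumes P: "finite P" "P \<subseteq> I" and n: "n' \<le> card P" "card P \<le> n" and c: "0 \<le> c" "c \<le> 1"
  shows "(1 - c) ^ n * (\<Sum>i\<le>k. real (n' choose i) * c ^ i) \<le> iid_prob I (\<lambda>x. card {u \<in> P. x u < c} \<le> k)"
proof -
  interpret prob_space "PiM I (\<lambda>_. unif)" by (rule prob_space_PiM_unif)
  define S where "S = {T. T \<subseteq> P \<and> card T \<le> k}"
  have fin: "finite S" using P(1) by (simp add: S_def)
  define A where "A T = {x \<in> space (PiM I (\<lambda>_. unif)). \<forall>u\<in>P. (x u < c \<longleftrightarrow> u \<in> T)}" for T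
  have loc: "local_event {u} (\<lambda>x. x u < c \<longleftrightarrow> u \<in> T)" for T u
    by (rule local_coord) auto
  have A_sets: "A T \<in> events" for T
  proof -
    have "local_event P (\<lambda>x. \<forall>u\<in>P. (x u < c \<longleftrightarrow> u \<in> T))"
    proof (rule local_eventI)
      fix M :: "('v \<Rightarrow> real) measure" assume *: "\<And>v. v \<in> P \<Longrightarrow> (\<lambda>x. x v) \<in> borel_measurable M"
      show "Measurable.pred M (\<lambda>x. \<forall>u\<in>P. (x u < c \<longleftrightarrow> u \<in> T))"
      proof (rule pred_intros_finite(3)[OF P(1)])
        fix u assume "u \<in> P"
        note [measurable] = *[OF this]
        show "Measurable.pred M (\<lambda>x. x u < c \<longleftrightarrow> u \<in> T)" by measurable
      qed
    qed auto
    from local_event_sets[OF this P(2)] show ?thesis by (simp add: A_def)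
  qed
  have prA: "prob (A T) = c ^ card T * (1 - c) ^ (card P - card T)" if "T \<subseteq> P" for T
  proof -
    have "prob (A T) = iid_prob I (\<lambda>x. \<forall>u\<in>P. (x u < c \<longleftrightarrow> u \<in> T))" by (simp add: iid_prob_def A_def)
    also have "\<dots> = (\<Prod>u\<in>P. iid_prob I (\<lambda>x. x u < c \<longleftrightarrow> u \<in> T))"
      using P loc by (intro iid_prob_blocks[of P "\<lambda>u. {u}"]) (auto simp: disjoint_family_on_def)
    also have "\<dots> = (\<Prod>u\<in>P. if u \<in> T then c else 1 - c)"
      using P(2) c iid_prob_less[of _ I c] iid_prob_ge[of _ I c] by (intro prod.cong) (auto simp: not_less)
    also have "\<dots> = c ^ card T * (1 - c) ^ (card P - card T)"
    proof -
      have "P \<inter> T = T" "P \<inter> - T = P - T" using that by auto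
      then show ?thesis using that P(1) finite_subset[OF that P(1)]
        by (simp add: prod.If_cases card_Diff_subset Int_def[symmetric] Compl_eq[symmetric])
    qed
    finally show ?thesis .
  qed
  have "(1 - c) ^ n * (\<Sum>i\<le>k. real (n' choose i) * c ^ i) \<le> (1 - c) ^ n * (\<Sum>i\<le>k. real (card P choose i) * c ^ i)"
    using n(1) c by (intro mult_left_mono sum_mono mult_right_mono) (auto intro: binomial_right_mono)
  also have "\<dots> = (\<Sum>T\<in>S. (1 - c) ^ n * c ^ card T)"
    unfolding S_def using sum_subsets_by_card[OF P(1), where k=k and f="\<lambda>i. c ^ i"] by (simp add: sum_distrib_left[symmetric])
  also have "\<dots> \<le> (\<Sum>T\<in>S. prob (A T))"
  proof (intro sum_mono)
    fix T assume "T \<in> S"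
    then have T: "T \<subseteq> P" by (simp add: S_def)
    have "(1 - c) ^ n \<le> (1 - c) ^ (card P - card T)" using c n(2) by (intro power_decreasing) auto
    then show "(1 - c) ^ n * c ^ card T \<le> prob (A T)"
      using c by (simp add: prA[OF T] mult.commute mult_left_mono)
  qed
  also have "\<dots> = prob (\<Union>T\<in>S. A T)"
  proof (rule finite_measure_finite_Union[symmetric])
    show "disjoint_family_on A S"
      unfolding disjoint_family_on_def S_def A_def by blast
  qed (use fin A_sets in auto)
  also have "(\<Union>T\<in>S. A T) = {x \<in> space (PiM I (\<lambda>_. unif)). card {u \<in> P. x u < c} \<le> k}"
    unfolding card_less_le_iff[OF P(1)] by (auto simp: A_def S_def)
  finally show ?thesis by (simp add: iid_prob_def)
qed

text \<open>The normalised sum \<open>W\<close> of the indicators has mean 1 and second moment at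
  most \<open>B\<close>. Since \<open>2 t W - t^2 W^2 = 1 - (1 - t W)^2\<close> is at most 1, and 0
  where \<open>W\<close> vanishes, its mean bounds the probability of the union from below;
  \<open>t = 1 / B\<close> gives the best value.\<close>

lemma (in prob_space) second_moment_union:
  assumes fin: "finite S" and ev: "\<And>s. s \<in> S \<Longrightarrow> A s \<in> events"
    and pos: "\<And>s. s \<in> S \<Longrightarrow> prob (A s) > 0" and q: "(\<Sum>s\<in>S. q s) = 1"
    and B: "B > 0" "(\<Sum>s\<in>S. \<Sum>s'\<in>S. q s * q s' * (prob (A s \<inter> A s') / (prob (A s) * prob (A s')))) \<le> B"
  shows "1 / B \<le> prob (\<Union>s\<in>S. A s)"
proof -
  define W where "W x = (\<Sum>s\<in>S. q s / prob (A s) * indicator (A s) x)" for x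
  define t where "t = 1 / B"
  have t: "t > 0" using B by (simp add: t_def)
  have int: "integrable M (indicator X :: _ \<Rightarrow> real)" if "X \<in> events" for X
    using that by (intro integrable_real_indicator) (auto simp: less_top[symmetric])
  have intW: "integrable M W" unfolding W_def
    by (intro Bochner_Integration.integrable_sum integrable_mult_right int ev)
  have "expectation W = (\<Sum>s\<in>S. q s / prob (A s) * prob (A s))"
    unfolding W_def using ev int by (subst Bochner_Integration.integral_sum) auto
  also have "\<dots> = (\<Sum>s\<in>S. q s)" using pos by (intro sum.cong refl) (auto simp: less_imp_neq[symmetric])
  finally have EW: "expectation W = 1" using q by simp
  have W2: "(W x)\<^sup>2 = (\<Sum>s\<in>S. \<Sum>s'\<in>S. q s * q s' / (prob (A s) * prob (A s')) * indicator (A s \<inter> A s') x)" for x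
    unfolding W_def power2_eq_square sum_product by (intro sum.cong refl) (simp add: indicator_inter_arith)
  have intW2: "integrable M (\<lambda>x. (W x)\<^sup>2)" unfolding W2
    using ev by (intro Bochner_Integration.integrable_sum integrable_mult_right int sets.Int)
  have "expectation (\<lambda>x. (W x)\<^sup>2) = (\<Sum>s\<in>S. \<Sum>s'\<in>S. q s * q s' / (prob (A s) * prob (A s')) * prob (A s \<inter> A s'))"
    unfolding W2 using ev int by (simp add: Bochner_Integration.integral_sum Bochner_Integration.integrable_sum)
  then have EW2: "expectation (\<lambda>x. (W x)\<^sup>2) \<le> B" using B(2) by simp
  have U: "(\<Union>s\<in>S. A s) \<in> events" using fin ev by auto
  have "2 * t * expectation W - t\<^sup>2 * expectation (\<lambda>x. (W x)\<^sup>2) = expectation (\<lambda>x. 2 * t * W x - t\<^sup>2 * (W x)\<^sup>2)"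
    using intW intW2 by simp
  also have "\<dots> \<le> expectation (indicator (\<Union>s\<in>S. A s))"
  proof (rule integral_mono)
    fix x
    show "2 * t * W x - t\<^sup>2 * (W x)\<^sup>2 \<le> indicator (\<Union>s\<in>S. A s) x"
    proof (cases "x \<in> (\<Union>s\<in>S. A s)")
      case True
      have "0 \<le> (1 - t * W x)\<^sup>2" by simp
      then show ?thesis using True by (simp add: power2_eq_square algebra_simps)
    next
      case False
      then have "W x = 0" unfolding W_def by (intro sum.neutral) auto
      then show ?thesis by simp
    qed
  qed (use intW intW2 U int in auto)
  also have "\<dots> = prob (\<Union>s\<in>S. A s)" using U by simp
  finally have "2 * t - t\<^sup>2 * expectation (\<lambda>x. (W x)\<^sup>2) \<le> prob (\<Union>s\<in>S. A s)" by (simp add: EW)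
  moreover have "t\<^sup>2 * expectation (\<lambda>x. (W x)\<^sup>2) \<le> t\<^sup>2 * B" using EW2 by (intro mult_left_mono) auto
  moreover have "t\<^sup>2 * B = t" using B by (simp add: t_def power2_eq_square)
  ultimately show ?thesis by (simp add: t_def)
qed

section \<open>Good paths\<close>

lemma local_conj: "local_event V Q \<Longrightarrow> local_event V R \<Longrightarrow> local_event V (\<lambda>x. Q x \<and> R x)"
  by (auto simp: local_event_def intro!: pred_intros_logic)

lemma local_True: "local_event V (\<lambda>_. True)"
  by (simp add: local_event_def)

lemma local_mono:
  assumes "local_event V Q" "V \<subseteq> I"
  shows "local_event I Q"
  unfolding local_event_def
proof (intro conjI allI)
  have L: "\<And>x. Q (restrict x V) = Q x" using assms(1) by (simp add: local_event_def)
  fix x have "Q (restrict x I) = Q (restrict (restrict x I) V)" by (simp only: L)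
  also have "restrict (restrict x I) V = restrict x V" using assms(2) by (auto simp: restrict_def fun_eq_iff)
  finally show "Q (restrict x I) = Q x" by (simp only: L)
  show "Measurable.pred (PiM I (\<lambda>_. unif)) Q"
    using local_event_sets[OF assms] by (simp add: pred_def)
qed

lemma local_ball:
  assumes "finite J" "\<And>j. j \<in> J \<Longrightarrow> local_event V (Q j)"
  shows "local_event V (\<lambda>x. \<forall>j\<in>J. Q j x)"
  using assms by (auto simp: local_event_def intro!: pred_intros_finite)

text \<open>Of the three younger neighbours allowed in the fourth layer, one is set aside for each
  path neighbour whose class does not exceed \<open>k\<close>; the rest is left to private
  neighbours.\<close>

definition budget :: "bool \<Rightarrow> nat \<Rightarrow> nat \<Rightarrow> nat" where
  "budget b k l = 3 - of_bool b - of_bool (l \<le> k)"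

text \<open>Class \<open>k\<close> means age in \<open>[k \<theta>, (k + 1) \<theta>)\<close>.  Private neighbours are tested against the upper end of the class
  rather than against the age itself, so that the event is a product over the block; corners are forced
  above all classes.  Path neighbours of the same class are counted as if each were smaller than the other.\<close>

definition good_at :: "nat \<Rightarrow> nat \<Rightarrow> real \<Rightarrow> (nat \<Rightarrow> int) \<Rightarrow> (nat \<Rightarrow> nat) \<Rightarrow> (nat \<Rightarrow> nat) \<Rightarrow> nat \<Rightarrow> ((nat \<Rightarrow> int) \<Rightarrow> real) \<Rightarrow> bool" where
  "good_at d N \<theta> z a m j X \<longleftrightarrow>
     (real (m j) * \<theta> \<le> X (path_pos z a j) \<and> X (path_pos z a j) < real (m j + 1) * \<theta>) \<and>
     (a (j - 2) \<noteq> a (j - 1) \<longrightarrow> real N * \<theta> \<le> X (corner z a j)) \<and>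
     card {u \<in> private_nbrs d z a j. X u < real (m j + 1) * \<theta>} \<le> budget (m (j - 1) \<le> m j) (m j) (m (Suc j))"

text \<open>The independent contributions of the vertex, the corner and the private neighbours. The
  corner factor is kept even where the path goes straight, and the private neighbours enter through
  the extreme sizes \<open>2 * d\<close> and \<open>2 * d - 4\<close>, so the bound is the same for
  all paths.\<close>

definition good_density :: "nat \<Rightarrow> nat \<Rightarrow> real \<Rightarrow> bool \<Rightarrow> nat \<Rightarrow> nat \<Rightarrow> real" where
  "good_density d N \<theta> b k l = \<theta> * (1 - real N * \<theta>) *
     ((1 - real (k + 1) * \<theta>) ^ (2 * d) * (\<Sum>i\<le>budget b k l. real ((2 * d - 4) choose i) * (real (k + 1) * \<theta>) ^ i))"

lemma local_good_at:
  assumes "\<And>i. a i < d"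
  shows "local_event (block d z a j) (good_at d N \<theta> z a m j)"
  unfolding good_at_def using assms
  by (intro local_conj local_interval local_imp_ge local_card_less path_pos_in_block corner_in_block finite_private private_nbrs_subset)

lemma iid_prob_good_at_ge:
  assumes a: "\<And>i. a i < d" and z: "z \<in> lattice_points d" and \<theta>: "\<theta> > 0" "real N * \<theta> \<le> 1" and m: "m j < N"
  shows "good_density d N \<theta> (m (j - 1) \<le> m j) (m j) (m (Suc j)) \<le> iid_prob (lattice_points d) (good_at d N \<theta> z a m j)"
proof -
  let ?I = "lattice_points d" and ?q = "a (j - 2) \<noteq> a (j - 1)"
  define t where "t = real (m j + 1) * \<theta>"
  define k where "k = budget (m (j - 1) \<le> m j) (m j) (m (Suc j))"
  have t: "0 \<le> t" "t \<le> 1"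
  proof -
    have "real (m j + 1) * \<theta> \<le> real N * \<theta>" using m \<theta> by (intro mult_right_mono) auto
    then show "t \<le> 1" unfolding t_def using \<theta>(2) by (rule order_trans)
  qed (use \<theta> in \<open>simp add: t_def\<close>)
  have sub: "block d z a j \<subseteq> ?I" using block_in_lattice[OF z a] .
  define V where "V i = (if i = 0 then {path_pos z a j} else if i = 1 then (if ?q then {corner z a j} else {}) else private_nbrs d z a j)" for i :: nat
  define Q where "Q i = (if i = 0 then (\<lambda>X. real (m j) * \<theta> \<le> X (path_pos z a j) \<and> X (path_pos z a j) < real (m j + 1) * \<theta>)
     else if i = 1 then (\<lambda>X. ?q \<longrightarrow> real N * \<theta> \<le> X (corner z a j))
     else (\<lambda>X. card {u \<in> private_nbrs d z a j. X u < t} \<le> k))" for i :: nat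
  have "iid_prob ?I (good_at d N \<theta> z a m j) = iid_prob ?I (\<lambda>X. \<forall>i\<in>{0,1,2}. Q i X)"
    by (intro arg_cong[of _ _ "iid_prob _"] ext) (auto simp: Q_def good_at_def t_def k_def)
  also have "\<dots> = (\<Prod>i\<in>{0,1,2}. iid_prob ?I (Q i))"
  proof (rule iid_prob_blocks[of _ V])
    show "disjoint_family_on V {0, 1, 2}"
      using corner_neq_pos[of z a j] path_pos_notin_private[of z a j d] corner_notin_private[of z a j d]
      by (auto simp: disjoint_family_on_def V_def)
    show "V i \<subseteq> ?I" for i
      using sub path_pos_in_block[of z a j d] corner_in_block[of a j d z] a private_nbrs_subset[of d z a j]
      by (auto simp: V_def)
    show "local_event (V i) (Q i)" for i
      unfolding V_def Q_def using finite_private[of d z a j]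
      by (auto intro!: local_interval local_ge local_True local_card_less)
  qed simp
  also have "\<dots> = iid_prob ?I (Q 0) * iid_prob ?I (Q 1) * iid_prob ?I (Q 2)" by simp
  also have "\<dots> \<ge> \<theta> * (1 - real N * \<theta>) *
      ((1 - t) ^ (2 * d) * (\<Sum>i\<le>k. real ((2 * d - 4) choose i) * t ^ i))"
  proof (intro mult_mono mult_nonneg_nonneg)
    show "\<theta> \<le> iid_prob ?I (Q 0)"
    proof -
      have "path_pos z a j \<in> ?I" using sub path_pos_in_block by blast
      from iid_prob_interval[OF this, of "real (m j) * \<theta>" "real (m j + 1) * \<theta>"] show ?thesis
        using t \<theta> by (simp add: Q_def t_def algebra_simps)
    qed
    show "1 - real N * \<theta> \<le> iid_prob ?I (Q 1)"
    proof (cases ?q)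
      case True
      then have "corner z a j \<in> ?I" using sub corner_in_block[of a j d z] a by blast
      from iid_prob_ge[OF this, of "real N * \<theta>"] show ?thesis using True \<theta> by (simp add: Q_def)
    next
      case False
      then show ?thesis using \<theta> prob_space.prob_space[OF prob_space_PiM_unif[of ?I]] by (simp add: Q_def iid_prob_def)
    qed
    show "(1 - t) ^ (2 * d) * (\<Sum>i\<le>k. real ((2 * d - 4) choose i) * t ^ i) \<le> iid_prob ?I (Q 2)"
    proof -
      have "private_nbrs d z a j \<subseteq> ?I" using sub private_nbrs_subset by blast
      from iid_prob_card_less_ge[OF finite_private this card_private t] show ?thesis by (simp add: Q_def)
    qed
  qed (use \<theta> t in \<open>auto intro!: sum_nonneg mult_nonneg_nonneg simp: iid_prob_nonneg\<close>)
  finally show ?thesis by (simp add: good_density_def t_def k_def)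
qed

lemma path_pos_eq_if_sqnorm_0:
  assumes "z \<in> lattice_points d" "\<And>i. a i < d" "\<And>i. a' i < d"
    and "sqnorm d (\<lambda>c. path_pos z a' j c - path_pos z a j c) = 0"
  shows "path_pos z a' j = path_pos z a j"
proof (rule ext)
  fix c
  have "path_pos z a j \<in> lattice_points d" "path_pos z a' j \<in> lattice_points d"
    using assms path_pos_in_lattice by blast+
  then show "path_pos z a' j c = path_pos z a j c"
    using assms(4) by (cases "c < d") (auto simp: sqnorm_eq_0_iff lattice_points_def PiE_def extensional_def)
qed

text \<open>If the second path is near the first one at time \<open>j\<close>, only the age bound \<open>N \<theta>\<close> of its vertex \<open>j\<close> is kept; if
  that vertex lies in a block of the first path, the neighbour condition of this block is dropped.  Vertices
  shared by both paths contribute nothing beyond consistency of the classes.\<close>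

lemma iid_prob_good_pair_le:
  fixes J :: "nat set" and n :: nat
  defines "J \<equiv> {2..<n}"
  assumes a: "\<And>i. a i < d" and a': "\<And>i. a' i < d" and z: "z \<in> lattice_points d"
    and m: "\<And>i. m i < N" and m': "\<And>i. m' i < N"
    and \<theta>: "\<theta> > 0" "real N * \<theta> \<le> 1" and q: "0 < q" "q \<le> 1"
    and p: "\<And>j. j \<in> J \<Longrightarrow> q * \<theta> \<le> iid_prob (lattice_points d) (good_at d N \<theta> z a m j)"
    and p': "\<And>j. j \<in> J \<Longrightarrow> q * \<theta> \<le> iid_prob (lattice_points d) (good_at d N \<theta> z a' m' j)"
  shows "iid_prob (lattice_points d) (\<lambda>X. (\<forall>j\<in>J. good_at d N \<theta> z a m j X) \<and> (\<forall>j\<in>J. good_at d N \<theta> z a' m' j X))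
    \<le> iid_prob (lattice_points d) (\<lambda>X. \<forall>j\<in>J. good_at d N \<theta> z a m j X) *
      iid_prob (lattice_points d) (\<lambda>X. \<forall>j\<in>J. good_at d N \<theta> z a' m' j X) *
      (\<Prod>j\<in>J. if sqnorm d (\<lambda>c. path_pos z a' j c - path_pos z a j c) > 16 then 1
         else if sqnorm d (\<lambda>c. path_pos z a' j c - path_pos z a j c) > 0 then real N / q\<^sup>2
         else if m j = m' j then 1 / iid_prob (lattice_points d) (good_at d N \<theta> z a' m' j) else 0)"
    (is "?L \<le> ?P1 * ?P2 * (\<Prod>j\<in>J. ?\<rho> j)")
proof -
  let ?I = "lattice_points d"
  let ?D = "\<lambda>j. sqnorm d (\<lambda>c. path_pos z a' j c - path_pos z a j c)"
  define G where "G = good_at d N \<theta> z a m"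
  define G' where "G' = good_at d N \<theta> z a' m'"
  have finJ: "finite J" by (simp add: J_def)
  have blk: "block d z a j \<subseteq> ?I" "block d z a' j \<subseteq> ?I" for j
    by (intro block_in_lattice z a a')+
  have locG: "local_event (block d z a j) (G j)" "local_event (block d z a' j) (G' j)" for j
    unfolding G_def G'_def by (intro local_good_at a a')+
  have P1: "?P1 = (\<Prod>j\<in>J. iid_prob ?I (G j))"
    unfolding G_def[symmetric] using finJ blk locG block_disjoint[of a d _ _ z] a
    by (intro iid_prob_blocks[of J "block d z a"]) (auto simp: disjoint_family_on_def)
  have P2: "?P2 = (\<Prod>j\<in>J. iid_prob ?I (G' j))"
    unfolding G'_def[symmetric] using finJ blk locG block_disjoint[of a' d _ _ z] a'
    by (intro iid_prob_blocks[of J "block d z a'"]) (auto simp: disjoint_family_on_def)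
  show ?thesis
  \<comment> \<open>A common vertex with two different classes would need its age in two disjoint
    intervals, so the left-hand side vanishes.\<close>
  proof (cases "\<exists>j\<in>J. ?D j = 0 \<and> m j \<noteq> m' j")
    case True
    then obtain j where j: "j \<in> J" "?D j = 0" "m j \<noteq> m' j" by blast
    have "\<not> (good_at d N \<theta> z a m j X \<and> good_at d N \<theta> z a' m' j X)" for X
    proof
      assume *: "good_at d N \<theta> z a m j X \<and> good_at d N \<theta> z a' m' j X"
      have "path_pos z a' j = path_pos z a j" by (rule path_pos_eq_if_sqnorm_0[OF z a a' j(2)])
      with * have "real (m j) * \<theta> < real (m' j + 1) * \<theta>" "real (m' j) * \<theta> < real (m j + 1) * \<theta>"
        by (auto simp: good_at_def)
      then have "real (m j) < real (m' j + 1)" "real (m' j) < real (m j + 1)"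
        using \<theta>(1) by (auto simp only: mult_less_cancel_right_pos)
      then show False using j(3) by linarith
    qed
    then have "?L = iid_prob ?I (\<lambda>X. False)" using j(1) by (intro arg_cong[of _ _ "iid_prob ?I"] ext) blast
    also have "\<dots> = 0" by (simp add: iid_prob_def)
    finally show ?thesis by (auto intro!: mult_nonneg_nonneg prod_nonneg simp: iid_prob_nonneg)
  next
    case False
    define far where "far = {j\<in>J. ?D j > 16}"
    define near where "near = {j\<in>J. 0 < ?D j \<and> ?D j \<le> 16}"
    define merged where "merged = {j\<in>J. ?D j = 0}"
    have J_split: "J = far \<union> near \<union> merged"
      using sqnorm_nonneg[of d] by (auto simp: far_def near_def merged_def less_le)
    have fins: "finite far" "finite near" "finite merged" using finJ by (auto simp: far_def near_def merged_def)
    have disj: "far \<inter> near = {}" "(far \<union> near) \<inter> merged = {}" by (auto simp: far_def near_def merged_def)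
    have prod_J: "(\<Prod>j\<in>J. f j) = (\<Prod>j\<in>far. f j) * (\<Prod>j\<in>near. f j) * (\<Prod>j\<in>merged. f j)" for f :: "nat \<Rightarrow> real"
      unfolding J_split using fins disj by (simp add: prod.union_disjoint)
    \<comment> \<open>The blocks of the first path that lose their neighbour condition. Each
      contains a near vertex of the second path, and blocks of one path are disjoint, so they can be
      charged injectively to near times.\<close>
    define bad where "bad = {i\<in>J. \<exists>j\<in>near. path_pos z a' j \<in> block d z a i}"
    have bad_near: "card bad \<le> card near"
    proof -
      obtain f where f: "\<And>i. i \<in> bad \<Longrightarrow> f i \<in> near \<and> path_pos z a' (f i) \<in> block d z a i"
      proof -
        have "\<forall>i\<in>bad. \<exists>j. j \<in> near \<and> path_pos z a' j \<in> block d z a i" by (auto simp: bad_def)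
        from bchoice[OF this] show ?thesis using that by blast
      qed
      have "inj_on f bad"
        using f block_disjoint[of a d _ _ z] a by (intro inj_onI) (metis disjoint_iff)
      then show ?thesis using f fins by (intro card_inj_on_le[of f]) auto
    qed
    \<comment> \<open>Indices of the retained conditions: \<open>Inl\<close> for the first path,
      \<open>Inr\<close> for the second. Merged times of the second path are left out, since their
      vertex is already constrained by the first.\<close>
    define K where "K = Inl ` J \<union> Inr ` (far \<union> near)"
    define V where "V s = (case s of Inl i \<Rightarrow> if i \<in> bad then {path_pos z a i} else block d z a i
       | Inr j \<Rightarrow> if j \<in> far then block d z a' j else {path_pos z a' j})" for s
    define Q where "Q s = (case s of
         Inl i \<Rightarrow> if i \<in> bad then (\<lambda>X. real (m i) * \<theta> \<le> X (path_pos z a i) \<and> X (path_pos z a i) < real (m i + 1) * \<theta>) else G i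
       | Inr j \<Rightarrow> if j \<in> far then G' j else (\<lambda>X. X (path_pos z a' j) < real N * \<theta>))" for s
    have finK: "finite K" using finJ fins by (simp add: K_def)
    have Vsub: "V s \<subseteq> ?I" for s
    proof (cases s)
      case (Inl i)
      then show ?thesis using blk(1)[of i] path_pos_in_block[of z a i d] by (auto simp: V_def)
    next
      case (Inr j)
      then show ?thesis using blk(2)[of j] path_pos_in_block[of z a' j d] by (auto simp: V_def)
    qed
    have Vloc: "local_event (V s) (Q s)" for s
      using locG by (auto simp: V_def Q_def split: sum.split intro!: local_interval local_less)
    have VInl: "V (Inl i) \<subseteq> block d z a i" "V (Inr j) \<subseteq> block d z a' j" for i j
      by (auto simp: V_def path_pos_in_block)
    have cross: "V (Inl i) \<inter> V (Inr j) = {}" if ij: "i \<in> J" "j \<in> far \<union> near" for i j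
    proof (cases "j \<in> far")
      case True
      then have "block d z a i \<inter> block d z a' j = {}"
        using blocks_meet_imp_near[where a=a and a'=a' and d=d and z=z and i=i and j=j, OF a a'] by (force simp: far_def)
      then show ?thesis using VInl by blast
    next
      case False
      then have j: "j \<in> near" using ij by blast
      show ?thesis
      proof (cases "i \<in> bad")
        case True
        have "path_pos z a i \<noteq> path_pos z a' j"
        proof
          assume eq: "path_pos z a i = path_pos z a' j"
          then have "level d (path_pos z a i) = level d (path_pos z a' j)" by simp
          then have "i = j" by (simp add: level_pos[OF a] level_pos[OF a'])
          then show False using j eq by (simp add: near_def sqnorm_def)
        qed
        then show ?thesis using True False by (simp add: V_def)
      next
        case notbad: False
        then show ?thesis using False j ij by (auto simp: V_def bad_def)
      qed
    qed
    have Vdisj: "disjoint_family_on V K"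
      unfolding disjoint_family_on_def
    proof (intro ballI impI)
      fix s s' assume s: "s \<in> K" "s' \<in> K" "s \<noteq> s'"
      show "V s \<inter> V s' = {}"
      proof (cases s; cases s')
        fix i i' assume "s = Inl i" "s' = Inl i'"
        then show ?thesis using s VInl(1)[of i] VInl(1)[of i'] block_disjoint[of a d i i' z] a by fastforce
      next
        fix i j assume "s = Inl i" "s' = Inr j"
        then show ?thesis using s cross[of i j] by (auto simp: K_def)
      next
        fix i j assume "s = Inr j" "s' = Inl i"
        then show ?thesis using s cross[of i j] by (auto simp: K_def)
      next
        fix j j' assume "s = Inr j" "s' = Inr j'"
        then show ?thesis using s VInl(2)[of j] VInl(2)[of j'] block_disjoint[of a' d j j' z] a' by fastforce
      qed
    qed
    have "?L \<le> iid_prob ?I (\<lambda>X. \<forall>s\<in>K. Q s X)"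
    proof (rule iid_prob_mono)
      fix X assume X: "(\<forall>j\<in>J. good_at d N \<theta> z a m j X) \<and> (\<forall>j\<in>J. good_at d N \<theta> z a' m' j X)"
      show "\<forall>s\<in>K. Q s X"
      proof
        fix s assume "s \<in> K"
        then consider i where "s = Inl i" "i \<in> J" | j where "s = Inr j" "j \<in> far \<union> near" by (auto simp: K_def)
        then show "Q s X"
        proof cases
          case 1 then show ?thesis using X by (auto simp: Q_def G_def good_at_def)
        next
          case 2
          then have j: "j \<in> J" by (auto simp: far_def near_def)
          then have "X (path_pos z a' j) < real (m' j + 1) * \<theta>" using X by (auto simp: good_at_def)
          also have "\<dots> \<le> real N * \<theta>" using m'[of j] \<theta> by (intro mult_right_mono) auto
          finally show ?thesis using X 2 j by (auto simp: Q_def G'_def)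
        qed
      qed
    next
      show "local_event ?I (\<lambda>X. \<forall>s\<in>K. Q s X)"
        by (intro local_ball finK local_mono[OF Vloc Vsub])
    qed simp
    also have "\<dots> = (\<Prod>s\<in>K. iid_prob ?I (Q s))"
      by (rule iid_prob_blocks[OF finK Vdisj Vsub Vloc])
    also have "\<dots> = (\<Prod>i\<in>J. iid_prob ?I (Q (Inl i))) * ((\<Prod>j\<in>far. iid_prob ?I (Q (Inr j))) * (\<Prod>j\<in>near. iid_prob ?I (Q (Inr j))))"
    proof -
      have "(\<Prod>s\<in>K. iid_prob ?I (Q s)) = (\<Prod>s\<in>Inl ` J. iid_prob ?I (Q s)) * (\<Prod>s\<in>Inr ` (far \<union> near). iid_prob ?I (Q s))"
        unfolding K_def using finJ fins by (intro prod.union_disjoint) auto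
      also have "(\<Prod>s\<in>Inl ` J. iid_prob ?I (Q s)) = (\<Prod>i\<in>J. iid_prob ?I (Q (Inl i)))"
        by (subst prod.reindex) auto
      also have "(\<Prod>s\<in>Inr ` (far \<union> near). iid_prob ?I (Q s)) = (\<Prod>j\<in>far \<union> near. iid_prob ?I (Q (Inr j)))"
        by (subst prod.reindex) auto
      also have "\<dots> = (\<Prod>j\<in>far. iid_prob ?I (Q (Inr j))) * (\<Prod>j\<in>near. iid_prob ?I (Q (Inr j)))"
        using fins disj by (intro prod.union_disjoint) auto
      finally show ?thesis .
    qed
    also have "(\<Prod>j\<in>far. iid_prob ?I (Q (Inr j))) = (\<Prod>j\<in>far. iid_prob ?I (G' j))"
      by (intro prod.cong) (auto simp: Q_def)
    also have "(\<Prod>j\<in>near. iid_prob ?I (Q (Inr j))) = (\<Prod>j\<in>near. real N * \<theta>)"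
    proof (intro prod.cong refl)
      fix j assume "j \<in> near"
      then have "j \<notin> far" using disj by blast
      moreover have "path_pos z a' j \<in> ?I" using blk(2)[of j] path_pos_in_block by blast
      ultimately show "iid_prob ?I (Q (Inr j)) = real N * \<theta>"
        using iid_prob_less[of "path_pos z a' j" ?I "real N * \<theta>"] \<theta> by (simp add: Q_def)
    qed
    \<comment> \<open>Reducing a bad block to the age interval of its vertex raises its probability
      to \<open>\<theta>\<close>, which by \<open>p\<close> costs at most a factor
      \<open>1 / q\<close>.\<close>
    also have "(\<Prod>i\<in>J. iid_prob ?I (Q (Inl i))) \<le> (\<Prod>i\<in>J. iid_prob ?I (G i) * (if i \<in> bad then 1 / q else 1))"
    proof (intro prod_mono conjI iid_prob_nonneg)
      fix i assume i: "i \<in> J"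
      show "iid_prob ?I (Q (Inl i)) \<le> iid_prob ?I (G i) * (if i \<in> bad then 1 / q else 1)"
      proof (cases "i \<in> bad")
        case True
        have "real (m i + 1) * \<theta> \<le> real N * \<theta>" using m[of i] \<theta> by (intro mult_right_mono) auto
        moreover have "path_pos z a i \<in> ?I" using blk(1)[of i] path_pos_in_block by blast
        ultimately have "iid_prob ?I (Q (Inl i)) = \<theta>"
          using True iid_prob_interval[of "path_pos z a i" ?I "real (m i) * \<theta>" "real (m i + 1) * \<theta>"] \<theta>
          by (simp add: Q_def algebra_simps)
        then show ?thesis using p[OF i] True q by (simp add: G_def field_simps)
      qed (simp add: Q_def)
    qed
    also have "\<dots> = ?P1 * (1 / q) ^ card bad"
    proof -
      have "J \<inter> bad = bad" by (auto simp: bad_def)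
      then show ?thesis using finJ by (simp add: P1 prod.distrib prod.If_cases)
    qed
    also have "\<dots> \<le> ?P1 * (1 / q) ^ card near"
      using bad_near q by (intro mult_left_mono power_increasing iid_prob_nonneg) auto
    finally have "?L \<le> ?P1 * (1 / q) ^ card near * ((\<Prod>j\<in>far. iid_prob ?I (G' j)) * (\<Prod>j\<in>near. real N * \<theta>))"
      using \<theta> by (auto simp: mult_right_mono prod_nonneg iid_prob_nonneg)
    also have "\<dots> = ?P1 * ((\<Prod>j\<in>far. iid_prob ?I (G' j)) * (\<Prod>j\<in>near. real N * \<theta> / q))"
      by (simp add: power_divide field_simps)
    also have "\<dots> \<le> ?P1 * (?P2 * (\<Prod>j\<in>J. ?\<rho> j))"
    proof (rule mult_left_mono[OF _ iid_prob_nonneg])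
      have "?P2 * (\<Prod>j\<in>J. ?\<rho> j) = (\<Prod>j\<in>J. iid_prob ?I (G' j) * ?\<rho> j)" by (simp add: P2 prod.distrib)
      also have "\<dots> = (\<Prod>j\<in>far. iid_prob ?I (G' j)) * (\<Prod>j\<in>near. iid_prob ?I (G' j) * (real N / q\<^sup>2)) * (\<Prod>j\<in>merged. 1)"
      proof -
        have "(\<Prod>j\<in>merged. iid_prob ?I (G' j) * ?\<rho> j) = (\<Prod>j\<in>merged. 1)"
        proof (intro prod.cong refl)
          fix j assume j: "j \<in> merged"
          then have "j \<in> J" "0 < q * \<theta>" using q \<theta> by (auto simp: merged_def)
          then have "0 < iid_prob ?I (G' j)" using p'[of j] unfolding G'_def by linarith
          moreover have "m j = m' j" using j False by (auto simp: merged_def)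
          ultimately show "iid_prob ?I (G' j) * ?\<rho> j = 1" using j by (simp add: merged_def G'_def)
        qed
        moreover have "(\<Prod>j\<in>far. iid_prob ?I (G' j) * ?\<rho> j) = (\<Prod>j\<in>far. iid_prob ?I (G' j))"
          by (intro prod.cong refl) (simp add: far_def)
        moreover have "(\<Prod>j\<in>near. iid_prob ?I (G' j) * ?\<rho> j) = (\<Prod>j\<in>near. iid_prob ?I (G' j) * (real N / q\<^sup>2))"
          by (intro prod.cong refl) (simp add: near_def)
        ultimately show ?thesis by (simp only: prod_J)
      qed
      also have "\<dots> \<ge> (\<Prod>j\<in>far. iid_prob ?I (G' j)) * (\<Prod>j\<in>near. real N * \<theta> / q)"
      proof -
        \<comment> \<open>The second factor \<open>1 / q\<close> comes from comparing
          \<open>N * \<theta>\<close> with the true probability, which is at least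
          \<open>q * \<theta>\<close>.\<close>
        have "(\<Prod>j\<in>near. real N * \<theta> / q) \<le> (\<Prod>j\<in>near. iid_prob ?I (G' j) * (real N / q\<^sup>2))"
        proof (intro prod_mono conjI)
          fix j assume "j \<in> near"
          then have "q * \<theta> * (real N / q\<^sup>2) \<le> iid_prob ?I (G' j) * (real N / q\<^sup>2)"
            using p'[of j] by (intro mult_right_mono) (auto simp: near_def G'_def)
          moreover have "q * \<theta> * (real N / q\<^sup>2) = real N * \<theta> / q"
            using q by (simp add: power2_eq_square)
          ultimately show "real N * \<theta> / q \<le> iid_prob ?I (G' j) * (real N / q\<^sup>2)" by linarith
        qed (use q \<theta> in simp)
        then show ?thesis by (simp add: mult_left_mono prod_nonneg iid_prob_nonneg)
      qed
      finally show "(\<Prod>j\<in>far. iid_prob ?I (G' j)) * (\<Prod>j\<in>near. real N * \<theta> / q) \<le> ?P2 * (\<Prod>j\<in>J. ?\<rho> j)" .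
    qed
    finally show ?thesis by (simp add: mult.assoc)
  qed
qed

section \<open>The local limit and its growth rate\<close>

text \<open>Chosen so that \<open>2 * d\<close> times the width is \<open>3/8\<close>: the mean
  number of neighbours younger than the upper end of class \<open>k\<close> tends to
  \<open>3/8 * (k + 1)\<close>. Twelve classes reach a mean of \<open>9/2\<close>.\<close>

definition class_width :: "nat \<Rightarrow> real" where
  "class_width d = 3 / (16 * real d)"

text \<open>The Poisson limit of \<open>2 d\<close> times \<open>good_density\<close>, with \<open>343/500\<close> as a lower bound for \<open>exp (- 3/8)\<close>.\<close>

definition limit_density :: "bool \<Rightarrow> nat \<Rightarrow> nat \<Rightarrow> real" where
  "limit_density b k l = 3/8 * ((343/500) ^ (k + 1) * (\<Sum>i\<le>budget b k l. (3/8 * real (k + 1)) ^ i / fact i))"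

text \<open>Rounded Perron vector of the transfer matrix of \<open>limit_density\<close>, computed numerically.\<close>

definition class_value :: "bool \<Rightarrow> nat \<Rightarrow> real" where
  "class_value b k = (if b then [99, 92, 80, 68, 55, 44, 34, 26, 20, 15, 11, 8]
     else [100, 98, 95, 89, 81, 72, 63, 54, 45, 37, 30, 24]) ! k"

section \<open>Poisson limit of the densities\<close>

lemma binomial_times_power_tendsto:
  "(\<lambda>d. real ((2 * d - 4) choose i) * (t / (2 * real d)) ^ i) \<longlonglongrightarrow> t ^ i / fact i"
proof -
  have ev: "\<forall>\<^sub>F d in sequentially. (\<Prod>j<i. t - (4 + real j) * t / (2 * real d)) / fact i =
      real ((2 * d - 4) choose i) * (t / (2 * real d)) ^ i"
    \<comment> \<open>From \<open>d = 2\<close> on, the subtraction in \<open>2 * d - 4\<close> does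
      not truncate.\<close>
    using eventually_ge_at_top[of 2]
  proof eventually_elim
    case (elim d)
    have "real ((2 * d - 4) choose i) = (\<Prod>j<i. 2 * real d - 4 - real j) / fact i"
      using elim by (simp add: binomial_gbinomial gbinomial_prod_rev of_nat_diff atLeast0LessThan)
    then have "real ((2 * d - 4) choose i) * (t / (2 * real d)) ^ i =
        (\<Prod>j<i. (2 * real d - 4 - real j) * (t / (2 * real d))) / fact i"
      unfolding prod.distrib by simp
    also have "(\<Prod>j<i. (2 * real d - 4 - real j) * (t / (2 * real d))) = (\<Prod>j<i. t - (4 + real j) * t / (2 * real d))"
      using elim by (intro prod.cong refl) (simp add: field_simps)
    finally show ?case by simp
  qed
  have "(\<lambda>d. (\<Prod>j<i. t - (4 + real j) * t / (2 * real d)) / fact i) \<longlonglongrightarrow> (\<Prod>j<i. t - 0) / fact i"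
  proof (intro tendsto_intros tendsto_prod)
    fix j
    have "(\<lambda>d. (4 + real j) * t / 2 * (1 / real d)) \<longlonglongrightarrow> (4 + real j) * t / 2 * 0"
      by (intro tendsto_intros lim_1_over_n)
    then show "(\<lambda>d. (4 + real j) * t / (2 * real d)) \<longlonglongrightarrow> 0" by simp
  qed auto
  then show ?thesis using Lim_transform_eventually[OF _ ev] by simp
qed

lemma one_minus_power_tendsto: "(\<lambda>d. (1 - t / (2 * real d)) ^ (2 * d)) \<longlonglongrightarrow> exp (- t)"
proof -
  have "strict_mono (\<lambda>d::nat. 2 * d)" by (auto simp: strict_mono_def)
  from LIMSEQ_subseq_LIMSEQ[OF tendsto_exp_limit_sequentially[of "- t"] this]
  show ?thesis by (simp add: o_def)
qed

text \<open>The quadratic bound for \<open>exp\<close> is applied at \<open>3/512\<close> and raised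
  to the power 64 in two stages, with rounding in between to keep the rationals short.\<close>

lemma exp_bound_343_500: "343/500 < exp (- (3/8) :: real)"
proof -
  have "exp (3/8 :: real) = exp (3/512) ^ 64" by (simp add: exp_of_nat_mult[symmetric])
  also have "\<dots> \<le> (1 + 3/512 + (3/512)\<^sup>2) ^ 64" by (intro power_mono exp_bound) auto
  also have "\<dots> = ((1 + 3/512 + (3/512)\<^sup>2) ^ 8) ^ 8" by (simp only: power_mult[symmetric]) simp
  also have "\<dots> \<le> (10482/10000) ^ 8"
    by (intro power_mono) (simp_all add: power2_eq_square power_divide)
  also have "\<dots> < 500/343" by (simp add: power_divide)
  finally have "inverse (500/343) < inverse (exp (3/8 :: real))" by (intro less_imp_inverse_less) auto
  then show ?thesis by (simp add: exp_minus)
qed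

text \<open>Replacing \<open>exp (- 3/8)\<close> by the smaller \<open>343/500\<close> leaves strict
  room below the limit, so the inequality holds for all large \<open>d\<close>; the corner factor
  \<open>1 - 9 / (4 d)\<close> disappears in the limit.\<close>

lemma density_ge_limit_density:
  "\<forall>\<^sub>F d in sequentially. limit_density b k l / (2 * real d) \<le> good_density d 12 (class_width d) b k l"
proof -
  define t where "t = 3/8 * real (k + 1)"
  define S where "S = (\<Sum>i\<le>budget b k l. t ^ i / fact i)"
  have S: "S > 0"
  proof -
    have "(\<Sum>i\<in>{0}. t ^ i / fact i) \<le> S" unfolding S_def by (intro sum_mono2) (auto simp: t_def)
    then show ?thesis by simp
  qed
  define F where "F d = (1 - 9/4 * (1 / real d)) *
     ((1 - t / (2 * real d)) ^ (2 * d) * (\<Sum>i\<le>budget b k l. real ((2 * d - 4) choose i) * (t / (2 * real d)) ^ i))" for d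
  have "F \<longlonglongrightarrow> (1 - 9/4 * 0) * (exp (- t) * S)"
    unfolding F_def S_def
    by (intro tendsto_intros lim_1_over_n one_minus_power_tendsto binomial_times_power_tendsto)
  moreover have "(343/500) ^ (k + 1) * S < (1 - 9/4 * 0) * (exp (- t) * S)"
  proof -
    have "(343/500) ^ (k + 1) < exp (- (3/8) :: real) ^ (k + 1)"
      using exp_bound_343_500 by (intro power_strict_mono) auto
    also have "\<dots> = exp (- t)" by (simp add: exp_of_nat_mult[symmetric] t_def algebra_simps del: power_Suc)
    finally show ?thesis using S by simp
  qed
  ultimately have "\<forall>\<^sub>F d in sequentially. (343/500) ^ (k + 1) * S < F d" by (rule order_tendstoD(1))
  then show ?thesis using eventually_gt_at_top[of 0]
  proof eventually_elim
    case (elim d)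
    have t: "real (k + 1) * class_width d = t / (2 * real d)" "real 12 * class_width d = 9/4 * (1 / real d)"
      by (simp_all add: t_def class_width_def)
    have "good_density d 12 (class_width d) b k l = class_width d * F d"
      unfolding good_density_def F_def t by (simp only: mult.assoc)
    moreover have "limit_density b k l / (2 * real d) = class_width d * ((343/500) ^ (k + 1) * S)"
      by (simp add: limit_density_def class_width_def S_def t_def)
    moreover have "class_width d > 0" using elim by (simp add: class_width_def)
    ultimately show ?case using elim by (simp only: mult_left_mono less_imp_le)
  qed
qed

section \<open>Numerical verification of the growth inequality\<close>

lemma lessThan_12: "{..<12::nat} = {0,1,2,3,4,5,6,7,8,9,10,11}"
  by (auto simp: lessThan_nat_numeral lessThan_Suc)

lemma limit_density_pos: "limit_density b k l > 0"
proof -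
  have "(\<Sum>i\<in>{0}. (3/8 * real (k + 1)) ^ i / fact i) \<le> (\<Sum>i\<le>budget b k l. (3/8 * real (k + 1)) ^ i / fact i)"
    by (intro sum_mono2) auto
  then show ?thesis by (simp add: limit_density_def)
qed

lemma less_12_cases:
  "k < (12::nat) \<Longrightarrow> k = 0 \<or> k = 1 \<or> k = 2 \<or> k = 3 \<or> k = 4 \<or> k = 5 \<or> k = 6 \<or> k = 7 \<or> k = 8 \<or> k = 9 \<or> k = 10 \<or> k = 11"
  using lessThan_12 by blast

lemma class_value_pos: "k < 12 \<Longrightarrow> class_value b k > 0"
  by (drule less_12_cases, elim disjE; hypsubst; simp add: class_value_def)

lemma class_value_prefix: "k < 12 \<Longrightarrow>
  (\<Sum>l<k. class_value False l) = [0, 100, 198, 293, 382, 463, 535, 598, 652, 697, 734, 764] ! k"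
  by (drule less_12_cases, elim disjE; hypsubst; simp add: class_value_def lessThan_nat_numeral lessThan_Suc)

lemma class_value_suffix: "k < 12 \<Longrightarrow>
  (\<Sum>l\<in>{Suc k..<12}. class_value True l) = [453, 361, 281, 213, 158, 114, 80, 54, 34, 19, 8, 0] ! k"
  by (drule less_12_cases, elim disjE; hypsubst; simp add: class_value_def atLeastLessThan_nat_numeral)

lemma class_value_numeric:
  assumes "k < 12" and t: "t = 3/8 * real (k + 1)"
  shows "2 * (102/100) * class_value b k \<le> 3/8 * (343/500) ^ (k + 1) *
    ((1 + t + of_bool (\<not> b) * t\<^sup>2 / 2) * ([0, 100, 198, 293, 382, 463, 535, 598, 652, 697, 734, 764] ! k + class_value True k)
      + (1 + t + t\<^sup>2 / 2 + of_bool (\<not> b) * t ^ 3 / 6) * ([453, 361, 281, 213, 158, 114, 80, 54, 34, 19, 8, 0] ! k))"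
  \<comment> \<open>The 12 classes and the two bits give 24 closed rational inequalities.\<close>
  using less_12_cases[OF assms(1)] unfolding t
  by (elim disjE; hypsubst; cases b; simp add: class_value_def power_divide)

lemma sum_split_at:
  assumes "k < (12::nat)"
  shows "(\<Sum>l<12. f l) = (\<Sum>l<k. f l) + f k + (\<Sum>l\<in>{Suc k..<12}. f l :: real)"
proof -
  have "{..<12} = insert k {..<k} \<union> {Suc k..<12}" using assms by auto
  then have "sum f {..<12} = sum f (insert k {..<k} \<union> {Suc k..<12})" by (rule arg_cong)
  also have "\<dots> = sum f (insert k {..<k}) + sum f {Suc k..<12}"
    by (rule sum.union_disjoint) auto
  finally show ?thesis by (simp add: add.commute)
qed

text \<open>A row of the transfer matrix takes only two values, according to whether
  \<open>l \<le> k\<close>, and \<open>class_value\<close> is read with bit \<open>False\<close>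
  exactly for \<open>l < k\<close>. So each row sum collapses to a tabulated prefix sum, the term
  \<open>l = k\<close> and a tabulated suffix sum.\<close>

lemma limit_density_growth:
  assumes "k < 12"
  shows "2 * (102/100) * class_value b k \<le> (\<Sum>l<12. limit_density b k l * class_value (k \<le> l) l)"
proof -
  define t where "t = 3/8 * real (k + 1)"
  define S where "S n = (\<Sum>i\<le>n. t ^ i / fact i)" for n :: nat
  have S: "S (Suc 0) = 1 + t" "S 2 = 1 + t + t\<^sup>2 / 2" "S 3 = 1 + t + t\<^sup>2 / 2 + t ^ 3 / 6"
    by (simp_all add: S_def numeral_eq_Suc)
  have S': "S (2 - of_bool b) = 1 + t + of_bool (\<not> b) * t\<^sup>2 / 2"
    "S (3 - of_bool b) = 1 + t + t\<^sup>2 / 2 + of_bool (\<not> b) * t ^ 3 / 6"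
    by (cases b; simp add: S)+
  define c where "c = 3/8 * (343/500::real) ^ (k + 1)"
  have L: "limit_density b k l = c * S (budget b k l)" for l
    unfolding limit_density_def S_def t_def c_def by (simp only: mult.assoc)
  have "(\<Sum>l<k. limit_density b k l * class_value (k \<le> l) l) = c * S (2 - of_bool b) * (\<Sum>l<k. class_value False l)"
    unfolding sum_distrib_left L by (intro sum.cong refl) (simp add: budget_def)
  moreover have "limit_density b k k * class_value (k \<le> k) k = c * S (2 - of_bool b) * class_value True k"
    by (simp add: L budget_def)
  moreover have "(\<Sum>l\<in>{Suc k..<12}. limit_density b k l * class_value (k \<le> l) l) = c * S (3 - of_bool b) * (\<Sum>l\<in>{Suc k..<12}. class_value True l)"
    unfolding sum_distrib_left L by (intro sum.cong refl) (simp add: budget_def)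
  ultimately have "(\<Sum>l<12. limit_density b k l * class_value (k \<le> l) l) =
    c * (S (2 - of_bool b) * ((\<Sum>l<k. class_value False l) + class_value True k)
      + S (3 - of_bool b) * (\<Sum>l\<in>{Suc k..<12}. class_value True l))"
    unfolding sum_split_at[OF assms] by (simp only: distrib_left mult.assoc)
  also have "\<dots> \<ge> 2 * (102/100) * class_value b k"
    unfolding class_value_prefix[OF assms] class_value_suffix[OF assms] S' c_def
    by (rule class_value_numeric[OF assms t_def])
  finally show ?thesis .
qed

section \<open>The second moment bound\<close>

lemma class_chain_ages: "class_chain 12 limit_density class_value (102/100)"
proof
  show "0 < limit_density b k l" for b k l by (rule limit_density_pos)
  show "0 < class_value b k" if "k < 12" for b k using that by (rule class_value_pos)
  show "2 * (102/100) * class_value b k \<le> (\<Sum>l<12. limit_density b k l * class_value (k \<le> l) l)"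
    if "k < 12" for b k using that by (rule limit_density_growth)
qed simp

abbreviation "age_steps \<equiv> class_chain.step_lists 12"
abbreviation "age_weight \<equiv> class_chain.path_weight 12 limit_density class_value"
abbreviation "age_overlap_factor \<equiv> class_chain.overlap_factor limit_density"
abbreviation "age_path_overlap_factor \<equiv> class_chain.path_overlap_factor limit_density"

lemmas age_steps_def = class_chain.step_lists_def[OF class_chain_ages]
  and age_overlap_factor_def = class_chain.overlap_factor_def[OF class_chain_ages]

text \<open>The list of steps starts at time 2, because \<open>good_at\<close> looks back two steps.\<close>

definition path_dir :: "(nat \<times> nat) list \<Rightarrow> nat \<Rightarrow> nat" where
  "path_dir ls j = (if 2 \<le> j \<and> j - 2 < length ls then fst (ls ! (j - 2)) else 0)"

text \<open>A step carries the direction out of its vertex but the class of the vertex it reaches,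
  whence an offset one larger than in \<open>path_dir\<close>. The default 0 is the class at time 2
  and before, which is the initial state of the chain.\<close>

definition path_class :: "(nat \<times> nat) list \<Rightarrow> nat \<Rightarrow> nat" where
  "path_class ls j = (if 3 \<le> j \<and> j - 3 < length ls then snd (ls ! (j - 3)) else 0)"

lemma path_dir_less: "ls \<in> age_steps d n \<Longrightarrow> d > 0 \<Longrightarrow> path_dir ls j < d"
proof -
  assume ls: "ls \<in> age_steps d n" and d: "d > 0"
  have "fst (ls ! i) < d" if "i < length ls" for i
    using ls nth_mem[OF that] by (auto simp: age_steps_def)
  then show ?thesis using d by (simp add: path_dir_def)
qed

lemma path_class_less: "ls \<in> age_steps d n \<Longrightarrow> path_class ls j < 12"
proof -
  assume ls: "ls \<in> age_steps d n"
  have "snd (ls ! i) < 12" if "i < length ls" for i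
    using ls nth_mem[OF that] by (auto simp: age_steps_def)
  then show ?thesis by (simp add: path_class_def)
qed

lemma path_pos_path_dir:
  assumes "i \<le> length ls"
  shows "path_pos z (path_dir ls) (i + 2) c = path_pos z (\<lambda>_. 0) 2 c + int (card {t. t < i \<and> fst (ls ! t) = c})"
proof -
  have split: "{t. t < i + 2 \<and> path_dir ls t = c} = {t. t < 2 \<and> 0 = c} \<union> (\<lambda>t. t + 2) ` {t. t < i \<and> fst (ls ! t) = c}"
    (is "?A = ?B")
  proof (rule set_eqI)
    fix t
    show "t \<in> ?A \<longleftrightarrow> t \<in> ?B"
    proof (cases "t < 2")
      case True then show ?thesis by (auto simp: path_dir_def)
    next
      case False
      then have "t = (t - 2) + 2" by simp
      then obtain u where "t = u + 2" by blast
      then show ?thesis using assms by (auto simp: path_dir_def)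
    qed
  qed
  have "card {t. t < i + 2 \<and> path_dir ls t = c} =
      card {t::nat. t < 2 \<and> 0 = c} + card ((\<lambda>t. t + 2) ` {t. t < i \<and> fst (ls ! t) = c})"
    unfolding split by (rule card_Un_disjoint) auto
  moreover have "card ((\<lambda>t. t + 2) ` {t. t < i \<and> fst (ls ! t) = c}) = card {t. t < i \<and> fst (ls ! t) = c}"
    by (intro card_image) (auto simp: inj_on_def)
  ultimately show ?thesis unfolding path_pos_eq_card by simp
qed

lemma path_class_nth: "i \<le> length ls \<Longrightarrow> path_class ls (i + 2) = (0 # map snd ls) ! i"
  by (cases i) (simp_all add: path_class_def)

definition path_event :: "nat \<Rightarrow> (nat \<Rightarrow> int) \<Rightarrow> nat \<Rightarrow> (nat \<times> nat) list \<Rightarrow> ((nat \<Rightarrow> int) \<Rightarrow> real) \<Rightarrow> bool" where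
  "path_event d z n ls X \<longleftrightarrow> (\<forall>j\<in>{2..<n+2}. good_at d 12 (class_width d) z (path_dir ls) (path_class ls) j X)"

text \<open>The second moment method with one event per typed path, weighted by the law of the
  transformed chain. The probability ratio is bounded by the overlap factors, time by time, so the
  resulting bound is uniform in \<open>n\<close> and \<open>z\<close>.\<close>

lemma good_path_probability:
  "\<exists>d\<^sub>0. \<forall>d\<ge>d\<^sub>0. \<exists>\<beta>>0. \<forall>z\<in>lattice_points d. \<forall>n.
     \<beta> \<le> iid_prob (lattice_points d) (\<lambda>X. \<exists>ls\<in>age_steps d n. path_event d z n ls X)"
proof -
  define S where "S = insert 1 ((\<lambda>(b, k, l). limit_density b k l / (3/8)) ` (UNIV \<times> {..<12} \<times> {..<12}))"
  have S: "finite S" "S \<noteq> {}" by (simp_all add: S_def)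
  \<comment> \<open>As the class width is \<open>3/8\<close> divided by \<open>2 * d\<close>, the
    least value of \<open>limit_density / (3/8)\<close> is a lower bound, uniform in
    \<open>d\<close>, for the probability of \<open>good_at\<close> divided by the class width.
    Including 1 in \<open>S\<close> gives \<open>q \<le> 1\<close>.\<close>
  define q where "q = Min S"
  have q_pos: "0 < q"
    unfolding q_def using S limit_density_pos by (subst Min_gr_iff) (auto simp: S_def)
  have q_le: "q \<le> 1" unfolding q_def using S by (intro Min_le) (auto simp: S_def)
  have q_density: "q * (3/8) \<le> limit_density b k l" if "k < 12" "l < 12" for b k l
  proof -
    have "q \<le> limit_density b k l / (3/8)"
      unfolding q_def using S that by (intro Min_le) (auto simp: S_def image_iff)
    then show ?thesis by simp
  qed
  define C where "C = 12 / q\<^sup>2"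
  have C: "C > 0" using q_pos by (simp add: C_def)
  obtain d1 where d1: "\<And>d. d \<ge> d1 \<Longrightarrow> \<exists>B. \<forall>n. \<forall>k<12. (\<Sum>ls\<in>age_steps d n. \<Sum>ls'\<in>age_steps d n.
    age_weight d True k ls * age_weight d True k ls' * age_path_overlap_factor C d (\<lambda>_. 0) k True k ls ls') \<le> B k"
    using class_chain.path_pair_sum_bounded[OF class_chain_ages C, of True] by blast
  have "\<forall>\<^sub>F d in sequentially. \<forall>x\<in>UNIV \<times> {..<12} \<times> {..<12}. case x of (b, k, l) \<Rightarrow>
      limit_density b k l / (2 * real d) \<le> good_density d 12 (class_width d) b k l"
    by (intro eventually_ball_finite) (auto intro: density_ge_limit_density)
  then obtain d2 where d2: "\<And>d b k l. d \<ge> d2 \<Longrightarrow> k < 12 \<Longrightarrow> l < 12 \<Longrightarrow>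
      limit_density b k l / (2 * real d) \<le> good_density d 12 (class_width d) b k l"
    unfolding eventually_sequentially by fastforce
  show ?thesis
  \<comment> \<open>From \<open>d = 3\<close> on, the twelve classes fit into the unit interval:
    \<open>9 / (4 d) \<le> 1\<close>.\<close>
  proof (intro exI[of _ "max (max d1 d2) 3"] allI impI)
    fix d assume "max (max d1 d2) 3 \<le> d"
    then have d: "d1 \<le> d" "d2 \<le> d" "3 \<le> d" by auto
    then have d0: "d > 0" by simp
    let ?I = "lattice_points d"
    have \<theta>: "class_width d > 0" "real 12 * class_width d \<le> 1" using d by (auto simp: class_width_def field_simps)
    obtain B0 where B0: "\<And>n. (\<Sum>ls\<in>age_steps d n. \<Sum>ls'\<in>age_steps d n.
      age_weight d True 0 ls * age_weight d True 0 ls' * age_path_overlap_factor C d (\<lambda>_. 0) 0 True 0 ls ls') \<le> B0"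
    proof -
      obtain B where "\<forall>n. \<forall>k<12. (\<Sum>ls\<in>age_steps d n. \<Sum>ls'\<in>age_steps d n.
        age_weight d True k ls * age_weight d True k ls' * age_path_overlap_factor C d (\<lambda>_. 0) k True k ls ls') \<le> B k"
        using d1[OF d(1)] by blast
      then show ?thesis by (intro that[of "B 0"]) simp
    qed
    define B where "B = max 1 B0"
    show "\<exists>\<beta>>0. \<forall>z\<in>?I. \<forall>n. \<beta> \<le> iid_prob ?I (\<lambda>X. \<exists>ls\<in>age_steps d n. path_event d z n ls X)"
    proof (intro exI[of _ "1 / B"] conjI ballI allI)
      show "0 < 1 / B" by (simp add: B_def)
      fix z n assume z: "z \<in> ?I"
      interpret prob_space "PiM ?I (\<lambda>_. unif)" by (rule prob_space_PiM_unif)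
      define A where "A ls = {X \<in> space (PiM ?I (\<lambda>_. unif)). path_event d z n ls X}" for ls
      define G where "G ls = good_at d 12 (class_width d) z (path_dir ls) (path_class ls)" for ls
      note dir = path_dir_less[OF _ d0]
      have locG: "local_event ?I (G ls j)" if "ls \<in> age_steps d n" for ls j
        unfolding G_def using dir[OF that] z
        by (intro local_mono[OF local_good_at] block_in_lattice)
      have loc: "local_event ?I (path_event d z n ls)" if "ls \<in> age_steps d n" for ls
      proof -
        have "local_event ?I (\<lambda>X. \<forall>j\<in>{2..<n+2}. G ls j X)"
          by (intro local_ball locG that) simp
        then show ?thesis by (simp add: path_event_def[abs_def] G_def)
      qed
      have A_ev: "A ls \<in> events" if "ls \<in> age_steps d n" for ls
        unfolding A_def by (rule local_event_sets[OF loc[OF that]]) simp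
      have pA: "prob (A ls) = iid_prob ?I (path_event d z n ls)" for ls by (simp add: A_def iid_prob_def)
      have lower: "limit_density (path_class ls (j - 1) \<le> path_class ls j) (path_class ls j) (path_class ls (Suc j)) / (2 * real d)
          \<le> iid_prob ?I (G ls j)" if "ls \<in> age_steps d n" for ls j
        using d2[OF d(2) path_class_less[OF that] path_class_less[OF that]]
          iid_prob_good_at_ge[where a="path_dir ls" and m="path_class ls" and j=j, OF dir[OF that] z \<theta> path_class_less[OF that]]
        unfolding G_def by (rule order_trans)
      have lower_q: "q * class_width d \<le> iid_prob ?I (G ls j)" if "ls \<in> age_steps d n" for ls j
      proof -
        have "q * class_width d = q * (3/8) / (2 * real d)" by (simp add: class_width_def)
        also have "\<dots> \<le> limit_density (path_class ls (j - 1) \<le> path_class ls j) (path_class ls j) (path_class ls (Suc j)) / (2 * real d)"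
          by (intro divide_right_mono q_density path_class_less[OF that]) auto
        finally show ?thesis using lower[OF that, of j] by linarith
      qed
      have q\<theta>: "q * class_width d > 0" using q_pos \<theta> by simp
      have prod: "iid_prob ?I (path_event d z n ls) = (\<Prod>j\<in>{2..<n+2}. iid_prob ?I (G ls j))" if "ls \<in> age_steps d n" for ls
      proof -
        have "iid_prob ?I (\<lambda>X. \<forall>j\<in>{2..<n+2}. G ls j X) = (\<Prod>j\<in>{2..<n+2}. iid_prob ?I (G ls j))"
          unfolding G_def using dir[OF that] z block_disjoint[of "path_dir ls" d _ _ z] block_in_lattice[of z d "path_dir ls"]
          by (intro iid_prob_blocks[of _ "block d z (path_dir ls)"] local_good_at) (auto simp: disjoint_family_on_def)
        then show ?thesis by (simp add: path_event_def[abs_def] G_def)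
      qed
      have pos: "prob (A ls) > 0" if "ls \<in> age_steps d n" for ls
        unfolding pA prod[OF that] using lower_q[OF that] q\<theta> by (intro prod_pos) (auto intro: less_le_trans)
      have ratio: "prob (A ls \<inter> A ls') / (prob (A ls) * prob (A ls')) \<le> age_path_overlap_factor C d (\<lambda>_. 0) 0 True 0 ls ls'"
        if ls: "ls \<in> age_steps d n" and ls': "ls' \<in> age_steps d n" for ls ls'
      proof -
        have len: "length ls = n" "length ls' = n" using ls ls' by (auto simp: age_steps_def)
        let ?a = "path_dir ls" and ?a' = "path_dir ls'"
        define R where "R j = sqnorm d (\<lambda>c. path_pos z ?a' j c - path_pos z ?a j c)" for j
        define \<rho> where "\<rho> j = (if R j > 16 then 1 else if R j > 0 then real 12 / q\<^sup>2
           else if path_class ls j = path_class ls' j then 1 / iid_prob ?I (G ls' j) else 0)" for j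
        have "prob (A ls \<inter> A ls') = iid_prob ?I (\<lambda>X. path_event d z n ls X \<and> path_event d z n ls' X)"
          by (auto simp: A_def iid_prob_def intro!: arg_cong[of _ _ prob])
        also have "\<dots> \<le> iid_prob ?I (path_event d z n ls) * iid_prob ?I (path_event d z n ls') * (\<Prod>j\<in>{2..<n+2}. \<rho> j)"
          using iid_prob_good_pair_le[where a="?a" and a'="?a'" and d=d and m="path_class ls" and m'="path_class ls'"
              and z=z and N=12 and n="n+2" and \<theta>="class_width d" and q=q, OF dir[OF ls] dir[OF ls'] z path_class_less[OF ls]
              path_class_less[OF ls'] \<theta> q_pos q_le] lower_q[OF ls] lower_q[OF ls']
          unfolding \<rho>_def R_def G_def path_event_def by blast
        finally have "prob (A ls \<inter> A ls') / (prob (A ls) * prob (A ls')) \<le> (\<Prod>j\<in>{2..<n+2}. \<rho> j)"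
          using pos[OF ls] pos[OF ls'] by (simp add: pA[symmetric] pos_divide_le_eq mult_ac)
        also have "\<dots> = (\<Prod>i<n. \<rho> (i + 2))"
          using prod.shift_bounds_nat_ivl[of \<rho> 0 2 n] by (simp only: add_0 atLeast0LessThan)
        also have "\<dots> \<le> (\<Prod>i<n. age_overlap_factor C d (\<lambda>c. 0 - int (card {t. t < i \<and> fst (ls ! t) = c}) + int (card {t. t < i \<and> fst (ls' ! t) = c}))
            ((0 # map snd ls) ! i) (if i = 0 then True else (0 # map snd ls') ! (i - 1) \<le> (0 # map snd ls') ! i)
            ((0 # map snd ls') ! i) (snd (ls' ! i)))"
        proof (intro prod_mono conjI)
          fix i assume "i \<in> {..<n}"
          then have i: "i < n" by simp
          have "(\<lambda>c. path_pos z ?a' (i + 2) c - path_pos z ?a (i + 2) c) =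
            (\<lambda>c. 0 - int (card {t. t < i \<and> fst (ls ! t) = c}) + int (card {t. t < i \<and> fst (ls' ! t) = c}))"
            using i len by (intro ext) (simp only: path_pos_path_dir less_imp_le)
          then have R: "R (i + 2) = sqnorm d (\<lambda>c. 0 - int (card {t. t < i \<and> fst (ls ! t) = c}) + int (card {t. t < i \<and> fst (ls' ! t) = c}))"
            by (simp only: R_def)
          have cls: "path_class ls (i + 2) = (0 # map snd ls) ! i" "path_class ls' (i + 2) = (0 # map snd ls') ! i"
            using i len by (intro path_class_nth, simp)+
          \<comment> \<open>At \<open>i = 0\<close> both classes are the default 0, in agreement
            with the initial bit \<open>True\<close>.\<close>
          have prev: "(path_class ls' (i + 2 - 1) \<le> path_class ls' (i + 2)) =
             (if i = 0 then True else (0 # map snd ls') ! (i - 1) \<le> (0 # map snd ls') ! i)"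
          proof (cases i)
            case 0 then show ?thesis by (simp add: path_class_def)
          next
            case (Suc i')
            then have "path_class ls' (i + 2 - 1) = (0 # map snd ls') ! (i - 1)"
              using path_class_nth[of i' ls'] i len by simp
            then show ?thesis using cls Suc by simp
          qed
          have nxt: "path_class ls' (Suc (i + 2)) = snd (ls' ! i)"
            using i len by (simp add: path_class_def)
          have pG: "0 < iid_prob ?I (G ls' (i + 2))" using lower_q[OF ls', of "i + 2"] q\<theta> by linarith
          have inv: "1 / iid_prob ?I (G ls' (i + 2)) \<le> 2 * real d / limit_density
             (path_class ls' (i + 2 - 1) \<le> path_class ls' (i + 2)) (path_class ls' (i + 2)) (path_class ls' (Suc (i + 2)))"
            (is "_ \<le> 2 * real d / ?w")
          proof -
            have w: "?w > 0" by (rule limit_density_pos)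
            have "?w / (2 * real d) \<le> iid_prob ?I (G ls' (i + 2))" by (rule lower[OF ls'])
            then have "1 / iid_prob ?I (G ls' (i + 2)) \<le> 1 / (?w / (2 * real d))"
              using w d0 pG by (intro divide_left_mono mult_pos_pos divide_pos_pos) auto
            then show ?thesis by simp
          qed
          show "0 \<le> \<rho> (i + 2)" using pG q_pos by (simp add: \<rho>_def)
          show "\<rho> (i + 2) \<le> age_overlap_factor C d (\<lambda>c. 0 - int (card {t. t < i \<and> fst (ls ! t) = c}) + int (card {t. t < i \<and> fst (ls' ! t) = c}))
            ((0 # map snd ls) ! i) (if i = 0 then True else (0 # map snd ls') ! (i - 1) \<le> (0 # map snd ls') ! i)
            ((0 # map snd ls') ! i) (snd (ls' ! i))"
            unfolding \<rho>_def R age_overlap_factor_def cls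
            using inv[unfolded prev, unfolded nxt, unfolded cls] by (auto simp: C_def)
        qed
        also have "\<dots> = age_path_overlap_factor C d (\<lambda>_. 0) 0 True 0 ls ls'"
          by (rule class_chain.path_overlap_factor_eq_prod[OF class_chain_ages len, symmetric])
        finally show ?thesis .
      qed
      have "1 / B \<le> prob (\<Union>ls\<in>age_steps d n. A ls)"
      proof (rule second_moment_union[where q="age_weight d True 0"])
        show "(\<Sum>ls\<in>age_steps d n. age_weight d True 0 ls) = 1"
          by (rule class_chain.sum_path_weight[OF class_chain_ages d0]) simp
        have "(\<Sum>ls\<in>age_steps d n. \<Sum>ls'\<in>age_steps d n. age_weight d True 0 ls * age_weight d True 0 ls' *
            (prob (A ls \<inter> A ls') / (prob (A ls) * prob (A ls'))))
          \<le> (\<Sum>ls\<in>age_steps d n. \<Sum>ls'\<in>age_steps d n. age_weight d True 0 ls * age_weight d True 0 ls' *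
            age_path_overlap_factor C d (\<lambda>_. 0) 0 True 0 ls ls')"
          by (intro sum_mono mult_left_mono ratio mult_nonneg_nonneg class_chain.path_weight_nonneg[OF class_chain_ages]) auto
        also have "\<dots> \<le> B0" by (rule B0)
        finally show "(\<Sum>ls\<in>age_steps d n. \<Sum>ls'\<in>age_steps d n. age_weight d True 0 ls * age_weight d True 0 ls' *
            (prob (A ls \<inter> A ls') / (prob (A ls) * prob (A ls')))) \<le> B" by (simp add: B_def)
      qed (use A_ev pos class_chain.finite_step_lists[OF class_chain_ages] in \<open>auto simp: B_def\<close>)
      also have "(\<Union>ls\<in>age_steps d n. A ls) = {X \<in> space (PiM ?I (\<lambda>_. unif)). \<exists>ls\<in>age_steps d n. path_event d z n ls X}"
        by (auto simp: A_def)
      finally show "1 / B \<le> iid_prob ?I (\<lambda>X. \<exists>ls\<in>age_steps d n. path_event d z n ls X)" by (simp add: iid_prob_def)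
    qed
  qed
qed

section \<open>Good paths lie in the fourth layer\<close>

lemma strongly_connected_imp_connected:
  assumes "wf_digraph H" "strongly_connected H"
  shows "Digraph_Component.connected H"
proof -
  interpret wf_digraph H by fact
  have sub: "arcs_ends H \<subseteq> arcs_ends (with_proj (mk_symmetric H))"
    by (auto simp: arcs_ends_conv mk_symmetric_def)
  have "u \<rightarrow>\<^sup>*\<^bsub>with_proj (mk_symmetric H)\<^esub> v" if "u \<rightarrow>\<^sup>*\<^bsub>H\<^esub> v" for u v
    using that unfolding reachable_def by (rule rtrancl_on_mono[rotated 2]) (use sub in \<open>auto simp: mk_symmetric_def\<close>)
  then show ?thesis
    using assms(2) unfolding Digraph_Component.connected_def strongly_connected_def by (auto simp: mk_symmetric_def)
qed

text \<open>Connectedness is defined through the symmetric closure, which adds no reachability to a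
  symmetric digraph. A connected subgraph containing \<open>u\<close> therefore stays inside the
  reachable set, and the induced subgraph already has all its arcs.\<close>

lemma (in sym_digraph) max_connected_reachable:
  assumes "u \<in> verts G"
  shows "max_subgraph Digraph_Component.connected (G \<restriction> {v. u \<rightarrow>\<^sup>* v})"
proof -
  let ?C = "G \<restriction> {v. u \<rightarrow>\<^sup>* v}"
  have "?C \<in> sccs" by (rule induce_reachable_is_in_sccs) fact
  then have ind: "induced_subgraph ?C G" and sc: "strongly_connected ?C" by auto
  have wf: "wf_digraph ?C" using ind by (auto simp: induced_subgraph_def subgraph_def)
  show ?thesis
    unfolding max_subgraph_def
  proof (intro conjI allI impI notI)
    show "subgraph ?C G" using ind by auto
    show "Digraph_Component.connected ?C" by (rule strongly_connected_imp_connected[OF wf sc])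
    fix H' assume H': "H' \<noteq> ?C \<and> subgraph ?C H'" "subgraph H' G \<and> Digraph_Component.connected H'"
    have u: "u \<in> verts H'" using H'(1) assms by (auto simp: subgraph_def)
    have "v \<in> {v. u \<rightarrow>\<^sup>* v}" if "v \<in> verts H'" for v
    proof -
      have "u \<rightarrow>\<^sup>*\<^bsub>with_proj (mk_symmetric H')\<^esub> v"
        using H'(2) u that unfolding Digraph_Component.connected_def strongly_connected_def
        by (auto simp: mk_symmetric_def)
      moreover have "subgraph (with_proj (mk_symmetric H')) (with_proj (mk_symmetric G))"
        using H'(2) by (auto dest: subgraph_mk_symmetric)
      ultimately have "u \<rightarrow>\<^sup>*\<^bsub>with_proj (mk_symmetric G)\<^esub> v" by (auto intro: pre_digraph.reachable_mono)
      then show ?thesis using reachable_mk_symmetric_eq[OF sym_arcs] by simp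
    qed
    then have verts: "verts H' = verts ?C" using H'(1) by (auto simp: subgraph_def)
    have comp: "tail H' = tail ?C" "head H' = head ?C" using H'(1) by (auto simp: subgraph_def compatible_def)
    have "e \<in> arcs ?C" if "e \<in> arcs H'" for e
    proof -
      have "wf_digraph H'" using H'(2) by (auto simp: subgraph_def)
      then have "tail H' e \<in> verts H'" "head H' e \<in> verts H'" using that by (auto simp: wf_digraph_def)
      then show ?thesis using that verts comp H'(2) by (auto simp: subgraph_def)
    qed
    then have "arcs H' = arcs ?C" using H'(1) by (auto simp: subgraph_def)
    then have "H' = ?C" using verts comp by (simp add: pre_digraph.equality)
    then show False using H'(1) by simp
  qed
qed

lemma sym_digraph_layer: "sym_digraph (layer k (lattice_graph d) X)"
proof
  show "symmetric (layer k (lattice_graph d) X)"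
    unfolding symmetric_conv
  proof
    fix e assume e: "e \<in> arcs (layer k (lattice_graph d) X)"
    have "(\<Sum>i<d. \<bar>snd e i - fst e i\<bar>) = (\<Sum>i<d. \<bar>fst e i - snd e i\<bar>)" by (simp add: abs_minus_commute)
    then show "\<exists>e'\<in>arcs (layer k (lattice_graph d) X).
        tail (layer k (lattice_graph d) X) e = head (layer k (lattice_graph d) X) e' \<and>
        head (layer k (lattice_graph d) X) e = tail (layer k (lattice_graph d) X) e'"
      using e by (intro bexI[of _ "(snd e, fst e)"]) (auto simp: layer_def lattice_graph_def)
  qed
qed (auto simp: layer_def)

lemma l1_neighbor_cases:
  assumes "u \<in> lattice_points d" "v \<in> lattice_points d" "(\<Sum>i<d. \<bar>v i - u i\<bar>) = 1"
  obtains b where "b < d" "u = bump v b 1" | b where "b < d" "u = bump v b (- 1)"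
proof -
  have "\<exists>b<d. \<bar>v b - u b\<bar> \<noteq> 0"
  proof (rule ccontr)
    assume "\<not> ?thesis"
    then have "(\<Sum>i<d. \<bar>v i - u i\<bar>) = 0" by (intro sum.neutral) auto
    then show False using assms(3) by simp
  qed
  then obtain b where b: "b < d" "\<bar>v b - u b\<bar> \<noteq> 0" by blast
  have sum: "\<bar>v b - u b\<bar> + (\<Sum>i\<in>{..<d} - {b}. \<bar>v i - u i\<bar>) = 1"
    using assms(3) b(1) by (simp add: sum.remove[of _ b])
  moreover have "0 \<le> (\<Sum>i\<in>{..<d} - {b}. \<bar>v i - u i\<bar>)" by (intro sum_nonneg) auto
  ultimately have "\<bar>v b - u b\<bar> = 1" "(\<Sum>i\<in>{..<d} - {b}. \<bar>v i - u i\<bar>) = 0" using b(2) by linarith+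
  then have one: "u b = v b + 1 \<or> u b = v b - 1" and "\<forall>i\<in>{..<d} - {b}. \<bar>v i - u i\<bar> = 0"
    by (linarith, subst (asm) sum_nonneg_eq_0_iff) auto
  then have "u i = v i" if "i \<noteq> b" for i
    using that assms(1,2) by (cases "i < d") (auto simp: lattice_points_def PiE_def extensional_def)
  then have "u = bump v b (u b - v b)" by (auto simp: bump_def fun_eq_iff)
  with one b(1) that show ?thesis by fastforce
qed

lemma bump_adjacent:
  assumes "v \<in> lattice_points d" "b < d"
  shows "(v, bump v b 1) \<in> parcs (lattice_graph d)"
  using l1dist_bump[OF assms(2), of v 1] bump_in_lattice[OF assms] assms(1)
  by (simp add: lattice_graph_def l1dist_def)

text \<open>Both corners next to the vertex lie above all classes: the lower one by the condition at
  \<open>j\<close>, the upper one by the condition at \<open>j + 2\<close>, to which it is assigned.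
  A path neighbour can be younger only if its class is at most \<open>m j\<close>, and then
  \<open>budget\<close> has reserved a place for it.\<close>

lemma good_imp_in_layer:
  assumes z: "z \<in> lattice_points d" and a: "\<And>i. a i < d" and m: "\<And>i. m i < N" and \<theta>: "\<theta> > 0" and j: "j \<ge> 3"
    and good: "good_at d N \<theta> z a m (j - 1) X" "good_at d N \<theta> z a m j X"
      "good_at d N \<theta> z a m (j + 1) X" "good_at d N \<theta> z a m (j + 2) X"
  shows "path_pos z a j \<in> layer_verts 4 (lattice_graph d) X"
proof -
  define v where "v = path_pos z a j"
  have v: "v \<in> lattice_points d" unfolding v_def by (rule path_pos_in_lattice[OF z a])
  let ?P = "{u \<in> private_nbrs d z a j. X u < real (m j + 1) * \<theta>}"
  let ?A = "if m (j - 1) \<le> m j then {path_pos z a (j - 1)} else {}"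
  let ?B = "if m (j + 1) \<le> m j then {path_pos z a (j + 1)} else {}"
  have Xv: "real (m j) * \<theta> \<le> X v" "X v < real (m j + 1) * \<theta>" using good(2) by (auto simp: good_at_def v_def)
  have high: "X v < real N * \<theta>"
  proof -
    have "real (m j + 1) * \<theta> \<le> real N * \<theta>" using m[of j] \<theta> by (intro mult_right_mono) auto
    then show ?thesis using Xv by linarith
  qed
  have class_le: "m i \<le> m j" if "X (path_pos z a i) < X v" "real (m i) * \<theta> \<le> X (path_pos z a i)" for i
  proof -
    have "real (m i) * \<theta> < real (m j + 1) * \<theta>" using that Xv by linarith
    then have "real (m i) < real (m j + 1)" using \<theta> by (simp only: mult_less_cancel_right_pos)
    then show ?thesis by linarith
  qed
  have prev: "v = bump (path_pos z a (j - 1)) (a (j - 1)) 1"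
    using j path_pos.simps(2)[of z a "j - 1"] by (simp add: v_def)
  have sub: "{u \<in> neighbors (lattice_graph d) v. X u < X v} \<subseteq> ?P \<union> ?A \<union> ?B"
  proof
    fix u assume "u \<in> {u \<in> neighbors (lattice_graph d) v. X u < X v}"
    then have u: "u \<in> lattice_points d" "(\<Sum>i<d. \<bar>v i - u i\<bar>) = 1" "X u < X v"
      by (auto simp: neighbors_def lattice_graph_def)
    from l1_neighbor_cases[OF u(1) v u(2)] show "u \<in> ?P \<union> ?A \<union> ?B"
    proof cases
      case (1 b)
      consider "b = a j" | "b = a (Suc j)" "b \<noteq> a j" | "b \<noteq> a j" "b \<noteq> a (Suc j)" by blast
      then show ?thesis
      proof cases
        assume b: "b = a j"
        then have "u = path_pos z a (j + 1)" using 1 by (simp add: v_def)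
        then show ?thesis using class_le[of "j + 1"] u(3) good(3) by (auto simp: good_at_def)
      next
        assume b: "b = a (Suc j)" "b \<noteq> a j"
        have "u = corner z a (j + 2)"
          using 1 b by (auto simp: corner_def v_def bump_def fun_eq_iff)
        moreover have "real N * \<theta> \<le> X (corner z a (j + 2))" using good(4) b by (simp add: good_at_def)
        ultimately show ?thesis using u(3) high by simp
      next
        assume "b \<noteq> a j" "b \<noteq> a (Suc j)"
        then have "u \<in> private_nbrs d z a j" using 1 by (auto simp: private_nbrs_def up_nbrs_def v_def)
        then show ?thesis using u(3) Xv by simp
      qed
    next
      case (2 b)
      consider "b = a (j - 1)" | "b = a (j - 2)" "b \<noteq> a (j - 1)" | "b \<noteq> a (j - 1)" "b \<noteq> a (j - 2)" by blast
      then show ?thesis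
      proof cases
        assume b: "b = a (j - 1)"
        then have "u = path_pos z a (j - 1)" using 2 prev by (auto simp: bump_def fun_eq_iff)
        then show ?thesis using class_le[of "j - 1"] u(3) good(1) by (auto simp: good_at_def)
      next
        assume b: "b = a (j - 2)" "b \<noteq> a (j - 1)"
        have "u = corner z a j" using 2 b by (simp add: corner_def v_def)
        moreover have "real N * \<theta> \<le> X (corner z a j)" using good(2) b by (simp add: good_at_def)
        ultimately show ?thesis using u(3) high by simp
      next
        assume "b \<noteq> a (j - 1)" "b \<noteq> a (j - 2)"
        then have "u \<in> private_nbrs d z a j" using 2 by (auto simp: private_nbrs_def v_def)
        then show ?thesis using u(3) Xv by simp
      qed
    qed
  qed
  have fin: "finite (?P \<union> ?A \<union> ?B)" using finite_private[of d z a j] by auto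
  have "card (?P \<union> ?A \<union> ?B) \<le> 3"
  proof -
    have "card (?P \<union> ?A \<union> ?B) \<le> card ?P + card ?A + card ?B"
      using card_Un_le[of "?P \<union> ?A" ?B] card_Un_le[of ?P ?A] by linarith
    moreover have "card ?P \<le> 3 - of_bool (m (j - 1) \<le> m j) - of_bool (m (Suc j) \<le> m j)"
      using good(2) by (simp add: good_at_def budget_def)
    ultimately show ?thesis by (auto split: if_splits)
  qed
  with card_mono[OF fin sub] have "card {u \<in> neighbors (lattice_graph d) v. X u < X v} \<le> 4 - 1"
    by linarith
  with finite_subset[OF sub fin] show ?thesis using v by (simp add: layer_verts_def lattice_graph_def v_def)
qed

definition valid_path :: "nat \<Rightarrow> (nat \<Rightarrow> nat) \<Rightarrow> (nat \<Rightarrow> nat) \<Rightarrow> bool" where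
  "valid_path d a m \<longleftrightarrow> (\<forall>i. a i < d) \<and> (\<forall>i. m i < 12)"

definition long_path :: "nat \<Rightarrow> (nat \<Rightarrow> int) \<Rightarrow> nat \<Rightarrow> ((nat \<Rightarrow> int) \<Rightarrow> real) \<Rightarrow> bool" where
  "long_path d z n X \<longleftrightarrow> (\<exists>a m. valid_path d a m \<and> (\<forall>j\<in>{2..<n+2}. good_at d 12 (class_width d) z a m j X))"

text \<open>Paths of different lengths need not extend one another, but at time 3 all of them pass
  through a finite set. If every vertex of it reached only finitely many others, a sufficiently long
  path would not fit into the union.\<close>

lemma infinite_component_if_long_paths:
  assumes z: "z \<in> lattice_points d" and long: "\<And>n. long_path d z n X"
  shows "\<exists>C. connected_component_of_graph (layer 4 (lattice_graph d) X) C \<and> infinite (verts C)"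
proof -
  let ?H = "layer 4 (lattice_graph d) X"
  interpret H: sym_digraph ?H by (rule sym_digraph_layer)
  have d: "d > 0" using long[of 0] by (auto simp: long_path_def valid_path_def gr_zeroI)
  then have \<theta>: "class_width d > 0" by (simp add: class_width_def)
  define F where "F = (\<lambda>(i, j, k). path_pos z (\<lambda>t. if t = 0 then i else if t = 1 then j else k) 3) ` ({..<d} \<times> {..<d} \<times> {..<d})"
  have finF: "finite F" by (simp add: F_def)
  have vert: "v \<in> verts ?H" if "v \<in> layer_verts 4 (lattice_graph d) X" for v
    using that by (simp add: layer_def)
  have "\<exists>u\<in>F. infinite {v. u \<rightarrow>\<^sup>*\<^bsub>?H\<^esub> v}"
  proof (rule ccontr)
    assume "\<not> ?thesis"
    then have finU: "finite (\<Union>u\<in>F. {v. u \<rightarrow>\<^sup>*\<^bsub>?H\<^esub> v})" using finF by auto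
    define n where "n = card (\<Union>u\<in>F. {v. u \<rightarrow>\<^sup>*\<^bsub>?H\<^esub> v})"
    \<comment> \<open>Membership in the layer at time \<open>j\<close> uses the conditions at
      \<open>j - 1\<close> to \<open>j + 2\<close>. Length \<open>n + 4\<close> thus leaves the
      times 3 to \<open>n + 3\<close>, one vertex too many for a union of size
      \<open>n\<close>.\<close>
    obtain a m where am: "\<And>i. a i < d" "\<And>i. m i < 12"
      and good: "\<And>j. 2 \<le> j \<Longrightarrow> j < n + 6 \<Longrightarrow> good_at d 12 (class_width d) z a m j X"
    proof -
      obtain a m where "valid_path d a m" "\<forall>j\<in>{2..<n + 4 + 2}. good_at d 12 (class_width d) z a m j X"
        using long[of "n + 4"] unfolding long_path_def by blast
      then show ?thesis by (intro that[of a m]) (auto simp: valid_path_def)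
    qed
    have in_layer: "path_pos z a j \<in> layer_verts 4 (lattice_graph d) X" if "3 \<le> j" "j < n + 4" for j
      using that good by (intro good_imp_in_layer[where N=12 and \<theta>="class_width d" and m=m] z am \<theta>) auto
    have reach: "path_pos z a 3 \<rightarrow>\<^sup>*\<^bsub>?H\<^esub> path_pos z a (3 + i)" if "3 + i < n + 4" for i
      using that
    proof (induction i)
      case 0
      then show ?case using vert[OF in_layer[of 3]] by simp
    next
      case (Suc i)
      have "(path_pos z a (3 + i), path_pos z a (Suc (3 + i))) \<in> parcs (lattice_graph d)"
        unfolding path_pos.simps by (intro bump_adjacent path_pos_in_lattice z am)
      moreover have "path_pos z a (3 + i) \<in> layer_verts 4 (lattice_graph d) X" "path_pos z a (Suc (3 + i)) \<in> layer_verts 4 (lattice_graph d) X"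
        using in_layer[of "3 + i"] in_layer[of "Suc (3 + i)"] Suc.prems by auto
      ultimately have "(path_pos z a (3 + i), path_pos z a (Suc (3 + i))) \<in> arcs_ends ?H"
        by (auto simp: arcs_ends_conv layer_def image_iff intro!: bexI[of _ "(path_pos z a (3 + i), path_pos z a (Suc (3 + i)))"])
      moreover have "path_pos z a 3 \<rightarrow>\<^sup>*\<^bsub>?H\<^esub> path_pos z a (3 + i)" using Suc by simp
      ultimately show ?case by (simp only: add_Suc_right) (rule H.reachable_adj_trans)
    qed
    have "path_pos z a 3 = path_pos z (\<lambda>t. if t = 0 then a 0 else if t = 1 then a 1 else a 2) 3"
      by (simp add: numeral_3_eq_3 numeral_2_eq_2)
    then have "path_pos z a 3 \<in> F" using am(1) unfolding F_def by (intro image_eqI[of _ _ "(a 0, a 1, a 2)"]) (auto simp del: One_nat_def)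
    then have "(\<lambda>i. path_pos z a (3 + i)) ` {..<n+1} \<subseteq> (\<Union>u\<in>F. {v. u \<rightarrow>\<^sup>*\<^bsub>?H\<^esub> v})"
      using reach by auto
    then have "card ((\<lambda>i. path_pos z a (3 + i)) ` {..<n+1}) \<le> n"
      unfolding n_def by (rule card_mono[OF finU])
    moreover have "inj_on (\<lambda>i. path_pos z a (3 + i)) {..<n+1}"
      by (rule inj_onI) (auto dest!: arg_cong[of _ _ "level d"] simp: level_pos[OF am(1)])
    ultimately show False by (simp add: card_image)
  qed
  then obtain u where u: "infinite {v. u \<rightarrow>\<^sup>*\<^bsub>?H\<^esub> v}" by blast
  then obtain v where "u \<rightarrow>\<^sup>*\<^bsub>?H\<^esub> v" by (metis (mono_tags) Collect_empty_eq finite.emptyI)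
  then have "u \<in> verts ?H" by (rule H.reachable_in_verts)
  from H.max_connected_reachable[OF this] u show ?thesis
    by (intro exI[of _ "?H \<restriction> {v. u \<rightarrow>\<^sup>*\<^bsub>?H\<^esub> v}"]) (simp add: connected_component_of_graph_def)
qed

section \<open>The zero-one law\<close>

lemma path_pos_cong: "(\<And>i. i < j \<Longrightarrow> a i = a' i) \<Longrightarrow> path_pos z a j = path_pos z a' j"
  by (induction j) auto

lemma good_at_cong:
  assumes "\<And>i. i \<le> Suc j \<Longrightarrow> a i = a' i" "\<And>i. i \<le> Suc j \<Longrightarrow> m i = m' i"
  shows "good_at d N \<theta> z a m j X = good_at d N \<theta> z a' m' j X"
proof -
  have "path_pos z a j = path_pos z a' j" using assms by (intro path_pos_cong) auto
  moreover have "a (j - 2) = a' (j - 2)" "a (j - 1) = a' (j - 1)" "a j = a' j" "a (Suc j) = a' (Suc j)"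
    "m (j - 1) = m' (j - 1)" "m j = m' j" "m (Suc j) = m' (Suc j)"
    using assms by auto
  ultimately show ?thesis by (simp only: good_at_def corner_def private_nbrs_def up_nbrs_def)
qed

lemma good_at_shift:
  assumes "j \<ge> 2"
  shows "good_at d N \<theta> (path_pos z a k) (\<lambda>i. a (i + k)) (\<lambda>i. m (i + k)) j X = good_at d N \<theta> z a m (j + k) X"
proof -
  have "j + k - 1 = j - 1 + k" "j + k - 2 = j - 2 + k" "Suc (j + k) = Suc j + k" using assms by auto
  then show ?thesis by (simp only: good_at_def corner_def private_nbrs_def up_nbrs_def path_pos_shift)
qed

lemma long_path_mono:
  assumes "long_path d z n X" "n' \<le> n"
  shows "long_path d z n' X"
proof -
  obtain a m where "valid_path d a m" "\<forall>j\<in>{2..<n+2}. good_at d 12 (class_width d) z a m j X"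
    using assms(1) unfolding long_path_def by blast
  then show ?thesis using assms(2) unfolding long_path_def
    by (intro exI[of _ a] exI[of _ m]) auto
qed

lemma long_path_step:
  assumes "long_path d z (Suc n) X"
  shows "\<exists>b<d. long_path d (bump z b 1) n X"
proof -
  obtain a m where v: "valid_path d a m" and g: "\<forall>j\<in>{2..<Suc n+2}. good_at d 12 (class_width d) z a m j X"
    using assms unfolding long_path_def by blast
  have "good_at d 12 (class_width d) (path_pos z a 1) (\<lambda>i. a (i + 1)) (\<lambda>i. m (i + 1)) j X" if "j \<in> {2..<n+2}" for j
    using that g good_at_shift[of j d 12 "class_width d" z a 1 m X] by auto
  moreover have "path_pos z a 1 = bump z (a 0) 1" by simp
  ultimately have "long_path d (bump z (a 0) 1) n X"
    using v unfolding long_path_def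
    by (intro exI[of _ "\<lambda>i. a (i + 1)"] exI[of _ "\<lambda>i. m (i + 1)"]) (auto simp: valid_path_def)
  then show ?thesis using v by (auto simp: valid_path_def)
qed

text \<open>Koenig's argument: if each of the finitely many successors failed at some length, all
  would fail at the largest of these lengths.\<close>

lemma long_paths_step:
  assumes "\<And>n. long_path d z n X"
  shows "\<exists>b<d. \<forall>n. long_path d (bump z b 1) n X"
proof (rule ccontr)
  assume "\<not> ?thesis"
  then have "\<forall>b\<in>{..<d}. \<exists>n. \<not> long_path d (bump z b 1) n X" by auto
  from bchoice[OF this] obtain f where f: "\<And>b. b < d \<Longrightarrow> \<not> long_path d (bump z b 1) (f b) X" by auto
  define n where "n = Max (insert 0 (f ` {..<d}))"
  obtain b where b: "b < d" "long_path d (bump z b 1) n X" using long_path_step[OF assms[of "Suc n"]] by blast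
  have "f b \<le> n" unfolding n_def using b by (intro Max_ge) auto
  then show False using f[OF b(1)] long_path_mono[OF b(2)] by blast
qed

section \<open>Measurability of the path events\<close>

lemma local_event_measurable:
  assumes "local_event V Q" "\<And>v. v \<in> V \<Longrightarrow> (\<lambda>x. x v) \<in> borel_measurable M"
  shows "Measurable.pred M Q"
proof -
  have "(\<lambda>x. restrict (\<lambda>v. x v) V) \<in> measurable M (PiM V (\<lambda>_. unif))"
    using assms(2) by (intro measurable_restrict) (simp cong: measurable_cong_sets)
  then have "Measurable.pred M (\<lambda>x. Q (restrict (\<lambda>v. x v) V))"
    using assms(1) unfolding local_event_def by (intro measurable_compose[of _ M _ Q]) auto
  then show ?thesis using assms(1) by (simp add: local_event_def)
qed

lemma level_block_ge:
  assumes "\<And>i. a i < d" "u \<in> block d z a j"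
  shows "level d u \<ge> level d z + int j - 1"
  using assms(2) by (cases rule: block_cases) (auto simp: level_bump level_pos[OF assms(1)])

text \<open>\<open>long_path\<close> quantifies over infinite sequences, but the conditions before
  time \<open>n + 2\<close> look no further than index \<open>n + 2\<close>. Truncation turns the
  quantifiers into finite ones, hence measurable.\<close>

definition trunc_funs :: "nat \<Rightarrow> nat set \<Rightarrow> (nat \<Rightarrow> nat) set" where
  "trunc_funs n S = {f. \<forall>i. (i \<in> {..n+2} \<longrightarrow> f i \<in> S) \<and> (i \<notin> {..n+2} \<longrightarrow> f i = 0)}"

lemma finite_trunc_funs: "finite S \<Longrightarrow> finite (trunc_funs n S)"
  unfolding trunc_funs_def by (rule finite_set_of_finite_funs) simp

lemma long_path_iff_finite:
  assumes "d > 0"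
  shows "long_path d z n X \<longleftrightarrow> (\<exists>a\<in>trunc_funs n {..<d}. \<exists>m\<in>trunc_funs n {..<12}. \<forall>j\<in>{2..<n+2}. good_at d 12 (class_width d) z a m j X)"
proof
  assume "long_path d z n X"
  then obtain a m where v: "valid_path d a m" and g: "\<forall>j\<in>{2..<n+2}. good_at d 12 (class_width d) z a m j X"
    unfolding long_path_def by blast
  define a' where "a' i = (if i \<le> n + 2 then a i else 0)" for i
  define m' where "m' i = (if i \<le> n + 2 then m i else 0)" for i
  have "a' \<in> trunc_funs n {..<d}" "m' \<in> trunc_funs n {..<12}" using v by (auto simp: trunc_funs_def a'_def m'_def valid_path_def)
  moreover have "good_at d 12 (class_width d) z a' m' j X" if "j \<in> {2..<n+2}" for j
    using good_at_cong[of j a' a m' m d 12 "class_width d" z X] that g by (auto simp: a'_def m'_def)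
  ultimately show "\<exists>a\<in>trunc_funs n {..<d}. \<exists>m\<in>trunc_funs n {..<12}. \<forall>j\<in>{2..<n+2}. good_at d 12 (class_width d) z a m j X" by blast
next
  assume "\<exists>a\<in>trunc_funs n {..<d}. \<exists>m\<in>trunc_funs n {..<12}. \<forall>j\<in>{2..<n+2}. good_at d 12 (class_width d) z a m j X"
  then obtain a m where am: "a \<in> trunc_funs n {..<d}" "m \<in> trunc_funs n {..<12}"
    and g: "\<forall>j\<in>{2..<n+2}. good_at d 12 (class_width d) z a m j X" by blast
  have "a i < d" "m i < 12" for i
    using am assms(1) by (cases "i \<le> n + 2"; force simp: trunc_funs_def)+
  then show "long_path d z n X" using g unfolding long_path_def valid_path_def by blast
qed

lemma measurable_long_path:
  assumes d: "d > 0" and M: "\<And>u. u \<in> lattice_points d \<Longrightarrow> level d u \<ge> level d z \<Longrightarrow> (\<lambda>x. x u) \<in> borel_measurable M"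
    and z: "z \<in> lattice_points d"
  shows "Measurable.pred M (long_path d z n)"
  unfolding long_path_iff_finite[OF d, abs_def]
proof (intro pred_intros_finite)
  show "finite (trunc_funs n {..<d})" "finite (trunc_funs n {..<12})" by (simp_all add: finite_trunc_funs)
  fix a m j assume a: "a \<in> trunc_funs n {..<d}" and j: "j \<in> {2..<n+2}"
  have a': "a i < d" for i using a d by (cases "i \<le> n + 2") (force simp: trunc_funs_def)+
  show "Measurable.pred M (good_at d 12 (class_width d) z a m j)"
  proof (rule local_event_measurable[OF local_good_at[OF a']])
    fix v assume v: "v \<in> block d z a j"
    then have "v \<in> lattice_points d" using block_in_lattice[where a=a and j=j, OF z a'] by blast
    moreover have "level d v \<ge> level d z" using level_block_ge[OF a' v] j by simp
    ultimately show "(\<lambda>x. x v) \<in> borel_measurable M" by (rule M)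
  qed
qed simp

text \<open>Asking for paths of every length in place of one infinite path gives a countable
  combination of measurable events, and \<open>long_paths_step\<close> still allows moving on to a
  next vertex.\<close>

definition infinite_paths_from_level :: "nat \<Rightarrow> nat \<Rightarrow> ((nat \<Rightarrow> int) \<Rightarrow> real) \<Rightarrow> bool" where
  "infinite_paths_from_level d L X \<longleftrightarrow> (\<exists>z\<in>{z \<in> lattice_points d. int L \<le> level d z}. \<forall>n. long_path d z n X)"

lemma infinite_paths_from_level_Suc: "infinite_paths_from_level d (Suc L) X \<longleftrightarrow> infinite_paths_from_level d L X"
proof
  assume "infinite_paths_from_level d (Suc L) X"
  then show "infinite_paths_from_level d L X" by (force simp: infinite_paths_from_level_def)
next
  assume "infinite_paths_from_level d L X"
  then obtain z where z: "z \<in> lattice_points d" "int L \<le> level d z" "\<And>n. long_path d z n X"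
    by (auto simp: infinite_paths_from_level_def)
  obtain b where b: "b < d" "\<forall>n. long_path d (bump z b 1) n X" using long_paths_step[OF z(3)] by blast
  then show "infinite_paths_from_level d (Suc L) X"
    using z bump_in_lattice[OF z(1) b(1), of 1] level_bump[OF b(1), of z 1]
    by (auto simp: infinite_paths_from_level_def intro!: bexI[of _ "bump z b 1"])
qed

lemma infinite_paths_from_level_shift: "infinite_paths_from_level d L X \<longleftrightarrow> infinite_paths_from_level d 0 X"
  by (induction L) (simp_all add: infinite_paths_from_level_Suc)

lemma countable_lattice_points: "countable (lattice_points d)"
  unfolding lattice_points_def by (intro countable_PiE) auto

lemma measurable_infinite_paths_from_level:
  assumes d: "d > 0" and M: "\<And>u. u \<in> lattice_points d \<Longrightarrow> level d u \<ge> int L \<Longrightarrow> (\<lambda>x. x u) \<in> borel_measurable M"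
  shows "{x \<in> space M. infinite_paths_from_level d L x} \<in> sets M"
proof -
  have "{x \<in> space M. infinite_paths_from_level d L x} = (\<Union>z\<in>{z \<in> lattice_points d. int L \<le> level d z}. {x \<in> space M. \<forall>n. long_path d z n x})"
    by (auto simp: infinite_paths_from_level_def)
  also have "\<dots> \<in> sets M"
  proof (rule sets.countable_UN'')
    show "countable {z \<in> lattice_points d. int L \<le> level d z}"
      using countable_lattice_points by (rule countable_subset[rotated]) auto
    fix z assume z: "z \<in> {z \<in> lattice_points d. int L \<le> level d z}"
    have "Measurable.pred M (\<lambda>x. \<forall>n. long_path d z n x)"
      using z by (intro pred_intros_countable measurable_long_path[OF d]) (auto intro: M)
    then show "{x \<in> space M. \<forall>n. long_path d z n x} \<in> sets M" by (simp add: pred_def)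
  qed
  finally show ?thesis .
qed

lemma coord_measurable_PiM_unif: "u \<in> I \<Longrightarrow> (\<lambda>x. x u) \<in> borel_measurable (PiM I (\<lambda>_. unif))"
  using measurable_component_singleton[of u I "\<lambda>_. unif"] by (simp cong: measurable_cong_sets)

text \<open>The event does not change when the start is required to lie at level \<open>n\<close> or
  above, and then it depends only on ages at levels from \<open>n\<close> on. It is therefore a tail
  event of the independent levels.\<close>

lemma infinite_paths_from_level_prob_0_or_1:
  assumes d: "d > 0"
  shows "iid_prob (lattice_points d) (infinite_paths_from_level d 0) = 0 \<or> iid_prob (lattice_points d) (infinite_paths_from_level d 0) = 1"
proof -
  let ?I = "lattice_points d" and ?M = "PiM (lattice_points d) (\<lambda>_. unif)"
  interpret prob_space ?M by (rule prob_space_PiM_unif)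
  \<comment> \<open>Nonnegative levels suffice: an oriented path from level \<open>L\<close>
    consults ages at level \<open>L\<close> or higher only.\<close>
  define Lv where "Lv i = {u \<in> ?I. level d u = int i}" for i :: nat
  define \<A> where "\<A> i = sigma_sets (space ?M)
      {(\<lambda>\<omega>. restrict (\<lambda>u. \<omega> u) (Lv i)) -` B \<inter> space ?M | B. B \<in> sets (PiM (Lv i) (\<lambda>_. unif))}" for i
  have "indep_vars (\<lambda>i. PiM (Lv i) (\<lambda>_. unif)) (\<lambda>i \<omega>. restrict (\<lambda>u. \<omega> u) (Lv i)) UNIV"
    by (rule indep_vars_restrict[OF indep_vars_PiM_unif]) (auto simp: Lv_def disjoint_family_on_def)
  then have ind: "indep_sets \<A> UNIV"
    unfolding indep_vars_def \<A>_def by simp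
  have sub: "\<A> i \<subseteq> Pow (space ?M)" for i
  proof
    fix B assume "B \<in> \<A> i"
    from sigma_sets_into_sp[OF _ this[unfolded \<A>_def]] show "B \<in> Pow (space ?M)" by blast
  qed
  have "prob {x \<in> space ?M. infinite_paths_from_level d 0 x} = 0 \<or> prob {x \<in> space ?M. infinite_paths_from_level d 0 x} = 1"
  proof (rule kolmogorov_0_1_law[OF _ ind])
    show "sigma_algebra (space ?M) (\<A> i)" for i
      unfolding \<A>_def by (intro sigma_algebra_sigma_sets) auto
    show "{x \<in> space ?M. infinite_paths_from_level d 0 x} \<in> tail_events \<A>"
      unfolding tail_events_def
    proof (rule INT_I)
      fix n :: nat
      define N where "N = sigma (space ?M) (\<Union> (\<A> ` {n..}))"
      have sub': "\<Union> (\<A> ` {n..}) \<subseteq> Pow (space ?M)" using sub by blast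
      have spN: "space N = space ?M" unfolding N_def by (rule space_measure_of[OF sub'])
      have setsN: "sets N = sigma_sets (space ?M) (\<Union> (\<A> ` {n..}))"
        unfolding N_def by (rule sets_measure_of[OF sub'])
      have meas: "(\<lambda>x. x u) \<in> borel_measurable N" if u: "u \<in> ?I" "int n \<le> level d u" for u
      proof (rule measurableI)
        fix B :: "real set" assume B: "B \<in> sets borel"
        define i where "i = nat (level d u)"
        have i: "level d u = int i" "i \<ge> n" using u by (auto simp: i_def)
        have uL: "u \<in> Lv i" using u i by (simp add: Lv_def)
        let ?B = "(\<lambda>f. f u) -` B \<inter> space (PiM (Lv i) (\<lambda>_. unif))"
        have "?B \<in> sets (PiM (Lv i) (\<lambda>_. unif))"
          by (rule measurable_sets[OF coord_measurable_PiM_unif[OF uL] B])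
        moreover have "(\<lambda>x. x u) -` B \<inter> space N = (\<lambda>\<omega>. restrict (\<lambda>u. \<omega> u) (Lv i)) -` ?B \<inter> space ?M"
          using uL by (auto simp: spN space_PiM Lv_def)
        ultimately have "(\<lambda>x. x u) -` B \<inter> space N \<in> \<A> i"
          unfolding \<A>_def by (intro sigma_sets.Basic) blast
        then show "(\<lambda>x. x u) -` B \<inter> space N \<in> sets N"
          unfolding setsN using i(2) by (intro sigma_sets.Basic) auto
      qed simp
      have "{x \<in> space N. infinite_paths_from_level d n x} \<in> sets N"
        by (rule measurable_infinite_paths_from_level[OF d meas])
      then show "{x \<in> space ?M. infinite_paths_from_level d 0 x} \<in> sigma_sets (space ?M) (\<Union> (\<A> ` {n..}))"
        by (simp add: spN setsN infinite_paths_from_level_shift[of d n])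
    qed
  qed
  then show ?thesis by (simp add: iid_prob_def)
qed

text \<open>The events of having a path of length \<open>n\<close> from the origin decrease in
  \<open>n\<close> and have probability at least \<open>\<beta>\<close>, so their intersection does
  too; the zero-one law raises this to 1.\<close>

lemma infinite_paths_from_level_almost_surely:
  "\<exists>d\<^sub>0. \<forall>d\<ge>d\<^sub>0. AE X in ages (lattice_graph d). infinite_paths_from_level d 0 X"
proof -
  obtain d0 where d0: "\<And>d. d \<ge> d0 \<Longrightarrow> \<exists>\<beta>>0. \<forall>z\<in>lattice_points d. \<forall>n.
     \<beta> \<le> iid_prob (lattice_points d) (\<lambda>X. \<exists>ls\<in>age_steps d n. path_event d z n ls X)"
    using good_path_probability by blast
  show ?thesis
  proof (intro exI[of _ "max d0 1"] allI impI)
    fix d assume "max d0 1 \<le> d"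
    then have d: "d0 \<le> d" "d > 0" by auto
    let ?I = "lattice_points d" and ?M = "PiM (lattice_points d) (\<lambda>_. unif)"
    interpret prob_space ?M by (rule prob_space_PiM_unif)
    obtain \<beta> where \<beta>: "\<beta> > 0" "\<And>z n. z \<in> ?I \<Longrightarrow> \<beta> \<le> iid_prob ?I (\<lambda>X. \<exists>ls\<in>age_steps d n. path_event d z n ls X)"
      using d0[OF d(1)] by blast
    define z where "z = (\<lambda>i\<in>{..<d}. 0 :: int)"
    have z: "z \<in> ?I" by (auto simp: z_def lattice_points_def)
    have lev: "level d z = 0" by (simp add: z_def level_def)
    define A where "A n = {X \<in> space ?M. long_path d z n X}" for n
    have A_ev: "A n \<in> events" for n
    proof -
      have "Measurable.pred ?M (long_path d z n)"
        using z by (intro measurable_long_path[OF d(2)] coord_measurable_PiM_unif)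
      then show ?thesis by (simp add: A_def pred_def)
    qed
    have lower: "\<beta> \<le> prob (A n)" for n
    proof -
      have "iid_prob ?I (\<lambda>X. \<exists>ls\<in>age_steps d n. path_event d z n ls X) \<le> prob (A n)"
        unfolding iid_prob_def
      proof (rule finite_measure_mono[OF _ A_ev], rule subsetI)
        fix X assume "X \<in> {X \<in> space ?M. \<exists>ls\<in>age_steps d n. path_event d z n ls X}"
        then obtain ls where ls: "ls \<in> age_steps d n" "path_event d z n ls X" "X \<in> space ?M" by auto
        then have "long_path d z n X"
          using path_dir_less[OF ls(1) d(2)] path_class_less[OF ls(1)]
          unfolding long_path_def path_event_def valid_path_def by blast
        then show "X \<in> A n" using ls by (simp add: A_def)
      qed
      then show ?thesis using \<beta>(2)[OF z, of n] by linarith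
    qed
    have "decseq A"
      unfolding decseq_def A_def using long_path_mono by blast
    then have "(\<lambda>n. prob (A n)) \<longlonglongrightarrow> prob (\<Inter>n. A n)"
      using A_ev by (intro finite_Lim_measure_decseq) auto
    then have "\<beta> \<le> prob (\<Inter>n. A n)"
      by (rule LIMSEQ_le_const) (use lower in auto)
    also have "\<dots> \<le> iid_prob ?I (infinite_paths_from_level d 0)"
      unfolding iid_prob_def
    proof (rule finite_measure_mono)
      show "(\<Inter>n. A n) \<subseteq> {X \<in> space ?M. infinite_paths_from_level d 0 X}"
        using z lev by (auto simp: A_def infinite_paths_from_level_def)
      show "{X \<in> space ?M. infinite_paths_from_level d 0 X} \<in> events"
        by (rule measurable_infinite_paths_from_level[OF d(2) coord_measurable_PiM_unif])
    qed
    finally have "iid_prob ?I (infinite_paths_from_level d 0) = 1"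
      using infinite_paths_from_level_prob_0_or_1[OF d(2)] \<beta>(1) by linarith
    then have "AE X in ?M. infinite_paths_from_level d 0 X"
      unfolding iid_prob_def
      by (subst (asm) prob_Collect_eq_1) (auto intro!: measurable_infinite_paths_from_level[OF d(2) coord_measurable_PiM_unif])
    moreover have "ages (lattice_graph d) = ?M" unfolding ages_def lattice_graph_def by simp
    ultimately show "AE X in ages (lattice_graph d). infinite_paths_from_level d 0 X" by (simp only:)
  qed
qed

theorem theorem3:
  shows "\<exists>d\<^sub>0. \<forall>d\<ge>d\<^sub>0. AE X in ages (lattice_graph d).
           \<exists>C. connected_component_of_graph (layer 4 (lattice_graph d) X) C \<and> infinite (verts C)"
proof -
  obtain d0 where d0: "\<And>d. d \<ge> d0 \<Longrightarrow> AE X in ages (lattice_graph d). infinite_paths_from_level d 0 X"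
    using infinite_paths_from_level_almost_surely by blast
  show ?thesis
  proof (intro exI[of _ d0] allI impI)
    fix d assume "d0 \<le> d"
    from d0[OF this] show "AE X in ages (lattice_graph d).
        \<exists>C. connected_component_of_graph (layer 4 (lattice_graph d) X) C \<and> infinite (verts C)"
      by eventually_elim (auto simp: infinite_paths_from_level_def intro: infinite_component_if_long_paths)
  qed
qed

end
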